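(* Let $\mathcal{K}$ be a finite totally chiral polytope of type $\{p_1,\dots,p_{n-2}\}$ with directly regular facets. Let $\mathcal{P}=U(\mathcal{K})$, and let $\mathcal{Q}$ be the finite directly regular polytope of type $\{p_1,\dots,p_{n-2},2\}$ with facets isomorphic to $\mathcal{K}\diamond\overline{\mathcal{K}}$. Then $\mathcal{P}\diamond\mathcal{Q}$ is a chiral polytope with directly regular facets.
   Context: All polytopes are abstract polytopes. A regular polytope is directly regular if its rotation group $\Gamma^+$, generated by $\sigma_i=\rho_{i-1}\rho_i$ ($\rho_i$ the standard generating involutions relative to a base flag), has index $2$ in the automorphism group. A polytope is chiral if its automorphism group has two orbits on flags, adjacent flags lying in distinct orbits; then $\Gamma^+(\mathcal{P})$ is its automorphism group, generated by standard rotations $\sigma_1,\dots,\sigma_{m-1}$ (rank $m$), satisfying $(\sigma_i\cdots\sigma_j)^2=1$ for $i<j$; the type is $\{p_1,\dots,p_{m-1}\}$ with $p_i$ the order of $\sigma_i$. For a chiral polytope $\mathcal{K}$ with directly regular facets, $U(\mathcal{K})$ denotes the universal chiral polytope with facets isomorphic to $\mathcal{K}$ (it exists and covers every chiral polytope with facets isomorphic to $\mathcal{K}$). Let $W^+=\langle \sigma_1,\dots,\sigma_{m-1}\mid (\sigma_i\cdots\sigma_j)^2=1,\ i<j\rangle$; rotation groups are $W^+/M$ for normal subgroups $M$. Let $w\mapsto\overline{w}$ be the automorphism of $W^+$ with $\sigma_1\mapsto\sigma_1^{-1}$, $\sigma_2\mapsto\sigma_1^2\sigma_2$, $\sigma_j\mapsto\sigma_j$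 ($j\ge3$); the mirror image $\overline{\mathcal{K}}$ of $\mathcal{K}$ with $\Gamma^+(\mathcal{K})=W^+/M$ has group $W^+/\overline M$. Chirality group: $X(\mathcal{K})=M\overline M/M$; $\mathcal{K}$ is totally chiral if $X(\mathcal{K})=\Gamma^+(\mathcal{K})$. Mix: if $\Gamma^+(\mathcal{P})=W^+/M$ and $\Gamma^+(\mathcal{Q})=W^+/K$, the mix $\mathcal{P}\diamond\mathcal{Q}$ is the (flag-connected pre-)polytope whose rotation group is the subgroup of $\Gamma^+(\mathcal{P})\times\Gamma^+(\mathcal{Q})$ generated by $(\sigma_i,\sigma_i')$, isomorphic to $W^+/(M\cap K)$; it is a polytope exactly when this group satisfies the intersection property $\Gamma^+_I\cap\Gamma^+_J=\Gamma^+_{I\cap J}$, where $\Gamma^+_I=\langle\tau_{i,j}: i\le j,\ i-1,j\in I\rangle$, $\tau_{i,j}=\sigma_i\cdots\sigma_j$, $\tau_{0,i}=\tau_{i,m}=1$. *)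

theory Defs
  imports "HOL-Algebra.Bij" "HOL-Algebra.Generated_Groups" "HOL-Algebra.Multiplicative_Group"
begin

section \<open>Abstract polytopes\<close>

text \<open>A poset is a relation \<open>r\<close> that is a partial order on \<open>Field r\<close>; the faces are the
  elements of \<open>Field r\<close>.\<close>

definition flags :: "'a rel \<Rightarrow> 'a set set" where
  "flags r = {\<Phi> \<in> Chains r. \<forall>C \<in> Chains r. \<Phi> \<subseteq> C \<longrightarrow> C = \<Phi>}"

text \<open>In a polytope all maximal chains below a face have the same size; the least face has
  rank \<open>-1\<close>.\<close>

definition face_rank :: "'a rel \<Rightarrow> 'a \<Rightarrow> int" where
  "face_rank r F = int (Max (card ` {C \<in> Chains r. C \<subseteq> underS r F})) - 1"

definition adjacent :: "'a rel \<Rightarrow> 'a set \<Rightarrow> 'a set \<Rightarrow> bool" where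
  "adjacent r \<Phi> \<Psi> \<longleftrightarrow> \<Phi> \<in> flags r \<and> \<Psi> \<in> flags r \<and> card (\<Phi> - \<Psi>) = 1 \<and> card (\<Psi> - \<Phi>) = 1"

definition i_adjacent :: "'a rel \<Rightarrow> nat \<Rightarrow> 'a set \<Rightarrow> 'a set \<Rightarrow> bool" where
  "i_adjacent r i \<Phi> \<Psi> \<longleftrightarrow> adjacent r \<Phi> \<Psi> \<and> (\<forall>F \<in> \<Phi> - \<Psi>. face_rank r F = int i)"

definition adj_flag :: "'a rel \<Rightarrow> nat \<Rightarrow> 'a set \<Rightarrow> 'a set" where
  "adj_flag r i \<Phi> = (THE \<Psi>. i_adjacent r i \<Phi> \<Psi>)"

definition strongly_flag_connected :: "'a rel \<Rightarrow> bool" where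
  "strongly_flag_connected r \<longleftrightarrow>
     (\<forall>\<Phi> \<in> flags r. \<forall>\<Psi> \<in> flags r.
        (\<Phi>, \<Psi>) \<in> {(A, B). adjacent r A B \<and> \<Phi> \<inter> \<Psi> \<subseteq> A \<and> \<Phi> \<inter> \<Psi> \<subseteq> B}\<^sup>*)"

definition diamond_condition :: "'a rel \<Rightarrow> bool" where
  "diamond_condition r \<longleftrightarrow>
     (\<forall>(F, G) \<in> r. face_rank r G = face_rank r F + 2 \<longrightarrow>
        card {H. (F, H) \<in> r \<and> (H, G) \<in> r \<and> H \<noteq> F \<and> H \<noteq> G} = 2)"

definition abstract_polytope :: "nat \<Rightarrow> 'a rel \<Rightarrow> bool" where
  "abstract_polytope n r \<longleftrightarrow>
     Partial_order r \<and>
     (\<exists>F \<in> Field r. \<forall>G \<in> Field r. (F, G) \<in> r) \<and>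
     (\<exists>F \<in> Field r. \<forall>G \<in> Field r. (G, F) \<in> r) \<and>
     (\<forall>\<Phi> \<in> flags r. card \<Phi> = n + 2) \<and>
     diamond_condition r \<and>
     strongly_flag_connected r"

definition facet :: "'a rel \<Rightarrow> 'a \<Rightarrow> 'a rel" where
  "facet r F = Restr r (under r F)"

definition poset_isomorphic :: "'a rel \<Rightarrow> 'b rel \<Rightarrow> bool" where
  "poset_isomorphic r s \<longleftrightarrow>
     (\<exists>f. bij_betw f (Field r) (Field s) \<and>
          (\<forall>x \<in> Field r. \<forall>y \<in> Field r. (x, y) \<in> r \<longleftrightarrow> (f x, f y) \<in> s))"

definition facets_isomorphic :: "nat \<Rightarrow> 'a rel \<Rightarrow> 'b rel \<Rightarrow> bool" where
  "facets_isomorphic n r s \<longleftrightarrow>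
     (\<forall>F \<in> Field r. face_rank r F = int n - 1 \<longrightarrow> poset_isomorphic (facet r F) s)"

text \<open>A covering preserves incidence, ranks and adjacency of flags.\<close>

definition covers :: "'a rel \<Rightarrow> 'b rel \<Rightarrow> bool" where
  "covers r s \<longleftrightarrow>
     (\<exists>f. f ` Field r = Field s \<and>
          (\<forall>(x, y) \<in> r. (f x, f y) \<in> s) \<and>
          (\<forall>x \<in> Field r. face_rank s (f x) = face_rank r x) \<and>
          (\<forall>i \<Phi> \<Psi>. i_adjacent r i \<Phi> \<Psi> \<longrightarrow> i_adjacent s i (f ` \<Phi>) (f ` \<Psi>)))"


section \<open>Automorphisms, regularity and chirality\<close>

definition aut_group :: "'a rel \<Rightarrow> ('a \<Rightarrow> 'a) monoid" where
  "aut_group r = (BijGroup (Field r))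
     \<lparr>carrier := {f \<in> Bij (Field r).
        \<forall>x \<in> Field r. \<forall>y \<in> Field r. (x, y) \<in> r \<longleftrightarrow> (f x, f y) \<in> r}\<rparr>"

definition flag_orbit_rel :: "'a rel \<Rightarrow> 'a set rel" where
  "flag_orbit_rel r =
     {(\<Phi>, \<Psi>). \<Phi> \<in> flags r \<and> \<Psi> \<in> flags r \<and> (\<exists>f \<in> carrier (aut_group r). f ` \<Phi> = \<Psi>)}"

definition regular_polytope :: "nat \<Rightarrow> 'a rel \<Rightarrow> bool" where
  "regular_polytope n r \<longleftrightarrow> abstract_polytope n r \<and> card (flags r // flag_orbit_rel r) = 1"

definition chiral_polytope :: "nat \<Rightarrow> 'a rel \<Rightarrow> bool" where
  "chiral_polytope n r \<longleftrightarrow> abstract_polytope n r \<and>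
     card (flags r // flag_orbit_rel r) = 2 \<and>
     (\<forall>\<Phi> \<Psi>. adjacent r \<Phi> \<Psi> \<longrightarrow> (\<Phi>, \<Psi>) \<notin> flag_orbit_rel r)"

text \<open>The involution \<open>\<rho>\<^sub>i\<close> of a regular polytope relative to the base flag \<open>\<Phi>\<close>.\<close>

definition standard_reflection :: "'a rel \<Rightarrow> 'a set \<Rightarrow> nat \<Rightarrow> ('a \<Rightarrow> 'a)" where
  "standard_reflection r \<Phi> i = (THE f. f \<in> carrier (aut_group r) \<and> f ` \<Phi> = adj_flag r i \<Phi>)"

definition directly_regular :: "nat \<Rightarrow> 'a rel \<Rightarrow> bool" where
  "directly_regular n r \<longleftrightarrow> regular_polytope n r \<and>
     (\<forall>\<Phi> \<in> flags r.
        card (rcosets\<^bsub>aut_group r\<^esub>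
          (generate (aut_group r)
            {standard_reflection r \<Phi> (i - 1) \<otimes>\<^bsub>aut_group r\<^esub> standard_reflection r \<Phi> i | i.
               1 \<le> i \<and> i < n})) = 2)"

definition facets_directly_regular :: "nat \<Rightarrow> 'a rel \<Rightarrow> bool" where
  "facets_directly_regular n r \<longleftrightarrow>
     (\<forall>F \<in> Field r. face_rank r F = int n - 1 \<longrightarrow> directly_regular (n - 1) (facet r F))"

text \<open>The standard rotation \<open>\<sigma>\<^sub>i\<close> maps the base flag \<open>\<Phi>\<close> to \<open>(\<Phi>\<^sup>i\<^sup>-\<^sup>1)\<^sup>i\<close>, where \<open>\<Phi>\<^sup>j\<close> is the flag
  \<open>j\<close>-adjacent to \<open>\<Phi>\<close>.  It exists for chiral polytopes as well as for regular ones.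
  Automorphisms act on the left, so for a regular polytope
  \<open>\<rho>\<^sub>i\<^sub>-\<^sub>1\<rho>\<^sub>i(\<Phi>) = \<rho>\<^sub>i\<^sub>-\<^sub>1(\<Phi>\<^sup>i) = (\<rho>\<^sub>i\<^sub>-\<^sub>1(\<Phi>))\<^sup>i = (\<Phi>\<^sup>i\<^sup>-\<^sup>1)\<^sup>i\<close>, that is, \<open>\<sigma>\<^sub>i = \<rho>\<^sub>i\<^sub>-\<^sub>1\<rho>\<^sub>i\<close>.\<close>

definition standard_rotation :: "'a rel \<Rightarrow> 'a set \<Rightarrow> nat \<Rightarrow> ('a \<Rightarrow> 'a)" where
  "standard_rotation r \<Phi> i =
     (THE f. f \<in> carrier (aut_group r) \<and> f ` \<Phi> = adj_flag r i (adj_flag r (i - 1) \<Phi>))"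

definition rotation_group :: "nat \<Rightarrow> 'a rel \<Rightarrow> 'a set \<Rightarrow> ('a \<Rightarrow> 'a) monoid" where
  "rotation_group n r \<Phi> = subgroup_generated (aut_group r) (standard_rotation r \<Phi> ` {1..<n})"

definition has_type :: "nat \<Rightarrow> 'a rel \<Rightarrow> 'a set \<Rightarrow> (nat \<Rightarrow> nat) \<Rightarrow> bool" where
  "has_type n r \<Phi> p \<longleftrightarrow>
     (\<forall>i \<in> {1..<n}. group.ord (rotation_group n r \<Phi>) (standard_rotation r \<Phi> i) = p i)"

text \<open>Characterises the universal chiral polytope \<open>U(K)\<close> up to isomorphism.  Since HOL cannot
  quantify over types inside a formula, the polytopes to be covered have natural numbers as faces;
  this loses nothing, because the group of a chiral polytope is finitely generated, so a chiral
  polytope has only countably many faces.\<close>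

definition universal_chiral :: "nat \<Rightarrow> 'a rel \<Rightarrow> 'b rel \<Rightarrow> bool" where
  "universal_chiral n K P \<longleftrightarrow> chiral_polytope n P \<and> facets_isomorphic n P K \<and>
     (\<forall>R :: nat rel. chiral_polytope n R \<and> facets_isomorphic n R K \<longrightarrow> covers P R)"


section \<open>The group \<open>W\<^sup>+\<close>\<close>

text \<open>Words in the generators; the letter \<open>(i, False)\<close> stands for \<open>\<sigma>\<^sub>i\<close> and \<open>(i, True)\<close> for its
  inverse.\<close>

type_synonym word = "(nat \<times> bool) list"

definition words :: "nat \<Rightarrow> word set" where
  "words m = lists ({1..<m} \<times> UNIV)"

definition tau_word :: "nat \<Rightarrow> nat \<Rightarrow> word" where
  "tau_word i j = map (\<lambda>k. (k, False)) [i..<Suc j]"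

inductive word_eq :: "nat \<Rightarrow> word \<Rightarrow> word \<Rightarrow> bool" for m where
  refl: "word_eq m u u"
| sym: "word_eq m u v \<Longrightarrow> word_eq m v u"
| trans: "word_eq m u v \<Longrightarrow> word_eq m v w \<Longrightarrow> word_eq m u w"
| append: "word_eq m u u' \<Longrightarrow> word_eq m v v' \<Longrightarrow> word_eq m (u @ v) (u' @ v')"
| cancel: "1 \<le> i \<Longrightarrow> i < m \<Longrightarrow> word_eq m [(i, b), (i, \<not> b)] []"
| relator: "1 \<le> i \<Longrightarrow> i < j \<Longrightarrow> j < m \<Longrightarrow> word_eq m (tau_word i j @ tau_word i j) []"

definition word_rel :: "nat \<Rightarrow> word rel" where
  "word_rel m = {(u, v). u \<in> words m \<and> v \<in> words m \<and> word_eq m u v}"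

definition Wplus :: "nat \<Rightarrow> word set monoid" where
  "Wplus m =
     \<lparr>carrier = words m // word_rel m,
      monoid.mult = (\<lambda>C D. \<Union>u \<in> C. \<Union>v \<in> D. word_rel m `` {u @ v}),
      one = word_rel m `` {[]}\<rparr>"

definition Wplus_gen :: "nat \<Rightarrow> nat \<Rightarrow> word set" where
  "Wplus_gen m i = word_rel m `` {[(i, False)]}"

text \<open>The automorphism of \<open>W\<^sup>+\<close> with \<open>\<sigma>\<^sub>1 \<mapsto> \<sigma>\<^sub>1\<^sup>-\<^sup>1\<close>, \<open>\<sigma>\<^sub>2 \<mapsto> \<sigma>\<^sub>1\<^sup>2\<sigma>\<^sub>2\<close>,
  \<open>\<sigma>\<^sub>j \<mapsto> \<sigma>\<^sub>j\<close> for \<open>j \<ge> 3\<close>.\<close>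

fun bar_letter :: "nat \<times> bool \<Rightarrow> word" where
  "bar_letter (i, b) =
     (if i = 1 then [(1, \<not> b)]
      else if i = 2 then
        (if b then [(2, True), (1, True), (1, True)] else [(1, False), (1, False), (2, False)])
      else [(i, b)])"

definition bar :: "nat \<Rightarrow> word set \<Rightarrow> word set" where
  "bar m C = (\<Union>w \<in> C. word_rel m `` {concat (map bar_letter w)})"

definition eval_word :: "('g, 'z) monoid_scheme \<Rightarrow> (nat \<Rightarrow> 'g) \<Rightarrow> word \<Rightarrow> 'g" where
  "eval_word G s w =
     foldr (\<lambda>(i, b) x. (if b then inv\<^bsub>G\<^esub> (s i) else s i) \<otimes>\<^bsub>G\<^esub> x) w \<one>\<^bsub>G\<^esub>"

text \<open>The homomorphism from \<open>W\<^sup>+\<close> to \<open>G\<close> sending the \<open>i\<close>-th generator to \<open>s i\<close> (provided that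
  the \<open>s i\<close> satisfy the defining relations, so that \<open>eval_word G s\<close> is constant on classes).\<close>

definition Wplus_hom :: "('g, 'z) monoid_scheme \<Rightarrow> (nat \<Rightarrow> 'g) \<Rightarrow> word set \<Rightarrow> 'g" where
  "Wplus_hom G s C = the_elem (eval_word G s ` C)"

text \<open>The normal subgroup \<open>M\<close> of \<open>W\<^sup>+\<close> for which the rotation group of the polytope, with base
  flag \<open>\<Phi>\<close>, is \<open>W\<^sup>+/M\<close>.\<close>

definition relation_subgroup :: "nat \<Rightarrow> 'a rel \<Rightarrow> 'a set \<Rightarrow> word set set" where
  "relation_subgroup n r \<Phi> =
     kernel (Wplus n) (rotation_group n r \<Phi>)
       (Wplus_hom (rotation_group n r \<Phi>) (standard_rotation r \<Phi>))"

text \<open>\<open>M\<close> \<open>bar M / M\<close> as a subgroup of \<open>W\<^sup>+/M\<close>.\<close>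

definition chirality_group :: "nat \<Rightarrow> 'a rel \<Rightarrow> 'a set \<Rightarrow> word set set monoid" where
  "chirality_group n r \<Phi> =
     (let M = relation_subgroup n r \<Phi>
      in (Wplus n)\<lparr>carrier := M <#>\<^bsub>Wplus n\<^esub> (bar n ` M)\<rparr> Mod M)"

definition totally_chiral :: "nat \<Rightarrow> 'a rel \<Rightarrow> 'a set \<Rightarrow> bool" where
  "totally_chiral n r \<Phi> \<longleftrightarrow> chiral_polytope n r \<and>
     carrier (chirality_group n r \<Phi>) = carrier (Wplus n Mod relation_subgroup n r \<Phi>)"


section \<open>Mixing\<close>

text \<open>A group together with its distinguished generators, indexed by \<open>1, \<dots>, m - 1\<close> for rank
  \<open>m\<close>.\<close>

type_synonym 'g rotation_system = "'g monoid \<times> (nat \<Rightarrow> 'g)"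

definition rotation_system :: "nat \<Rightarrow> 'a rel \<Rightarrow> 'a set \<Rightarrow> ('a \<Rightarrow> 'a) rotation_system" where
  "rotation_system n r \<Phi> = (rotation_group n r \<Phi>, standard_rotation r \<Phi>)"

text \<open>The mirror image of \<open>W\<^sup>+/M\<close>, namely \<open>W\<^sup>+/bar M\<close>.\<close>

definition mirror_rotation_system :: "nat \<Rightarrow> 'a rel \<Rightarrow> 'a set \<Rightarrow> word set set rotation_system" where
  "mirror_rotation_system n r \<Phi> =
     (let N = bar n ` relation_subgroup n r \<Phi>
      in (Wplus n Mod N, \<lambda>i. N #>\<^bsub>Wplus n\<^esub> Wplus_gen n i))"

definition tau :: "('g, 'z) monoid_scheme \<Rightarrow> (nat \<Rightarrow> 'g) \<Rightarrow> nat \<Rightarrow> nat \<Rightarrow> 'g" where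
  "tau G s i j = foldr (\<lambda>k x. s k \<otimes>\<^bsub>G\<^esub> x) [i..<Suc j] \<one>\<^bsub>G\<^esub>"

text \<open>The subgroup \<open>\<Gamma>\<^sup>+\<^sub>I\<close> for \<open>I \<subseteq> {0, \<dots>, m - 1}\<close>.\<close>

definition rotation_subgroup ::
  "nat \<Rightarrow> ('g, 'z) monoid_scheme \<Rightarrow> (nat \<Rightarrow> 'g) \<Rightarrow> nat set \<Rightarrow> 'g set" where
  "rotation_subgroup m G s I =
     generate G {tau G s i j | i j. 1 \<le> i \<and> i \<le> j \<and> j < m \<and> i - 1 \<in> I \<and> j \<in> I}"

text \<open>The (pre-)polytope of rank \<open>m\<close> with rotation group \<open>G\<close> and standard rotations \<open>s i\<close>: the
  faces of rank \<open>i\<close> are the cosets of the stabiliser \<open>\<Gamma>\<^sup>+\<^sub>I\<close>, \<open>I = {0, \<dots>, m - 1} - {i}\<close>, of the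
  base face of rank \<open>i\<close>, and two faces are incident iff the cosets intersect.  For \<open>i = -1\<close> and
  \<open>i = m\<close> this gives a single face, the coset \<open>G\<close>.  (The construction is the usual one for
  \<open>m \<ge> 3\<close>; chiral polytopes have rank at least 3.)\<close>

definition coset_faces ::
  "nat \<Rightarrow> ('g, 'z) monoid_scheme \<Rightarrow> (nat \<Rightarrow> 'g) \<Rightarrow> (int \<times> 'g set) set" where
  "coset_faces m G s =
     {(i, C). -1 \<le> i \<and> i \<le> int m \<and>
        C \<in> rcosets\<^bsub>G\<^esub> (rotation_subgroup m G s {k. k < m \<and> int k \<noteq> i})}"

definition coset_poset ::
  "nat \<Rightarrow> ('g, 'z) monoid_scheme \<Rightarrow> (nat \<Rightarrow> 'g) \<Rightarrow> (int \<times> 'g set) rel" where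
  "coset_poset m G s =
     {((i, C), (j, D)) | i C j D. (i, C) \<in> coset_faces m G s \<and> (j, D) \<in> coset_faces m G s \<and>
        i \<le> j \<and> C \<inter> D \<noteq> {}}"

text \<open>The mix, from the subgroup of the direct product generated by the pairs of generators.\<close>

fun mix :: "nat \<Rightarrow> 'g rotation_system \<Rightarrow> 'h rotation_system \<Rightarrow> (int \<times> ('g \<times> 'h) set) rel" where
  "mix m (G, s) (H, t) =
     coset_poset m (subgroup_generated (G \<times>\<times> H) ((\<lambda>i. (s i, t i)) ` {1..<m})) (\<lambda>i. (s i, t i))"

end

theory Submission
  imports Defs "HOL-Library.Countable_Set"
begin

text \<open>A polytope is determined by the chamber system of its flags, that is, by the action of the
  flag-adjacency involutions \<open>r i\<close> (\<open>i < n\<close>), which commute for non-adjacent indices.  The coset poset of a rotation group \<open>\<Gamma>\<close> comes from the chamber system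
  on two copies of \<open>\<Gamma>\<close>, and it is a polytope as soon as residues of chambers intersect properly.

  By the quotient criterion this holds for the mix of \<open>P\<close> and \<open>Q\<close>: its projection to \<open>Q\<close> is injective
  on facets, because a word in the facet generators that fixes a flag of the mix of \<open>K\<close> and its
  mirror image acts trivially on all flags of \<open>K\<close>, hence of the facets of \<open>P\<close>.  So the mix has the
  facets of \<open>Q\<close>, which are directly regular.

  The universal polytope \<open>P\<close> is infinite, since a covering of \<open>P\<close> given by the universal abelian cover
  of its facet graph is an infinite chiral polytope with the same facets.  Let \<open>M\<close> be the relation
  subgroup of \<open>P\<close> and \<open>M'\<close> that of its mirror image.  By total chirality of \<open>K\<close>, the index of \<open>M M'\<close>
  is at most 2, so the orbits of \<open>M'\<close> on the flags of \<open>P\<close> are infinite, whereas those on the flags of \<open>Q\<close> are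
  finite.  Some element of \<open>M'\<close> therefore fixes a flag of \<open>Q\<close> but not the base flag of \<open>P\<close>, and no
  automorphism of the mix can interchange the base flag with its mirror flag.\<close>

section \<open>Chamber systems\<close>

text \<open>The hypotheses speak of posets (facets, coverings), of permutation groups (rotations)
  and of words modulo relations (\<open>M\<close> and its mirror image). Chambers are where these
  meet: a word belongs to \<open>M\<close> exactly if it fixes the base flag, and to the mirror
  image of \<open>M\<close> exactly if it fixes the 0-adjacent flag. The theorem becomes a question
  of which words fix which flags. The bound 2 for the index has this origin. Total chirality of K
  writes every word in the facet generators as a word fixing the one flag followed by a word fixing
  the other. Only the last rotation is missing, and it may be replaced by the half-turn
  \<open>\<sigma>\<^sub>m\<^sub>-\<^sub>1\<sigma>\<^sub>m\<close> with \<open>m = n - 1\<close>; an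
  involution can at most double. A regular Q could in principle absorb the chirality of P. What
  prevents this is a mismatch of size, an infinite orbit against a finite one. Infinity of P is not
  visible in its definition: universality only says that P covers other polytopes, so an infinite
  chiral polytope with the right facets has to be constructed.\<close>

definition conn :: "(nat \<Rightarrow> 'x \<Rightarrow> 'x) \<Rightarrow> nat set \<Rightarrow> 'x \<Rightarrow> 'x \<Rightarrow> bool" where
  "conn r I x y \<longleftrightarrow> (\<exists>w \<in> lists I. fold r w x = y)"

abbreviation cot :: "nat \<Rightarrow> int \<Rightarrow> nat set" where
  "cot n i \<equiv> {k. k < n \<and> int k \<noteq> i}"

lemma conn_refl [simp]: "conn r I x x"
  unfolding conn_def by (rule bexI[of _ "[]"]) auto

lemma conn_trans: "conn r I x y \<Longrightarrow> conn r I y z \<Longrightarrow> conn r I x z"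
  unfolding conn_def
  by (metis append_in_lists_conv comp_apply fold_append)

lemma conn_mono: "conn r I x y \<Longrightarrow> I \<subseteq> J \<Longrightarrow> conn r J x y"
  unfolding conn_def using lists_mono by blast

lemma conn_step: "i \<in> I \<Longrightarrow> conn r I x (r i x)"
  unfolding conn_def by (rule bexI[of _ "[i]"]) auto

lemma conn_word: "w \<in> lists I \<Longrightarrow> conn r I x (fold r w x)"
  unfolding conn_def by blast

lemma conn_empty [simp]: "conn r {} x y \<longleftrightarrow> x = y"
  unfolding conn_def by auto

lemma conn_induct [consumes 1, case_names base step]:
  assumes "conn r I x y" and "P x" and "\<And>z i. conn r I x z \<Longrightarrow> P z \<Longrightarrow> i \<in> I \<Longrightarrow> P (r i z)"
  shows "P y"
proof -
  obtain w where w: "w \<in> lists I" "fold r w x = y" using assms(1) unfolding conn_def by blast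
  have "P (fold r w x)" using w(1)
  proof (induction w rule: rev_induct)
    case Nil then show ?case using assms(2) by simp
  next
    case (snoc i w)
    then show ?case using assms(3)[OF conn_word, of w i] by simp
  qed
  then show ?thesis using w by simp
qed

locale chamber_system =
  fixes n :: nat and X :: "'x set" and r :: "nat \<Rightarrow> 'x \<Rightarrow> 'x"
  assumes closed: "i < n \<Longrightarrow> x \<in> X \<Longrightarrow> r i x \<in> X"
    and invol: "i < n \<Longrightarrow> x \<in> X \<Longrightarrow> r i (r i x) = x"
    and commute: "i < n \<Longrightarrow> j < n \<Longrightarrow> i + 2 \<le> j \<Longrightarrow> x \<in> X \<Longrightarrow> r i (r j x) = r j (r i x)"
    and connected: "x \<in> X \<Longrightarrow> y \<in> X \<Longrightarrow> conn r {..<n} x y"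
    and nonempty: "X \<noteq> {}"
begin

lemma commute': "i < n \<Longrightarrow> j < n \<Longrightarrow> i + 2 \<le> j \<or> j + 2 \<le> i \<Longrightarrow> x \<in> X \<Longrightarrow> r i (r j x) = r j (r i x)"
  using commute by metis

lemma fold_closed: "w \<in> lists {..<n} \<Longrightarrow> x \<in> X \<Longrightarrow> fold r w x \<in> X"
  by (induction w arbitrary: x) (auto simp: closed)

lemma fold_rev: "w \<in> lists {..<n} \<Longrightarrow> x \<in> X \<Longrightarrow> fold r (rev w) (fold r w x) = x"
proof (induction w arbitrary: x)
  case (Cons i w)
  then show ?case using Cons.IH[of "r i x"] by (simp add: closed invol)
qed simp

lemma fold_rev': "w \<in> lists {..<n} \<Longrightarrow> x \<in> X \<Longrightarrow> fold r w (fold r (rev w) x) = x"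
  using fold_rev[of "rev w" x] by (simp add: in_lists_conv_set)

lemma fold_inj: "w \<in> lists {..<n} \<Longrightarrow> x \<in> X \<Longrightarrow> y \<in> X \<Longrightarrow> fold r w x = fold r w y \<Longrightarrow> x = y"
  by (metis fold_rev)

lemma conn_sym: "conn r I x y \<Longrightarrow> I \<subseteq> {..<n} \<Longrightarrow> x \<in> X \<Longrightarrow> conn r I y x"
proof -
  assume "conn r I x y" "I \<subseteq> {..<n}" "x \<in> X"
  then obtain w where "w \<in> lists I" "fold r w x = y" "w \<in> lists {..<n}"
    unfolding conn_def using lists_mono by blast
  then show ?thesis unfolding conn_def
    using fold_rev[of w x] \<open>x \<in> X\<close> by (intro bexI[of _ "rev w"]) auto
qed

lemma conn_closed: "conn r I x y \<Longrightarrow> I \<subseteq> {..<n} \<Longrightarrow> x \<in> X \<Longrightarrow> y \<in> X"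
  unfolding conn_def using fold_closed lists_mono by blast

lemma fold_commute:
  assumes "u \<in> lists {k. k < n \<and> (k + 2 \<le> i \<or> i + 2 \<le> k)}" "i < n" "x \<in> X"
  shows "r i (fold r u x) = fold r u (r i x)"
  using assms
proof (induction u arbitrary: x)
  case (Cons k u)
  then have k: "k < n" "k + 2 \<le> i \<or> i + 2 \<le> k" by auto
  have "r i (fold r u (r k x)) = fold r u (r i (r k x))" using Cons by (simp add: closed)
  also have "r i (r k x) = r k (r i x)" using Cons.prems k by (intro commute') auto
  finally show ?case by simp
qed simp

text \<open>The diagram of the commutation relations is a path, so removing the node \<open>j\<close> splits it.\<close>

lemma conn_cot_split:
  assumes "conn r (cot n j) x y" "x \<in> X"
  obtains z where "z \<in> X" "conn r {k. k < n \<and> j < int k} x z"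
    "conn r {k. k < n \<and> int k < j} z y"
proof -
  have "\<exists>z. conn r {k. k < n \<and> j < int k} x z \<and> conn r {k. k < n \<and> int k < j} z y"
    using assms
  proof (induction rule: conn_induct)
    case base
    then show ?case using conn_refl by metis
  next
    case (step y i)
    then obtain z where z: "conn r {k. k < n \<and> j < int k} x z" "conn r {k. k < n \<and> int k < j} z y"
      by blast
    have zX: "z \<in> X" using conn_closed[OF z(1)] step by auto
    show ?case
    proof (cases "int i < j")
      case True
      then have "conn r {k. k < n \<and> int k < j} z (r i y)"
        using step conn_trans[OF z(2) conn_step[of i]] by auto
      then show ?thesis using z by blast
    next
      case False
      then have i: "j < int i" "i < n" using step by auto
      obtain u where u: "u \<in> lists {k. k < n \<and> int k < j}" "y = fold r u z"
        using z(2) unfolding conn_def by blast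
      \<comment> \<open>The letters of \<open>u\<close> lie below \<open>j\<close> and
        \<open>i\<close> lies above it, so they are at least 2 apart and the new letter can be moved
        in front of them.\<close>
      have "r i y = fold r u (r i z)" unfolding u
      proof (rule fold_commute)
        show "u \<in> lists {k. k < n \<and> (k + 2 \<le> i \<or> i + 2 \<le> k)}" using u(1) i by auto
      qed (use i zX in auto)
      then have "conn r {k. k < n \<and> int k < j} (r i z) (r i y)" using conn_word u by metis
      moreover have "conn r {k. k < n \<and> j < int k} x (r i z)"
        using i by (intro conn_trans[OF z(1) conn_step]) auto
      ultimately show ?thesis by blast
    qed
  qed
  then obtain z where z: "conn r {k. k < n \<and> j < int k} x z" "conn r {k. k < n \<and> int k < j} z y"
    by blast
  moreover have "z \<in> X" by (rule conn_closed[OF z(1)]) (use assms(2) in auto)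
  ultimately show ?thesis using that by blast
qed

text \<open>Chambers are reached from one chamber by words over the natural numbers. This lets a
  polytope be rebuilt with natural numbers as faces, the form in which
  \<open>universal_chiral\<close> asks for it.\<close>

lemma countable: "countable X"
proof -
  obtain x where x: "x \<in> X" using nonempty by blast
  have "X \<subseteq> range (\<lambda>w. fold r w x)"
    using connected[OF x] unfolding conn_def by blast
  then show ?thesis by (rule countable_subset) (rule countable_image, simp)
qed

end

text \<open>\<open>intersection\<close> is strong flag-connectedness read on chambers: if two
  chambers share their faces of all ranks in \<open>J\<close>, some path joins them without changing
  any of these faces. \<open>fixpoint_free\<close> yields the second face that the diamond condition
  demands.\<close>

locale polytopal_chamber_system = chamber_system +
  assumes intersection: "x \<in> X \<Longrightarrow> y \<in> X \<Longrightarrow> J \<subseteq> {..<n} \<Longrightarrow>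
      (\<And>j. j \<in> J \<Longrightarrow> conn r (cot n (int j)) x y) \<Longrightarrow> conn r ({..<n} - J) x y"
    and fixpoint_free: "i < n \<Longrightarrow> x \<in> X \<Longrightarrow> r i x \<noteq> x"
begin

lemma conn_cot_eq:
  assumes "x \<in> X" "y \<in> X" "\<And>j. j < n \<Longrightarrow> conn r (cot n (int j)) x y"
  shows "x = y"
  using intersection[of x y "{..<n}"] assms by auto

lemma not_conn_cot: "i < n \<Longrightarrow> x \<in> X \<Longrightarrow> \<not> conn r (cot n (int i)) x (r i x)"
proof
  assume i: "i < n" "x \<in> X" and c: "conn r (cot n (int i)) x (r i x)"
  have "conn r (cot n (int j)) x (r i x)" if "j < n" for j
    using that c i by (cases "j = i") (auto intro!: conn_step)
  then show False using conn_cot_eq[of x "r i x"] fixpoint_free closed i by metis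
qed

end

text \<open>The faces of rank \<open>i\<close> are the residues of type \<open>cot n i\<close>; for the improper ranks \<open>-1\<close> and \<open>n\<close>
  this type is all of \<open>{..<n}\<close>, so that there is only one such face.\<close>

locale incidence_presentation = chamber_system n X r
  for n and X :: "'x set" and r +
  fixes s :: "'a rel" and face :: "'x \<Rightarrow> int \<Rightarrow> 'a"
  assumes Field_eq: "Field s = {face x i | x i. x \<in> X \<and> -1 \<le> i \<and> i \<le> int n}"
    and face_eq: "x \<in> X \<Longrightarrow> y \<in> X \<Longrightarrow> -1 \<le> i \<Longrightarrow> i \<le> int n \<Longrightarrow> -1 \<le> j \<Longrightarrow> j \<le> int n \<Longrightarrow>
      face x i = face y j \<longleftrightarrow> i = j \<and> conn r (cot n i) x y"
    and incident: "x \<in> X \<Longrightarrow> y \<in> X \<Longrightarrow> -1 \<le> i \<Longrightarrow> i \<le> int n \<Longrightarrow> -1 \<le> j \<Longrightarrow> j \<le> int n \<Longrightarrow>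
      (face x i, face y j) \<in> s \<longleftrightarrow> i \<le> j \<and> (\<exists>z \<in> X. face z i = face x i \<and> face z j = face y j)"
begin

definition flag_of :: "'x \<Rightarrow> 'a set" where
  "flag_of x = face x ` {-1..int n}"

lemma face_cong: "x \<in> X \<Longrightarrow> conn r I x y \<Longrightarrow> I \<subseteq> cot n i \<Longrightarrow> -1 \<le> i \<Longrightarrow> i \<le> int n \<Longrightarrow> face x i = face y i"
proof -
  assume a: "x \<in> X" "conn r I x y" "I \<subseteq> cot n i" "-1 \<le> i" "i \<le> int n"
  have c: "conn r (cot n i) x y" using a(2,3) by (rule conn_mono)
  have "y \<in> X" by (rule conn_closed[OF c]) (use a in auto)
  with c show ?thesis using a face_eq[of x y i i] by simp
qed

lemma face_mem: "x \<in> X \<Longrightarrow> -1 \<le> i \<Longrightarrow> i \<le> int n \<Longrightarrow> face x i \<in> Field s"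
  unfolding Field_eq by blast

lemma FieldE: "F \<in> Field s \<Longrightarrow> (\<And>x i. x \<in> X \<Longrightarrow> -1 \<le> i \<Longrightarrow> i \<le> int n \<Longrightarrow> F = face x i \<Longrightarrow> thesis) \<Longrightarrow> thesis"
  unfolding Field_eq by blast

lemma incidentE:
  assumes "(F, G) \<in> s"
  obtains z i j where "z \<in> X" "-1 \<le> i" "i \<le> j" "j \<le> int n" "F = face z i" "G = face z j"
proof -
  have FG: "F \<in> Field s" "G \<in> Field s" using assms by (auto simp: Field_def)
  then obtain x i y j where "x \<in> X" "y \<in> X" "-1 \<le> i" "i \<le> int n" "-1 \<le> j" "j \<le> int n"
    "F = face x i" "G = face y j" by (elim FieldE) blast
  note xy = this
  then have "(face x i, face y j) \<in> s" using assms by simp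
  then obtain z where "i \<le> j" "z \<in> X" "face z i = face x i" "face z j = face y j"
    using incident[OF xy(1-6)] by auto
  then show ?thesis using that[of z i j] xy by simp
qed

lemma incidentI: "z \<in> X \<Longrightarrow> -1 \<le> i \<Longrightarrow> i \<le> j \<Longrightarrow> j \<le> int n \<Longrightarrow> (face z i, face z j) \<in> s"
  using incident[of z z i j] by auto

text \<open>On the split path from \<open>x\<close> to \<open>y\<close>, letters above
  \<open>j\<close> come first and leave the faces up to rank \<open>j\<close> alone; letters below
  \<open>j\<close> follow and leave the faces from rank \<open>j\<close> on alone. The chamber in
  between is the one wanted. Transitivity of incidence and the extension of chains both rest on
  it.\<close>

lemma splice:
  assumes "x \<in> X" "y \<in> X" "-1 \<le> j" "j \<le> int n" "face x j = face y j"
  obtains z where "z \<in> X" "\<And>i. -1 \<le> i \<Longrightarrow> i \<le> j \<Longrightarrow> face z i = face x i"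
    "\<And>i. j \<le> i \<Longrightarrow> i \<le> int n \<Longrightarrow> face z i = face y i"
proof -
  have "conn r (cot n j) x y" using assms face_eq by blast
  then obtain z where z: "z \<in> X" "conn r {k. k < n \<and> j < int k} x z"
    "conn r {k. k < n \<and> int k < j} z y" by (rule conn_cot_split[OF _ assms(1)])
  have "face x i = face z i" if "-1 \<le> i" "i \<le> j" for i
    using assms(1) z(2) by (rule face_cong) (use that assms in auto)
  moreover have "face z i = face y i" if "j \<le> i" "i \<le> int n" for i
    using z(1,3) by (rule face_cong) (use that assms in auto)
  ultimately show ?thesis using that z(1) by metis
qed

lemma partial_order: "Partial_order s"
proof -
  have "(F, F) \<in> s" if "F \<in> Field s" for F
    using that by (rule FieldE) (auto intro: incidentI)
  then have "Refl s" unfolding refl_on_def by blast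
  moreover have "antisym s"
  proof (rule antisymI)
    fix F G assume "(F, G) \<in> s" "(G, F) \<in> s"
    then obtain z i j z' i' j' where a: "z \<in> X" "-1 \<le> i" "i \<le> j" "j \<le> int n" "F = face z i" "G = face z j"
      "z' \<in> X" "-1 \<le> i'" "i' \<le> j'" "j' \<le> int n" "G = face z' i'" "F = face z' j'"
      by (elim incidentE) blast
    then have "i = j'" "i' = j"
      using face_eq[of z z' i j'] face_eq[of z' z i' j] by force+
    then have "i = j" using a by simp
    then show "F = G" using a by simp
  qed
  moreover have "trans s"
  proof (rule transI)
    fix F G H assume "(F, G) \<in> s" "(G, H) \<in> s"
    then obtain z i j z' j' k where a: "z \<in> X" "-1 \<le> i" "i \<le> j" "j \<le> int n" "F = face z i" "G = face z j"
      "z' \<in> X" "-1 \<le> j'" "j' \<le> k" "k \<le> int n" "G = face z' j'" "H = face z' k"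
      by (elim incidentE) blast
    then have j': "j' = j" using face_eq[of z z' j j'] by force
    have "-1 \<le> j" "face z j = face z' j" using a j' by auto
    then obtain y where "y \<in> X" "face y i = face z i" "face y k = face z' k"
      using splice[of z z' j] a j' by metis
    then show "(F, H) \<in> s" using a j' incidentI[of y i k] by auto
  qed
  moreover have "s \<subseteq> Field s \<times> Field s" by (auto simp: Field_def)
  ultimately show ?thesis unfolding partial_order_on_def preorder_on_def by simp
qed

text \<open>Ranks are treated upwards, with a chamber that already carries the faces of
  \<open>C\<close> of lower rank. When \<open>C\<close> has a face of the next rank, some chamber
  carries it together with the highest lower face of \<open>C\<close>; splicing at that lower face
  joins the two.\<close>

lemma chain_lift:
  assumes C: "C \<in> Chains s"
  obtains x where "x \<in> X" "C \<subseteq> flag_of x"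
proof -
  have cmp: "(F, G) \<in> s \<or> (G, F) \<in> s" if "F \<in> C" "G \<in> C" for F G
    using C that unfolding Chains_def by blast
  have inF: "F \<in> Field s" if "F \<in> C" for F using cmp[OF that that] by (auto simp: Field_def)
  have "\<exists>x \<in> X. \<forall>y i. y \<in> X \<longrightarrow> -1 \<le> i \<longrightarrow> i \<le> int k - 2 \<longrightarrow> i \<le> int n \<longrightarrow> face y i \<in> C \<longrightarrow> face y i = face x i" for k :: nat
  proof (induction k)
    case 0
    then show ?case using nonempty by auto
  next
    case (Suc k)
    then obtain x where x: "x \<in> X" "\<And>y i. y \<in> X \<Longrightarrow> -1 \<le> i \<Longrightarrow> i \<le> int k - 2 \<Longrightarrow> i \<le> int n \<Longrightarrow> face y i \<in> C \<Longrightarrow> face y i = face x i"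
      by blast
    let ?l = "int k - 1"
    show ?case
    proof (cases "\<exists>y \<in> X. -1 \<le> ?l \<and> ?l \<le> int n \<and> face y ?l \<in> C")
      case False
      have "face y i = face x i" if "y \<in> X" "-1 \<le> i" "i \<le> int (Suc k) - 2" "i \<le> int n" "face y i \<in> C" for y i
        using x(2)[of y i] that False by (cases "i = ?l") auto
      then show ?thesis using x(1) by blast
    next
      case True
      then obtain y where y: "y \<in> X" "-1 \<le> ?l" "?l \<le> int n" "face y ?l \<in> C" by blast
      have same: "face z ?l = face y ?l" if "z \<in> X" "face z ?l \<in> C" for z
      proof -
        from cmp[OF that(2) y(4)] show ?thesis using incident[of z y ?l ?l] incident[of y z ?l ?l] that y by auto
      qed
      let ?J = "{j. -1 \<le> j \<and> j < ?l \<and> (\<exists>z \<in> X. face z j \<in> C)}"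
      have fin: "finite ?J" by (rule finite_subset[of _ "{-1..?l}"]) auto
      show ?thesis
      proof (cases "?J = {}")
        case True
        have "face z i = face y i" if "z \<in> X" "-1 \<le> i" "i \<le> int (Suc k) - 2" "i \<le> int n" "face z i \<in> C" for z i
          using that True same by (cases "i = ?l") auto
        then show ?thesis using y(1) by blast
      next
        case False
        define j where "j = Max ?J"
        have j: "j \<in> ?J" unfolding j_def using Max_in[OF fin False] .
        then obtain z where z: "z \<in> X" "face z j \<in> C" by blast
        have jj: "-1 \<le> j" "j < ?l" "j \<le> int n" using j y by auto
        have "(face z j, face y ?l) \<in> s"
        proof -
          have "(face y ?l, face z j) \<notin> s" using incident[of y z ?l j] z y jj by auto
          then show ?thesis using cmp z y by blast
        qed
        then obtain v where v: "v \<in> X" "face v j = face z j" "face v ?l = face y ?l"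
          using incident[of z y j ?l] z y jj by auto
        have "face x j = face v j" using x(2)[of z j] z jj v by auto
        then obtain u where u: "u \<in> X" "\<And>i. -1 \<le> i \<Longrightarrow> i \<le> j \<Longrightarrow> face u i = face x i"
          "\<And>i. j \<le> i \<Longrightarrow> i \<le> int n \<Longrightarrow> face u i = face v i"
          using splice[of x v j] x(1) v(1) jj by metis
        have "face w i = face u i" if w: "w \<in> X" "-1 \<le> i" "i \<le> int (Suc k) - 2" "i \<le> int n" "face w i \<in> C" for w i
        proof (cases "i = ?l")
          case True
          then show ?thesis using same[of w] w u(3)[of i] v jj y by simp
        next
          case False
          then have "i \<in> ?J" using w by auto
          then have "i \<le> j" unfolding j_def using Max_ge[OF fin] by blast
          then show ?thesis using x(2)[of w i] u(2)[of i] w False by auto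
        qed
        then show ?thesis using u(1) by blast
      qed
    qed
  qed
  from this[of "n + 2"] obtain x where x: "x \<in> X"
    "\<And>y i. y \<in> X \<Longrightarrow> -1 \<le> i \<Longrightarrow> i \<le> int n \<Longrightarrow> face y i \<in> C \<Longrightarrow> face y i = face x i" by auto
  have "C \<subseteq> flag_of x"
  proof
    fix F assume F: "F \<in> C"
    then obtain y i where "y \<in> X" "-1 \<le> i" "i \<le> int n" "F = face y i" using FieldE[OF inF[OF F]] by blast
    then show "F \<in> flag_of x" unfolding flag_of_def using x(2)[of y i] F by auto
  qed
  then show ?thesis using that x(1) by blast
qed

lemma inj_face: "x \<in> X \<Longrightarrow> inj_on (face x) {-1..int n}"
  by (rule inj_onI) (auto simp: face_eq)

lemma card_flag_of: "x \<in> X \<Longrightarrow> card (flag_of x) = n + 2"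
  unfolding flag_of_def using inj_face by (simp add: card_image)

lemma finite_flag_of: "finite (flag_of x)"
  unfolding flag_of_def by simp

lemma flag_of_chain: "x \<in> X \<Longrightarrow> flag_of x \<in> Chains s"
proof -
  assume x: "x \<in> X"
  have "(face x i, face x j) \<in> s \<or> (face x j, face x i) \<in> s" if "-1 \<le> i" "i \<le> int n" "-1 \<le> j" "j \<le> int n" for i j
    using incidentI[OF x, of i j] incidentI[OF x, of j i] that by linarith
  then show ?thesis unfolding Chains_def flag_of_def by auto
qed

lemma flags_eq: "flags s = flag_of ` X"
proof
  show "flags s \<subseteq> flag_of ` X"
  proof
    fix \<Phi> assume "\<Phi> \<in> flags s"
    then have c: "\<Phi> \<in> Chains s" "\<And>C. C \<in> Chains s \<Longrightarrow> \<Phi> \<subseteq> C \<Longrightarrow> C = \<Phi>" unfolding flags_def by auto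
    obtain x where "x \<in> X" "\<Phi> \<subseteq> flag_of x" using chain_lift[OF c(1)] by blast
    then show "\<Phi> \<in> flag_of ` X" using c(2)[OF flag_of_chain] by blast
  qed
  show "flag_of ` X \<subseteq> flags s"
  proof
    fix \<Phi> assume "\<Phi> \<in> flag_of ` X"
    then obtain x where x: "x \<in> X" "\<Phi> = flag_of x" by blast
    have "C = flag_of x" if C: "C \<in> Chains s" "flag_of x \<subseteq> C" for C
    proof -
      obtain y where y: "y \<in> X" "C \<subseteq> flag_of y" using chain_lift[OF C(1)] by blast
      then have "flag_of x = flag_of y" using C x
        by (metis card_flag_of card_subset_eq finite_flag_of order_trans)
      then show ?thesis using C y by blast
    qed
    then show "\<Phi> \<in> flags s" using x flag_of_chain unfolding flags_def by blast
  qed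
qed

lemma face_mem_flag_of: "x \<in> X \<Longrightarrow> y \<in> X \<Longrightarrow> -1 \<le> i \<Longrightarrow> i \<le> int n \<Longrightarrow>
    face y i \<in> flag_of x \<longleftrightarrow> face y i = face x i"
proof
  assume a: "x \<in> X" "y \<in> X" "-1 \<le> i" "i \<le> int n" and "face y i \<in> flag_of x"
  then obtain j where j: "-1 \<le> j" "j \<le> int n" "face y i = face x j" unfolding flag_of_def by auto
  then have "i = j" using face_eq[of y x i j] a by simp
  then show "face y i = face x i" using j by simp
qed (auto simp: flag_of_def)

lemma flag_of_eq_iff: "x \<in> X \<Longrightarrow> y \<in> X \<Longrightarrow>
    flag_of x = flag_of y \<longleftrightarrow> (\<forall>i. -1 \<le> i \<longrightarrow> i \<le> int n \<longrightarrow> face x i = face y i)"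
proof
  assume "x \<in> X" "y \<in> X" and eq: "flag_of x = flag_of y"
  have "face x i = face y i" if "-1 \<le> i" "i \<le> int n" for i
    using face_mem_flag_of[of y x i] that eq \<open>x \<in> X\<close> \<open>y \<in> X\<close> unfolding flag_of_def by auto
  then show "\<forall>i. -1 \<le> i \<longrightarrow> i \<le> int n \<longrightarrow> face x i = face y i" by blast
qed (auto simp: flag_of_def intro!: image_cong)

lemma face_extreme: "x \<in> X \<Longrightarrow> y \<in> X \<Longrightarrow> i = -1 \<or> i = int n \<Longrightarrow> face x i = face y i"
proof -
  assume a: "x \<in> X" "y \<in> X" "i = -1 \<or> i = int n"
  then have "cot n i = {..<n}" by auto
  then have "conn r (cot n i) x y" using connected a by simp
  then show ?thesis using face_eq[of x y i i] a by auto
qed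

text \<open>\<open>face_rank\<close> maximises over all chains strictly below the face. Each such
  chain extends to a flag, where only the ranks from -1 to \<open>i - 1\<close> are available; the
  faces of \<open>x\<close> of these ranks attain the bound.\<close>

lemma face_rank_face:
  assumes x: "x \<in> X" "-1 \<le> i" "i \<le> int n"
  shows "face_rank s (face x i) = i"
proof -
  let ?S = "{C \<in> Chains s. C \<subseteq> underS s (face x i)}"
  have bound: "finite C \<and> card C \<le> nat (i + 1)" if C: "C \<in> ?S" for C
  proof -
    obtain y where y: "y \<in> X" "C \<subseteq> flag_of y"
      using chain_lift C by blast
    have "C \<subseteq> face y ` {-1..i - 1}"
    proof
      fix F assume F: "F \<in> C"
      then have "F \<in> flag_of y" using y by blast
      then obtain j where j: "-1 \<le> j" "j \<le> int n" "F = face y j" unfolding flag_of_def by auto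
      have "(face y j, face x i) \<in> s" "face y j \<noteq> face x i" using that F j unfolding underS_def by auto
      then have "j \<le> i" "j = i \<longrightarrow> False" using incident[of y x j i] j x y by auto
      then show "F \<in> face y ` {-1..i - 1}" using j by auto
    qed
    then have sub: "C \<subseteq> face y ` {-1..i - 1}" .
    then have "card C \<le> card (face y ` {-1..i - 1})" by (intro card_mono) auto
    also have "\<dots> \<le> card {-1..i - 1}" by (rule card_image_le) simp
    finally have "card C \<le> nat (i + 1)" by simp
    moreover have "finite C" using sub by (rule finite_subset) simp
    ultimately show ?thesis by simp
  qed
  have mem: "face x ` {-1..i - 1} \<in> ?S"
  proof -
    have "face x ` {-1..i - 1} \<subseteq> flag_of x" unfolding flag_of_def using x by auto
    then have "face x ` {-1..i - 1} \<in> Chains s" using flag_of_chain[OF x(1)] unfolding Chains_def by blast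
    moreover have "face x ` {-1..i - 1} \<subseteq> underS s (face x i)"
      unfolding underS_def using incidentI[OF x(1)] x by (auto simp: face_eq)
    ultimately show ?thesis by blast
  qed
  have crd: "card (face x ` {-1..i - 1}) = nat (i + 1)"
    using inj_on_subset[OF inj_face[OF x(1)], of "{-1..i - 1}"] x by (simp add: card_image)
  have "nat (i + 1) \<in> card ` ?S" using imageI[OF mem, of card] crd by simp
  moreover have "finite (card ` ?S)"
    by (rule finite_subset[of _ "{..nat (i + 1)}"]) (use bound in auto)
  ultimately have "Max (card ` ?S) = nat (i + 1)" using bound by (intro Max_eqI) auto
  then show ?thesis unfolding face_rank_def using x by simp
qed

lemma face_rank_eqE:
  assumes "F \<in> Field s" "face_rank s F = i"
  obtains x where "x \<in> X" "F = face x i" "-1 \<le> i" "i \<le> int n"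
  by (rule FieldE[OF assms(1)]) (use assms(2) face_rank_face that in auto)

end

section \<open>Polytopal chamber systems give abstract polytopes\<close>

locale polytope_presentation = incidence_presentation n X r s face + polytopal_chamber_system n X r
  for n and X :: "'x set" and r and s :: "'a rel" and face
begin

lemma flag_of_inj: "x \<in> X \<Longrightarrow> y \<in> X \<Longrightarrow> flag_of x = flag_of y \<Longrightarrow> x = y"
proof -
  assume a: "x \<in> X" "y \<in> X" "flag_of x = flag_of y"
  have "conn r (cot n (int j)) x y" if "j < n" for j
    using flag_of_eq_iff[of x y] face_eq[of x y "int j" "int j"] a that by auto
  then show "x = y" using conn_cot_eq a by blast
qed

lemma face_step_other: "i < n \<Longrightarrow> x \<in> X \<Longrightarrow> j \<noteq> int i \<Longrightarrow> -1 \<le> j \<Longrightarrow> j \<le> int n \<Longrightarrow> face (r i x) j = face x j"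
  using face_cong[OF _ conn_step[of i "{i}" r x], of j] by auto

lemma face_step: "i < n \<Longrightarrow> x \<in> X \<Longrightarrow> face (r i x) (int i) \<noteq> face x (int i)"
  using face_eq[of x "r i x" "int i" "int i"] closed not_conn_cot[of i x] by auto

lemma flag_of_diff: "x \<in> X \<Longrightarrow> y \<in> X \<Longrightarrow>
    flag_of x - flag_of y = face x ` {i. -1 \<le> i \<and> i \<le> int n \<and> face x i \<noteq> face y i}"
proof -
  assume xy: "x \<in> X" "y \<in> X"
  have "face x i \<in> flag_of y \<longleftrightarrow> face x i = face y i" if "-1 \<le> i" "i \<le> int n" for i
    using face_mem_flag_of that xy by blast
  then show ?thesis unfolding flag_of_def[of x] by auto
qed

lemma flag_of_step_diff: "i < n \<Longrightarrow> x \<in> X \<Longrightarrow> flag_of x - flag_of (r i x) = {face x (int i)}"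
proof -
  assume i: "i < n" "x \<in> X"
  have "{j. -1 \<le> j \<and> j \<le> int n \<and> face x j \<noteq> face (r i x) j} = {int i}"
    using face_step_other[OF i] face_step[OF i] i by fastforce
  then show ?thesis using flag_of_diff[of x "r i x"] closed i by simp
qed

lemma flag_of_mem: "x \<in> X \<Longrightarrow> flag_of x \<in> flags s"
  using flags_eq by blast

lemma adjacent_step: "i < n \<Longrightarrow> x \<in> X \<Longrightarrow> adjacent s (flag_of x) (flag_of (r i x))"
  using flag_of_step_diff[of i x] flag_of_step_diff[of i "r i x"] invol[of i x] closed flag_of_mem
  unfolding adjacent_def by auto

text \<open>Adjacent flags differ in the face of one proper rank only. The intersection property for
  all other ranks leaves a path in a single letter, and an involution reaches only two
  chambers.\<close>

lemma adjacent_imp_step: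
  assumes x: "x \<in> X" and adj: "adjacent s (flag_of x) \<Psi>"
  obtains i where "i < n" "\<Psi> = flag_of (r i x)"
proof -
  obtain y where y: "y \<in> X" "\<Psi> = flag_of y"
    using adj flags_eq unfolding adjacent_def by blast
  let ?D = "{i. -1 \<le> i \<and> i \<le> int n \<and> face x i \<noteq> face y i}"
  have "card (face x ` ?D) = 1" using adj flag_of_diff[OF x y(1)] y unfolding adjacent_def by simp
  moreover have "inj_on (face x) ?D" using inj_face[OF x] by (rule inj_on_subset) auto
  ultimately have "card ?D = 1" by (simp add: card_image)
  then obtain j where j: "?D = {j}" using card_1_singletonE by blast
  have "j \<in> ?D" using j by blast
  then have j': "-1 \<le> j" "j \<le> int n" "face x j \<noteq> face y j" by auto
  then have "j \<noteq> -1" "j \<noteq> int n" using face_extreme[OF x y(1)] by blast+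
  then have k: "nat j < n" "j = int (nat j)" using j' by auto
  have "conn r (cot n (int q)) x y" if "q \<in> {..<n} - {nat j}" for q
  proof -
    have "int q \<notin> ?D" using j that k by auto
    then show ?thesis using that face_eq[of x y "int q" "int q"] x y by auto
  qed
  then have "conn r ({..<n} - ({..<n} - {nat j})) x y" by (intro intersection[OF x y(1)]) auto
  moreover have "{..<n} - ({..<n} - {nat j}) = {nat j}" using k by auto
  ultimately have "conn r {nat j} x y" by simp
  then have "y = x \<or> y = r (nat j) x"
    by (induction rule: conn_induct) (use invol k x in auto)
  then show ?thesis using that k y j' by auto
qed

lemma i_adjacent_iff:
  assumes x: "x \<in> X"
  shows "i_adjacent s i (flag_of x) \<Psi> \<longleftrightarrow> i < n \<and> \<Psi> = flag_of (r i x)"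
proof
  assume a: "i_adjacent s i (flag_of x) \<Psi>"
  then obtain k where k: "k < n" "\<Psi> = flag_of (r k x)"
    using adjacent_imp_step[OF x] unfolding i_adjacent_def by blast
  then have "face_rank s (face x (int k)) = int i"
    using a flag_of_step_diff[OF k(1) x] unfolding i_adjacent_def by auto
  then show "i < n \<and> \<Psi> = flag_of (r i x)" using k face_rank_face[OF x, of "int k"] by auto
next
  assume "i < n \<and> \<Psi> = flag_of (r i x)"
  then show "i_adjacent s i (flag_of x) \<Psi>"
    using adjacent_step[OF _ x] flag_of_step_diff[OF _ x] face_rank_face[OF x] unfolding i_adjacent_def by auto
qed

lemma adj_flag_eq: "i < n \<Longrightarrow> x \<in> X \<Longrightarrow> adj_flag s i (flag_of x) = flag_of (r i x)"
  unfolding adj_flag_def by (rule the_equality) (auto simp: i_adjacent_iff)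

lemma diamond: "diamond_condition s"
proof -
  have "card {H. (F, H) \<in> s \<and> (H, G) \<in> s \<and> H \<noteq> F \<and> H \<noteq> G} = 2"
    if FG: "(F, G) \<in> s" and rk: "face_rank s G = face_rank s F + 2" for F G
  proof -
    obtain z i j where z: "z \<in> X" "-1 \<le> i" "i \<le> j" "j \<le> int n" "F = face z i" "G = face z j"
      using FG by (rule incidentE)
    then have j: "j = i + 2" using rk face_rank_face by auto
    define k where "k = nat (i + 1)"
    have k: "k < n" "int k = i + 1" unfolding k_def using z j by auto
    let ?J = "{q. q < n \<and> int q \<noteq> i \<and> int q \<noteq> i + 1 \<and> int q \<noteq> i + 2}"
    have rz: "r k z \<in> X" using k z closed by blast
    have "{H. (F, H) \<in> s \<and> (H, G) \<in> s \<and> H \<noteq> F \<and> H \<noteq> G} = {face z (int k), face (r k z) (int k)}"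
    proof (intro equalityI subsetI)
      fix H assume "H \<in> {face z (int k), face (r k z) (int k)}"
      moreover have "face (r k z) i = F" "face (r k z) j = G"
        using face_step_other[OF k(1) z(1)] z k j by auto
      ultimately obtain y where y: "y \<in> X" "H = face y (int k)" "F = face y i" "G = face y j"
        using z rz by auto
      then have "(F, H) \<in> s" "(H, G) \<in> s" using incidentI[OF y(1)] z k j by auto
      moreover have "H \<noteq> F" "H \<noteq> G" using y face_eq[OF y(1) y(1)] z k j by auto
      ultimately show "H \<in> {H. (F, H) \<in> s \<and> (H, G) \<in> s \<and> H \<noteq> F \<and> H \<noteq> G}" by blast
    next
      fix H assume H: "H \<in> {H. (F, H) \<in> s \<and> (H, G) \<in> s \<and> H \<noteq> F \<and> H \<noteq> G}"
      have po: "refl_on (Field s) s" using partial_order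
        unfolding partial_order_on_def preorder_on_def by blast
      have inF: "F \<in> Field s" "G \<in> Field s" "H \<in> Field s" using FG H by (auto simp: Field_def)
      have "{F, H, G} \<in> Chains s" unfolding Chains_def
        using H FG refl_onD[OF po inF(1)] refl_onD[OF po inF(2)] refl_onD[OF po inF(3)] by auto
      then obtain x where x: "x \<in> X" "{F, H, G} \<subseteq> flag_of x" by (rule chain_lift)
      then have "H \<in> flag_of x" by blast
      then obtain l where l: "-1 \<le> l" "l \<le> int n" "H = face x l" unfolding flag_of_def by auto
      have F: "F = face x i" using face_mem_flag_of[OF x(1) z(1), of i] x z by auto
      have G: "G = face x j" using face_mem_flag_of[OF x(1) z(1), of j] x z by auto
      have "i \<le> l" "l \<le> j" using H F G l incident[OF x(1) x(1)] z by auto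
      moreover have "l \<noteq> i" "l \<noteq> j" using H F G l by auto
      ultimately have lk: "l = int k" using j k by auto
      have "conn r ({..<n} - {q. q < n \<and> (int q = i \<or> int q = j)}) z x"
      proof (rule intersection[OF z(1) x(1)])
        fix q assume "q \<in> {q. q < n \<and> (int q = i \<or> int q = j)}"
        then show "conn r (cot n (int q)) z x"
          using F G z face_eq[OF z(1) x(1), of "int q" "int q"] by auto
      qed auto
      \<comment> \<open>A path that keeps both \<open>F\<close> and \<open>G\<close> uses the letter
        \<open>k\<close> and letters of \<open>?J\<close>. As \<open>k\<close> commutes with all of
        \<open>?J\<close>, its occurrences can be moved to the start, where they cancel in
        pairs.\<close>
      then have "conn r ?J z x \<or> conn r ?J (r k z) x"
      proof (induction rule: conn_induct)
        case base
        then show ?case by simp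
      next
        case (step y q)
        show ?case
        proof (cases "q = k")
          case False
          then have "q \<in> ?J" using step k j by auto
          then have "conn r ?J y (r q y)" by (rule conn_step)
          then show ?thesis using step.IH conn_trans[of r ?J _ y "r q y"] by blast
        next
          case True
          have *: "conn r ?J (r k x') (r k y)" if c: "conn r ?J x' y" and x': "x' \<in> X" for x'
          proof -
            obtain w where w: "w \<in> lists ?J" "y = fold r w x'" using c unfolding conn_def by blast
            have "r k y = fold r w (r k x')" unfolding w
              by (rule fold_commute) (use w k x' in auto)
            then show ?thesis using conn_word[OF w(1), of r "r k x'"] by simp
          qed
          show ?thesis using step.IH *[of z] *[of "r k z"] invol k z rz True by auto
        qed
      qed
      then obtain y where y: "y \<in> {z, r k z}" "conn r ?J y x" by blast
      have "face y (int k) = face x (int k)"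
        using _ y(2) by (rule face_cong) (use y z rz k in auto)
      then show "H \<in> {face z (int k), face (r k z) (int k)}" using l lk y by auto
    qed
    then show ?thesis using face_step[OF k(1) z(1)] by simp
  qed
  then show ?thesis unfolding diamond_condition_def by auto
qed

lemma strong_connectivity: "strongly_flag_connected s"
proof -
  have "(flag_of x, flag_of y) \<in> {(A, B). adjacent s A B \<and> flag_of x \<inter> flag_of y \<subseteq> A \<and> flag_of x \<inter> flag_of y \<subseteq> B}\<^sup>*"
    (is "_ \<in> ?R\<^sup>*") if x: "x \<in> X" and y: "y \<in> X" for x y
  proof -
    define A where "A = flag_of x \<inter> flag_of y"
    let ?J = "{j. j < n \<and> face x (int j) = face y (int j)}"
    have c: "conn r ({..<n} - ?J) x y"
      by (rule intersection[OF x y]) (use face_eq[OF x y] in auto)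
    have sub: "A \<subseteq> flag_of z" if c: "conn r ({..<n} - ?J) x z" for z
    proof
      fix F assume F: "F \<in> A"
      then obtain i where i: "-1 \<le> i" "i \<le> int n" "F = face x i" unfolding A_def flag_of_def by auto
      then have "face x i = face y i" using F face_mem_flag_of[OF y x, of i] unfolding A_def by auto
      then have "face x i = face z i"
        using x c i by (intro face_cong[OF x c]) auto
      then show "F \<in> flag_of z" using i unfolding flag_of_def by auto
    qed
    let ?S = "{(B, C). adjacent s B C \<and> A \<subseteq> B \<and> A \<subseteq> C}"
    from c have "(flag_of x, flag_of y) \<in> ?S\<^sup>*"
    proof (induction rule: conn_induct)
      case base
      then show ?case by simp
    next
      case (step z i)
      have zX: "z \<in> X" using conn_closed[OF step.hyps(1)] x by auto
      have "i < n" using step.hyps(2) by simp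
      then have "adjacent s (flag_of z) (flag_of (r i z))" using adjacent_step zX by blast
      then have "(flag_of z, flag_of (r i z)) \<in> ?S"
        using sub[OF step.hyps(1)] sub[OF conn_trans[OF step.hyps(1) conn_step[OF step.hyps(2)]]]
        by simp
      then show ?case by (rule rtrancl_into_rtrancl[OF step.IH])
    qed
    then show ?thesis unfolding A_def .
  qed
  then show ?thesis unfolding strongly_flag_connected_def flags_eq by blast
qed

lemma abstract_polytope: "abstract_polytope n s"
proof -
  obtain x where x: "x \<in> X" using nonempty by blast
  have "(face x (-1), G) \<in> s \<and> (G, face x (int n)) \<in> s" if "G \<in> Field s" for G
  proof (rule FieldE[OF that])
    fix y i assume y: "y \<in> X" "-1 \<le> i" "i \<le> int n" "G = face y i"
    have "face x (-1) = face y (-1)" "face x (int n) = face y (int n)" using face_extreme[OF x y(1)] by auto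
    then show ?thesis using incidentI[OF y(1)] y by auto
  qed
  moreover have "face x (-1) \<in> Field s" "face x (int n) \<in> Field s" using face_mem[OF x] by auto
  moreover have "\<forall>\<Phi> \<in> flags s. card \<Phi> = n + 2" unfolding flags_eq using card_flag_of by blast
  ultimately show ?thesis unfolding abstract_polytope_def
    using partial_order diamond strong_connectivity by blast
qed

end

subsection \<open>The chamber system of flags\<close>

definition face_at :: "'a rel \<Rightarrow> 'a set \<Rightarrow> int \<Rightarrow> 'a" where
  "face_at s \<Phi> i = (THE F. F \<in> \<Phi> \<and> face_rank s F = i)"

context
  fixes n :: nat and s :: "'a rel"
  assumes polytope: "abstract_polytope n s"
begin

private lemma po: "Refl s" "antisym s" "trans s"
  using polytope unfolding abstract_polytope_def partial_order_on_def preorder_on_def by auto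

private lemma card_flag: "\<Phi> \<in> flags s \<Longrightarrow> card \<Phi> = n + 2"
  using polytope unfolding abstract_polytope_def by auto

private lemma finite_flag: "\<Phi> \<in> flags s \<Longrightarrow> finite \<Phi>"
  using card_flag card.infinite by fastforce

private lemma flag_chain: "\<Phi> \<in> flags s \<Longrightarrow> \<Phi> \<in> Chains s"
  unfolding flags_def by blast

private lemma flag_cmp: "\<Phi> \<in> flags s \<Longrightarrow> F \<in> \<Phi> \<Longrightarrow> G \<in> \<Phi> \<Longrightarrow> (F, G) \<in> s \<or> (G, F) \<in> s"
  unfolding flags_def Chains_def by blast

private lemma flag_Field: "\<Phi> \<in> flags s \<Longrightarrow> \<Phi> \<subseteq> Field s"
  using flag_cmp by (force simp: Field_def)

text \<open>There may be infinitely many faces, and the length of an arbitrary chain is not yet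
  bounded, so a flag above a given chain comes from Zorn's lemma. The bound \<open>n + 2\<close> for
  all chains is then a consequence.\<close>

private lemma chain_extend:
  assumes C: "C \<in> Chains s"
  obtains \<Phi> where "\<Phi> \<in> flags s" "C \<subseteq> \<Phi>"
proof -
  let ?A = "{D \<in> Chains s. C \<subseteq> D}"
  have "\<exists>M \<in> ?A. \<forall>X \<in> ?A. M \<subseteq> X \<longrightarrow> X = M"
  proof (rule subset_Zorn)
    fix \<C> assume ch: "subset.chain ?A \<C>"
    show "\<exists>U \<in> ?A. \<forall>X \<in> \<C>. X \<subseteq> U"
    proof (cases "\<C> = {}")
      case True
      then show ?thesis using C by blast
    next
      case False
      have sub: "\<C> \<subseteq> ?A" and lin: "\<And>X Y. X \<in> \<C> \<Longrightarrow> Y \<in> \<C> \<Longrightarrow> X \<subseteq> Y \<or> Y \<subseteq> X"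
        using ch unfolding subset_chain_def by blast+
      have "(a, b) \<in> s \<or> (b, a) \<in> s" if ab: "a \<in> \<Union>\<C>" "b \<in> \<Union>\<C>" for a b
      proof -
        obtain X Y where XY: "X \<in> \<C>" "Y \<in> \<C>" "a \<in> X" "b \<in> Y" using ab by blast
        then obtain Z where "Z \<in> \<C>" "a \<in> Z" "b \<in> Z" using lin[OF XY(1,2)] by blast
        then show ?thesis using sub unfolding Chains_def by blast
      qed
      then have "\<Union>\<C> \<in> Chains s" unfolding Chains_def by blast
      then show ?thesis using sub False by (intro bexI[of _ "\<Union>\<C>"]) auto
    qed
  qed
  then obtain M where M: "M \<in> ?A" "\<And>X. X \<in> ?A \<Longrightarrow> M \<subseteq> X \<Longrightarrow> X = M" by auto
  then have "M \<in> flags s" unfolding flags_def by auto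
  then show ?thesis using that M by blast
qed

private lemma chain_flagI: "C \<in> Chains s \<Longrightarrow> card C = n + 2 \<Longrightarrow> C \<in> flags s"
  using chain_extend[of C] card_flag card_subset_eq finite_flag by metis

private lemma chain_card: "C \<in> Chains s \<Longrightarrow> finite C \<and> card C \<le> n + 2"
proof -
  assume "C \<in> Chains s"
  then obtain \<Phi> where "\<Phi> \<in> flags s" "C \<subseteq> \<Phi>" by (rule chain_extend)
  then show ?thesis using card_flag finite_flag card_mono finite_subset by metis
qed

text \<open>A chain below \<open>F\<close> can replace the part of the flag below \<open>F\<close>:
  together with the faces of \<open>\<Phi>\<close> from \<open>F\<close> upwards it is still a
  chain, so it has at most as many elements as the part replaced. Thus the maximum in
  \<open>face_rank\<close> is attained inside any flag through \<open>F\<close>.\<close>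

private lemma rank_in_flag:
  assumes \<Phi>: "\<Phi> \<in> flags s" and F: "F \<in> \<Phi>"
  shows "face_rank s F = int (card (\<Phi> \<inter> underS s F)) - 1"
proof -
  let ?S = "{C \<in> Chains s. C \<subseteq> underS s F}" and ?D = "\<Phi> \<inter> underS s F" and ?U = "{G \<in> \<Phi>. (F, G) \<in> s}"
  have fin: "finite \<Phi>" using finite_flag \<Phi> by blast
  have FF: "(F, F) \<in> s" using flag_cmp[OF \<Phi> F F] by blast
  have "\<Phi> = ?D \<union> ?U" using flag_cmp[OF \<Phi> _ F] FF unfolding underS_def by blast
  moreover have disj: "A \<inter> ?U = {}" if "A \<subseteq> underS s F" for A
    using that po(2) unfolding underS_def antisym_def by blast
  ultimately have card\<Phi>: "n + 2 = card ?D + card ?U"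
    using card_Un_disjoint[of ?D ?U] fin card_flag[OF \<Phi>] by auto
  have bound: "card C \<le> card ?D" if C: "C \<in> ?S" for C
  proof -
    have "(a, b) \<in> s \<or> (b, a) \<in> s" if "a \<in> C \<union> ?U" "b \<in> C \<union> ?U" for a b
    proof -
      have below: "(c, u) \<in> s" if "c \<in> C" "u \<in> ?U" for c u
        using that C po(3) unfolding underS_def trans_def by blast
      show ?thesis using that below C flag_cmp[OF \<Phi>] unfolding Chains_def by blast
    qed
    then have "C \<union> ?U \<in> Chains s" unfolding Chains_def by blast
    then have "card (C \<union> ?U) \<le> n + 2" using chain_card by blast
    moreover have "finite C" using C chain_card by blast
    ultimately show ?thesis using card_Un_disjoint[of C ?U] disj[of C] C fin card\<Phi> by auto
  qed
  have "?D \<in> ?S" using flag_chain[OF \<Phi>] unfolding Chains_def by blast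
  then have "card ?D \<in> card ` ?S" by blast
  moreover have "finite (card ` ?S)" by (rule finite_subset[of _ "{..card ?D}"]) (use bound in auto)
  ultimately have "Max (card ` ?S) = card ?D" using bound by (intro Max_eqI) auto
  then show ?thesis unfolding face_rank_def by simp
qed

private lemma rank_strict_in_flag:
  assumes \<Phi>: "\<Phi> \<in> flags s" and "F \<in> \<Phi>" "G \<in> \<Phi>" "(F, G) \<in> s" "F \<noteq> G"
  shows "face_rank s F < face_rank s G"
proof -
  have "\<Phi> \<inter> underS s F \<subseteq> \<Phi> \<inter> underS s G"
    using assms po(2,3) unfolding underS_def trans_def antisym_def by blast
  moreover have "F \<in> \<Phi> \<inter> underS s G" "F \<notin> \<Phi> \<inter> underS s F" using assms unfolding underS_def by auto
  ultimately have "\<Phi> \<inter> underS s F \<subset> \<Phi> \<inter> underS s G" by blast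
  then have "card (\<Phi> \<inter> underS s F) < card (\<Phi> \<inter> underS s G)"
    using finite_flag[OF \<Phi>] by (intro psubset_card_mono) auto
  then show ?thesis using rank_in_flag assms by auto
qed

private lemma rank_strict: "(F, G) \<in> s \<Longrightarrow> F \<noteq> G \<Longrightarrow> face_rank s F < face_rank s G"
proof -
  assume a: "(F, G) \<in> s" "F \<noteq> G"
  have "(F, F) \<in> s" "(G, G) \<in> s" using a po(1) by (auto simp: refl_on_def Field_def)
  then have "{F, G} \<in> Chains s" using a unfolding Chains_def by auto
  then obtain \<Phi> where "\<Phi> \<in> flags s" "{F, G} \<subseteq> \<Phi>" by (rule chain_extend)
  then show ?thesis using rank_strict_in_flag a by auto
qed

private lemma rank_mono: "(F, G) \<in> s \<Longrightarrow> face_rank s F \<le> face_rank s G"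
  using rank_strict[of F G] by (cases "F = G") auto

private lemma rank_inj: "\<Phi> \<in> flags s \<Longrightarrow> inj_on (face_rank s) \<Phi>"
proof (rule inj_onI)
  fix F G assume "\<Phi> \<in> flags s" "F \<in> \<Phi>" "G \<in> \<Phi>" "face_rank s F = face_rank s G"
  then show "F = G" using flag_cmp[of \<Phi> F G] rank_strict[of F G] rank_strict[of G F] by auto
qed

private lemma rank_image: "\<Phi> \<in> flags s \<Longrightarrow> face_rank s ` \<Phi> = {-1..int n}"
proof (rule card_subset_eq)
  assume \<Phi>: "\<Phi> \<in> flags s"
  show "card (face_rank s ` \<Phi>) = card {-1..int n}"
    using card_image[OF rank_inj[OF \<Phi>]] card_flag[OF \<Phi>] by simp
  have "card (\<Phi> \<inter> underS s F) \<le> n + 1" if "F \<in> \<Phi>" for F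
  proof -
    have "\<Phi> \<inter> underS s F \<subseteq> \<Phi> - {F}" unfolding underS_def by blast
    then have "card (\<Phi> \<inter> underS s F) \<le> card (\<Phi> - {F})" using finite_flag[OF \<Phi>] by (intro card_mono) auto
    then show ?thesis using card_flag[OF \<Phi>] that finite_flag[OF \<Phi>] by simp
  qed
  then show "face_rank s ` \<Phi> \<subseteq> {-1..int n}" using rank_in_flag[OF \<Phi>] by force
qed simp

private lemma face_at:
  assumes "\<Phi> \<in> flags s" "-1 \<le> i" "i \<le> int n"
  shows "face_at s \<Phi> i \<in> \<Phi>" "face_rank s (face_at s \<Phi> i) = i"
proof -
  have "i \<in> face_rank s ` \<Phi>" using rank_image[OF assms(1)] assms by auto
  then have "\<exists>!F. F \<in> \<Phi> \<and> face_rank s F = i" using rank_inj[OF assms(1)] unfolding inj_on_def by blast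
  from theI'[OF this] show "face_at s \<Phi> i \<in> \<Phi>" "face_rank s (face_at s \<Phi> i) = i"
    unfolding face_at_def by auto
qed

private lemma face_atI:
  assumes "\<Phi> \<in> flags s" "F \<in> \<Phi>" "face_rank s F = i"
  shows "face_at s \<Phi> i = F" "-1 \<le> i" "i \<le> int n"
proof -
  have "i \<in> {-1..int n}" using rank_image[OF assms(1)] assms by blast
  then show "-1 \<le> i" "i \<le> int n" by auto
  then show "face_at s \<Phi> i = F"
    using face_at[OF assms(1), of i] rank_inj[OF assms(1)] assms unfolding inj_on_def by blast
qed

private lemma flag_eq: "\<Phi> \<in> flags s \<Longrightarrow> \<Phi> = face_at s \<Phi> ` {-1..int n}"
proof
  assume \<Phi>: "\<Phi> \<in> flags s"
  show "\<Phi> \<subseteq> face_at s \<Phi> ` {-1..int n}"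
  proof
    fix F assume "F \<in> \<Phi>"
    then show "F \<in> face_at s \<Phi> ` {-1..int n}" using face_atI[OF \<Phi>, of F] by (metis atLeastAtMost_iff imageI)
  qed
  show "face_at s \<Phi> ` {-1..int n} \<subseteq> \<Phi>" using face_at[OF \<Phi>] by auto
qed

private lemma flag_eqI: "\<Phi> \<in> flags s \<Longrightarrow> \<Psi> \<in> flags s \<Longrightarrow>
    (\<And>i. -1 \<le> i \<Longrightarrow> i \<le> int n \<Longrightarrow> face_at s \<Phi> i = face_at s \<Psi> i) \<Longrightarrow> \<Phi> = \<Psi>"
  using flag_eq[of \<Phi>] flag_eq[of \<Psi>] by (metis (no_types, lifting) atLeastAtMost_iff image_cong)

private lemma face_at_mono: "\<Phi> \<in> flags s \<Longrightarrow> -1 \<le> i \<Longrightarrow> i \<le> j \<Longrightarrow> j \<le> int n \<Longrightarrow> (face_at s \<Phi> i, face_at s \<Phi> j) \<in> s"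
proof -
  assume a: "\<Phi> \<in> flags s" "-1 \<le> i" "i \<le> j" "j \<le> int n"
  note fi = face_at[OF a(1), of i] and fj = face_at[OF a(1), of j]
  have "(face_at s \<Phi> i, face_at s \<Phi> j) \<in> s \<or> (face_at s \<Phi> j, face_at s \<Phi> i) \<in> s"
    using flag_cmp[OF a(1)] fi fj a by simp
  moreover have "(face_at s \<Phi> i, face_at s \<Phi> j) \<in> s" if "(face_at s \<Phi> j, face_at s \<Phi> i) \<in> s"
  proof (cases "face_at s \<Phi> i = face_at s \<Phi> j")
    case True
    then show ?thesis using that by simp
  next
    case False
    then have "face_rank s (face_at s \<Phi> j) < face_rank s (face_at s \<Phi> i)" using rank_strict[OF that] by metis
    then show ?thesis using fi(2) fj(2) a by linarith
  qed
  ultimately show ?thesis by blast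
qed

private lemma face_at_extreme:
  assumes "\<Phi> \<in> flags s" "\<Psi> \<in> flags s" "i = -1 \<or> i = int n"
  shows "face_at s \<Phi> i = face_at s \<Psi> i"
proof -
  obtain B T where B: "B \<in> Field s" "\<And>G. G \<in> Field s \<Longrightarrow> (B, G) \<in> s"
    and T: "T \<in> Field s" "\<And>G. G \<in> Field s \<Longrightarrow> (G, T) \<in> s"
    using polytope unfolding abstract_polytope_def by blast
  have *: "face_at s \<Phi> (-1) = B \<and> face_at s \<Phi> (int n) = T" if \<Phi>: "\<Phi> \<in> flags s" for \<Phi>
  proof -
    have "face_at s \<Phi> (-1) \<in> Field s" "face_at s \<Phi> (int n) \<in> Field s"
      using face_at[OF \<Phi>] flag_Field[OF \<Phi>] by auto
    then have b: "(B, face_at s \<Phi> (-1)) \<in> s" "(face_at s \<Phi> (int n), T) \<in> s" using B T by auto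
    obtain \<Phi>1 where 1: "\<Phi>1 \<in> flags s" "{B} \<subseteq> \<Phi>1" using B by (rule_tac chain_extend[of "{B}"]) (auto simp: Chains_def)
    obtain \<Phi>2 where 2: "\<Phi>2 \<in> flags s" "{T} \<subseteq> \<Phi>2" using T by (rule_tac chain_extend[of "{T}"]) (auto simp: Chains_def)
    have "-1 \<le> face_rank s B" "face_rank s T \<le> int n"
      using face_atI(2)[OF 1(1), of B] face_atI(3)[OF 2(1), of T] 1 2 by auto
    then show ?thesis using rank_strict[OF b(1)] rank_strict[OF b(2)] face_at(2)[OF \<Phi>, of "-1"] face_at(2)[OF \<Phi>, of "int n"]
      by fastforce
  qed
  show ?thesis using *[OF assms(1)] *[OF assms(2)] assms(3) by auto
qed

private lemma diamond_pair:
  assumes \<Phi>: "\<Phi> \<in> flags s" and i: "i < n"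
  shows "\<exists>F'. F' \<noteq> face_at s \<Phi> (int i) \<and> (\<forall>H. H \<in> {face_at s \<Phi> (int i), F'} \<longleftrightarrow>
      (face_at s \<Phi> (int i - 1), H) \<in> s \<and> (H, face_at s \<Phi> (int i + 1)) \<in> s \<and> face_rank s H = int i)"
proof -
  let ?F = "face_at s \<Phi>"
  let ?S = "{H. (?F (int i - 1), H) \<in> s \<and> (H, ?F (int i + 1)) \<in> s \<and> H \<noteq> ?F (int i - 1) \<and> H \<noteq> ?F (int i + 1)}"
  have "card ?S = 2"
    using polytope face_at_mono[OF \<Phi>, of "int i - 1" "int i + 1"] face_at(2)[OF \<Phi>, of "int i - 1"]
      face_at(2)[OF \<Phi>, of "int i + 1"] i
    unfolding abstract_polytope_def diamond_condition_def by fastforce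
  moreover have S: "H \<in> ?S \<longleftrightarrow> (?F (int i - 1), H) \<in> s \<and> (H, ?F (int i + 1)) \<in> s \<and> face_rank s H = int i" for H
    using rank_strict[of "?F (int i - 1)" H] rank_strict[of H "?F (int i + 1)"]
      face_at(2)[OF \<Phi>, of "int i - 1"] face_at(2)[OF \<Phi>, of "int i + 1"] i by auto
  moreover have "?F (int i) \<in> ?S"
    unfolding S using face_at_mono[OF \<Phi>, of "int i - 1" "int i"] face_at_mono[OF \<Phi>, of "int i" "int i + 1"]
      face_at(2)[OF \<Phi>, of "int i"] i by auto
  ultimately obtain F' where F': "F' \<noteq> ?F (int i)" "?S = {?F (int i), F'}"
    by (metis (no_types, lifting) card_2_iff doubleton_eq_iff insertE singletonD)
  have "H \<in> {?F (int i), F'} \<longleftrightarrow> (?F (int i - 1), H) \<in> s \<and> (H, ?F (int i + 1)) \<in> s \<and> face_rank s H = int i" for H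
    using S[of H] unfolding F'(2) .
  then show ?thesis using F'(1) by blast
qed

text \<open>The diamond condition offers exactly one face \<open>F'\<close> to exchange for the face
  of rank \<open>i\<close>. The exchanged set is a chain with \<open>n + 2\<close> elements, hence a
  flag; any other candidate has its new face between the same two neighbours, so that face is
  \<open>F'\<close> again.\<close>

private lemma adj_flag_ex1:
  assumes \<Phi>: "\<Phi> \<in> flags s" and i: "i < n"
  shows "\<exists>!\<Psi>. i_adjacent s i \<Phi> \<Psi>"
proof -
  let ?F = "face_at s \<Phi>"
  obtain F' where F': "F' \<noteq> ?F (int i)"
    "\<And>H. H \<in> {?F (int i), F'} \<longleftrightarrow> (?F (int i - 1), H) \<in> s \<and> (H, ?F (int i + 1)) \<in> s \<and> face_rank s H = int i"
    using diamond_pair[OF \<Phi> i] by blast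
  have Fi: "?F (int i) \<in> \<Phi>" "face_rank s (?F (int i)) = int i" using face_at[OF \<Phi>, of "int i"] i by auto
  have F'': "(?F (int i - 1), F') \<in> s" "(F', ?F (int i + 1)) \<in> s" "face_rank s F' = int i" using F'(2) by auto
  have notin: "F' \<notin> \<Phi>" using F'(1) F''(3) Fi rank_inj[OF \<Phi>] unfolding inj_on_def by metis
  let ?\<Psi> = "insert F' (\<Phi> - {?F (int i)})"
  have fin: "finite \<Phi>" using finite_flag \<Phi> by blast
  have F'F': "(F', F') \<in> s" using F''(1) po(1) by (auto simp: refl_on_def Field_def)
  have cmp: "(G, F') \<in> s \<or> (F', G) \<in> s" if G: "G \<in> \<Phi>" "G \<noteq> ?F (int i)" for G
  proof -
    let ?k = "face_rank s G"
    have k: "G = ?F ?k" "-1 \<le> ?k" "?k \<le> int n" using face_atI[OF \<Phi> G(1)] by auto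
    then have "?k \<noteq> int i" using G by auto
    then consider "?k \<le> int i - 1" | "int i + 1 \<le> ?k" by linarith
    then show ?thesis
    proof cases
      case 1
      then have "(G, ?F (int i - 1)) \<in> s" using face_at_mono[OF \<Phi>, of ?k "int i - 1"] k i by auto
      then show ?thesis using F'' po(3) by (meson transD)
    next
      case 2
      then have "(?F (int i + 1), G) \<in> s" using face_at_mono[OF \<Phi>, of "int i + 1" ?k] k i by auto
      then show ?thesis using F'' po(3) by (meson transD)
    qed
  qed
  have "?\<Psi> \<in> Chains s" unfolding Chains_def using cmp F'F' flag_cmp[OF \<Phi>] by blast
  moreover have "card ?\<Psi> = n + 2" using fin notin Fi card_flag[OF \<Phi>] by simp
  ultimately have \<Psi>: "?\<Psi> \<in> flags s" by (rule chain_flagI)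
  have "\<Phi> - ?\<Psi> = {?F (int i)}" "?\<Psi> - \<Phi> = {F'}" using F'(1) notin Fi by auto
  then have "i_adjacent s i \<Phi> ?\<Psi>" unfolding i_adjacent_def adjacent_def using \<Phi> \<Psi> Fi by auto
  moreover have "\<Psi>' = ?\<Psi>" if adj: "i_adjacent s i \<Phi> \<Psi>'" for \<Psi>'
  proof -
    have \<Psi>': "\<Psi>' \<in> flags s" using adj unfolding i_adjacent_def adjacent_def by blast
    obtain F1 H where F1: "\<Phi> - \<Psi>' = {F1}" and H: "\<Psi>' - \<Phi> = {H}"
      using adj unfolding i_adjacent_def adjacent_def by (metis card_1_singletonE)
    have "face_rank s F1 = int i" "F1 \<in> \<Phi>" using adj F1 unfolding i_adjacent_def by auto
    then have F1': "F1 = ?F (int i)" using face_atI[OF \<Phi>, of F1] by auto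
    have eq: "\<Psi>' = insert H (\<Phi> - {?F (int i)})" using F1 H F1' by blast
    let ?G = "face_at s \<Psi>'"
    have G: "?G (int i) \<in> \<Psi>'" "face_rank s (?G (int i)) = int i" using face_at[OF \<Psi>', of "int i"] i by auto
    have "?G (int i) = H"
    proof (rule ccontr)
      assume "?G (int i) \<noteq> H"
      then have "?G (int i) \<in> \<Phi>" "?G (int i) \<noteq> ?F (int i)" using G eq by auto
      then show False using face_atI[OF \<Phi>, of "?G (int i)"] G by auto
    qed
    moreover have same: "?G k = ?F k" if "k \<noteq> int i" "-1 \<le> k" "k \<le> int n" for k
    proof -
      have "?F k \<noteq> ?F (int i)" using face_at(2)[OF \<Phi>, of k] Fi that by auto
      then have "?F k \<in> \<Psi>'" using eq face_at(1)[OF \<Phi>, of k] that by blast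
      then show ?thesis using face_atI[OF \<Psi>', of "?F k"] face_at(2)[OF \<Phi>, of k] that by blast
    qed
    ultimately have "(?F (int i - 1), H) \<in> s \<and> (H, ?F (int i + 1)) \<in> s \<and> face_rank s H = int i"
      using face_at_mono[OF \<Psi>', of "int i - 1" "int i"] face_at_mono[OF \<Psi>', of "int i" "int i + 1"] G i by auto
    then have "H \<in> {?F (int i), F'}" using F'(2) by blast
    moreover have "H \<noteq> ?F (int i)" using H Fi by blast
    ultimately show ?thesis using eq by blast
  qed
  ultimately show ?thesis by blast
qed

private lemma adj_flag_adjacent: "\<Phi> \<in> flags s \<Longrightarrow> i < n \<Longrightarrow> i_adjacent s i \<Phi> (adj_flag s i \<Phi>)"
  unfolding adj_flag_def using theI'[OF adj_flag_ex1] .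

private lemma adj_flag_unique: "\<Phi> \<in> flags s \<Longrightarrow> i < n \<Longrightarrow> i_adjacent s i \<Phi> \<Psi> \<Longrightarrow> adj_flag s i \<Phi> = \<Psi>"
  using adj_flag_adjacent adj_flag_ex1 by blast

private lemma adj_flag_closed: "\<Phi> \<in> flags s \<Longrightarrow> i < n \<Longrightarrow> adj_flag s i \<Phi> \<in> flags s"
  using adj_flag_adjacent unfolding i_adjacent_def adjacent_def by blast

private lemma face_at_adjacent:
  assumes adj: "adjacent s \<Phi> \<Psi>"
  obtains i where "i < n" "i_adjacent s i \<Phi> \<Psi>"
    "\<And>j. -1 \<le> j \<Longrightarrow> j \<le> int n \<Longrightarrow> face_at s \<Psi> j = face_at s \<Phi> j \<longleftrightarrow> j \<noteq> int i"
proof -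
  have \<Phi>\<Psi>: "\<Phi> \<in> flags s" "\<Psi> \<in> flags s" using adj unfolding adjacent_def by auto
  obtain F where F: "\<Phi> - \<Psi> = {F}" using adj unfolding adjacent_def by (metis card_1_singletonE)
  let ?i = "face_rank s F"
  have FF: "face_at s \<Phi> ?i = F" "-1 \<le> ?i" "?i \<le> int n" using face_atI[OF \<Phi>\<Psi>(1), of F] F by auto
  have ne: "face_at s \<Psi> ?i \<noteq> F" using face_at(1)[OF \<Phi>\<Psi>(2), of ?i] F FF by auto
  have "?i \<noteq> -1" "?i \<noteq> int n" using face_at_extreme[OF \<Phi>\<Psi>] FF ne by metis+
  then have i: "?i = int (nat ?i)" "nat ?i < n" using FF by auto
  have "face_at s \<Psi> j = face_at s \<Phi> j \<longleftrightarrow> j \<noteq> int (nat ?i)" if j: "-1 \<le> j" "j \<le> int n" for j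
  proof
    show "face_at s \<Psi> j = face_at s \<Phi> j \<Longrightarrow> j \<noteq> int (nat ?i)" using ne FF i by auto
    assume "j \<noteq> int (nat ?i)"
    then have "face_at s \<Phi> j \<noteq> F" using face_at(2)[OF \<Phi>\<Psi>(1) j] i by auto
    then have "face_at s \<Phi> j \<in> \<Psi>" using face_at(1)[OF \<Phi>\<Psi>(1) j] F by blast
    then show "face_at s \<Psi> j = face_at s \<Phi> j" using face_atI[OF \<Phi>\<Psi>(2)] face_at(2)[OF \<Phi>\<Psi>(1) j] by blast
  qed
  moreover have "i_adjacent s (nat ?i) \<Phi> \<Psi>" using adj F i unfolding i_adjacent_def by auto
  ultimately show ?thesis using that i by blast
qed

private lemma face_at_adj:
  assumes "\<Phi> \<in> flags s" "i < n" "-1 \<le> j" "j \<le> int n"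
  shows "face_at s (adj_flag s i \<Phi>) j = face_at s \<Phi> j \<longleftrightarrow> j \<noteq> int i"
proof -
  have adj: "i_adjacent s i \<Phi> (adj_flag s i \<Phi>)" using adj_flag_adjacent assms by blast
  then obtain k where k: "k < n" "i_adjacent s k \<Phi> (adj_flag s i \<Phi>)"
    "\<And>j. -1 \<le> j \<Longrightarrow> j \<le> int n \<Longrightarrow> face_at s (adj_flag s i \<Phi>) j = face_at s \<Phi> j \<longleftrightarrow> j \<noteq> int k"
    using face_at_adjacent[of \<Phi> "adj_flag s i \<Phi>"] unfolding i_adjacent_def by blast
  have "k = i" using adj k(2) unfolding i_adjacent_def adjacent_def
    by (metis card_1_singletonE insertI1 of_nat_eq_iff)
  then show ?thesis using k(3) assms by blast
qed

private lemma i_adjacent_sym: "i_adjacent s i \<Phi> \<Psi> \<Longrightarrow> i < n \<Longrightarrow> i_adjacent s i \<Psi> \<Phi>"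
proof -
  assume a: "i_adjacent s i \<Phi> \<Psi>" and i: "i < n"
  then have fl: "\<Phi> \<in> flags s" "\<Psi> \<in> flags s" unfolding i_adjacent_def adjacent_def by auto
  have e: "\<Psi> = adj_flag s i \<Phi>" using adj_flag_unique[OF fl(1) i a] by simp
  have "adjacent s \<Psi> \<Phi>" using a unfolding i_adjacent_def adjacent_def by blast
  moreover have "face_rank s F = int i" if "F \<in> \<Psi> - \<Phi>" for F
  proof (rule ccontr)
    assume ne: "face_rank s F \<noteq> int i"
    have "face_at s \<Psi> (face_rank s F) = F" "-1 \<le> face_rank s F" "face_rank s F \<le> int n"
      using face_atI[OF fl(2)] that by auto
    then have "F = face_at s \<Phi> (face_rank s F)" "face_at s \<Phi> (face_rank s F) \<in> \<Phi>"
      using face_at_adj[OF fl(1) i, of "face_rank s F"] ne e face_at(1)[OF fl(1), of "face_rank s F"] by simp_all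
    then show False using that by auto
  qed
  ultimately show ?thesis unfolding i_adjacent_def by blast
qed

private lemma adj_flag_invol: "\<Phi> \<in> flags s \<Longrightarrow> i < n \<Longrightarrow> adj_flag s i (adj_flag s i \<Phi>) = \<Phi>"
  using adj_flag_unique adj_flag_adjacent i_adjacent_sym adj_flag_closed by metis

text \<open>The exchanged face is found between the faces of ranks \<open>i - 1\<close> and
  \<open>i + 1\<close>, so nothing outside these three ranks matters. This locality makes
  adjacencies of distant ranks commute.\<close>

private lemma face_at_adj_cong:
  assumes "\<Phi> \<in> flags s" "\<Psi> \<in> flags s" "i < n"
    and "\<And>j. j \<in> {int i - 1, int i, int i + 1} \<Longrightarrow> face_at s \<Phi> j = face_at s \<Psi> j"
  shows "face_at s (adj_flag s i \<Phi>) (int i) = face_at s (adj_flag s i \<Psi>) (int i)"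
proof -
  obtain F' where F': "F' \<noteq> face_at s \<Phi> (int i)"
    "\<And>H. H \<in> {face_at s \<Phi> (int i), F'} \<longleftrightarrow> (face_at s \<Phi> (int i - 1), H) \<in> s \<and> (H, face_at s \<Phi> (int i + 1)) \<in> s \<and> face_rank s H = int i"
    using diamond_pair[OF assms(1,3)] by blast
  have "face_at s (adj_flag s i \<Xi>) (int i) = F'"
    if \<Xi>: "\<Xi> \<in> flags s" "\<And>j. j \<in> {int i - 1, int i, int i + 1} \<Longrightarrow> face_at s \<Xi> j = face_at s \<Phi> j" for \<Xi>
  proof -
    let ?\<Xi> = "adj_flag s i \<Xi>"
    have cl: "?\<Xi> \<in> flags s" using adj_flag_closed \<Xi> assms by blast
    have "face_at s ?\<Xi> (int i - 1) = face_at s \<Phi> (int i - 1)" "face_at s ?\<Xi> (int i + 1) = face_at s \<Phi> (int i + 1)"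
      using face_at_adj[OF \<Xi>(1) assms(3), of "int i - 1"] face_at_adj[OF \<Xi>(1) assms(3), of "int i + 1"]
        \<Xi>(2)[of "int i - 1"] \<Xi>(2)[of "int i + 1"] assms(3) by simp_all
    then have "face_at s ?\<Xi> (int i) \<in> {face_at s \<Phi> (int i), F'}"
      unfolding F'(2) using face_at_mono[OF cl, of "int i - 1" "int i"] face_at_mono[OF cl, of "int i" "int i + 1"]
        face_at(2)[OF cl, of "int i"] assms(3) by auto
    moreover have "face_at s ?\<Xi> (int i) \<noteq> face_at s \<Phi> (int i)"
      using face_at_adj[OF \<Xi>(1) assms(3), of "int i"] \<Xi>(2)[of "int i"] assms(3) by auto
    ultimately show ?thesis by blast
  qed
  from this[of \<Phi>] this[of \<Psi>] show ?thesis using assms by auto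
qed

private lemma adj_flag_commute:
  assumes \<Phi>: "\<Phi> \<in> flags s" and ij: "i < n" "j < n" "i + 2 \<le> j"
  shows "adj_flag s i (adj_flag s j \<Phi>) = adj_flag s j (adj_flag s i \<Phi>)"
proof (rule flag_eqI)
  let ?i = "adj_flag s i \<Phi>" and ?j = "adj_flag s j \<Phi>"
  have cl: "?i \<in> flags s" "?j \<in> flags s" using adj_flag_closed assms by auto
  show cl2: "adj_flag s i ?j \<in> flags s" "adj_flag s j ?i \<in> flags s" using adj_flag_closed assms cl by auto
  fix k :: int assume k: "-1 \<le> k" "k \<le> int n"
  have i: "face_at s ?j l = face_at s \<Phi> l" if "l \<in> {int i - 1, int i, int i + 1}" for l
    using that face_at_adj[OF \<Phi> ij(2)] ij by auto
  have j: "face_at s ?i l = face_at s \<Phi> l" if "l \<in> {int j - 1, int j, int j + 1}" for l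
    using that face_at_adj[OF \<Phi> ij(1)] ij by auto
  consider "k = int i" | "k = int j" | "k \<noteq> int i" "k \<noteq> int j" by blast
  then show "face_at s (adj_flag s i ?j) k = face_at s (adj_flag s j ?i) k"
  proof cases
    case 1
    have "face_at s (adj_flag s i ?j) k = face_at s ?i k"
      using face_at_adj_cong[OF cl(2) \<Phi> ij(1)] i 1 by blast
    then show ?thesis using face_at_adj[OF cl(1) ij(2) k] 1 ij by auto
  next
    case 2
    have "face_at s (adj_flag s j ?i) k = face_at s ?j k"
      using face_at_adj_cong[OF cl(1) \<Phi> ij(2)] j 2 by blast
    then show ?thesis using face_at_adj[OF cl(2) ij(1) k] 2 ij by auto
  next
    case 3
    then show ?thesis
      using face_at_adj[OF cl(1) ij(2) k] face_at_adj[OF cl(2) ij(1) k] face_at_adj[OF \<Phi> ij(1) k] face_at_adj[OF \<Phi> ij(2) k]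
      by auto
  qed
qed

text \<open>A path keeping all common faces, as strong flag-connectedness provides, can only use
  letters at whose rank the two flags differ. This gives both the description of faces as residues
  and the intersection property.\<close>

private lemma conn_flags:
  assumes \<Phi>: "\<Phi> \<in> flags s" and \<Psi>: "\<Psi> \<in> flags s"
  shows "conn (adj_flag s) {k. k < n \<and> face_at s \<Phi> (int k) \<noteq> face_at s \<Psi> (int k)} \<Phi> \<Psi>"
proof -
  define D where "D = \<Phi> \<inter> \<Psi>"
  define I where "I = {k. k < n \<and> face_at s \<Phi> (int k) \<noteq> face_at s \<Psi> (int k)}"
  have ne: "face_at s \<Phi> (int k) \<noteq> face_at s \<Psi> (int k)"
    if k: "k < n" "face_at s B (int k) \<noteq> face_at s A (int k)" and fl: "A \<in> flags s" "B \<in> flags s"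
      and AB: "D \<subseteq> A" "D \<subseteq> B" for k A B
  proof
    let ?F = "face_at s \<Phi> (int k)"
    assume "?F = face_at s \<Psi> (int k)"
    then have "?F \<in> D" "face_rank s ?F = int k"
      using face_at[OF \<Phi>, of "int k"] face_at[OF \<Psi>, of "int k"] k(1) unfolding D_def by auto
    then have "face_at s A (int k) = ?F" "face_at s B (int k) = ?F"
      using AB face_atI(1)[OF fl(1)] face_atI(1)[OF fl(2)] by blast+
    then show False using k by auto
  qed
  have "(\<Phi>, \<Psi>) \<in> {(A, B). adjacent s A B \<and> D \<subseteq> A \<and> D \<subseteq> B}\<^sup>*"
    unfolding D_def using polytope \<Phi> \<Psi> unfolding abstract_polytope_def strongly_flag_connected_def by blast
  then have "conn (adj_flag s) I \<Phi> \<Psi>"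
  proof (induction rule: rtrancl_induct)
    case (step A B)
    then have AB: "adjacent s A B" "D \<subseteq> A" "D \<subseteq> B" by auto
    then have fl: "A \<in> flags s" "B \<in> flags s" unfolding adjacent_def by auto
    obtain k where k: "k < n" "i_adjacent s k A B"
      "\<And>j. -1 \<le> j \<Longrightarrow> j \<le> int n \<Longrightarrow> face_at s B j = face_at s A j \<longleftrightarrow> j \<noteq> int k"
      using face_at_adjacent[OF AB(1)] by blast
    have "face_at s B (int k) \<noteq> face_at s A (int k)" using k(3)[of "int k"] k(1) by auto
    then have "k \<in> I" using ne[OF k(1) _ fl AB(2,3)] k(1) unfolding I_def by blast
    moreover have "B = adj_flag s k A" using adj_flag_unique[OF fl(1) k(1,2)] by simp
    ultimately show ?case using conn_trans[OF step.IH conn_step[of k I "adj_flag s" A]] by simp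
  qed simp
  then show ?thesis unfolding I_def .
qed

private lemma face_at_conn:
  assumes c: "conn (adj_flag s) I \<Phi> \<Psi>" and \<Phi>: "\<Phi> \<in> flags s" and I: "I \<subseteq> cot n i" and i: "-1 \<le> i" "i \<le> int n"
  shows "\<Psi> \<in> flags s \<and> face_at s \<Phi> i = face_at s \<Psi> i"
  using c
proof (induction rule: conn_induct)
  case (step \<Xi> k)
  then have "k < n" "int k \<noteq> i" using I by auto
  then show ?case using step adj_flag_closed face_at_adj[of \<Xi> k i] i by auto
qed (use \<Phi> in simp)

text \<open>Converse to \<open>polytope_presentation.abstract_polytope\<close>: arguments about
  chambers thereby apply to polytopes given as posets.\<close>

theorem flags_presentation: "polytope_presentation n (flags s) (adj_flag s) s (face_at s)"
proof unfold_locales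
  fix \<Phi> \<Psi> assume fl: "\<Phi> \<in> flags s" "\<Psi> \<in> flags s"
  show "conn (adj_flag s) {..<n} \<Phi> \<Psi>" using conn_flags[OF fl] by (rule conn_mono) auto
  have eq: "face_at s \<Phi> i = face_at s \<Psi> i \<longleftrightarrow> conn (adj_flag s) (cot n i) \<Phi> \<Psi>" if i: "-1 \<le> i" "i \<le> int n" for i
  proof
    assume e: "face_at s \<Phi> i = face_at s \<Psi> i"
    show "conn (adj_flag s) (cot n i) \<Phi> \<Psi>" using conn_flags[OF fl] by (rule conn_mono) (use e in auto)
  next
    assume "conn (adj_flag s) (cot n i) \<Phi> \<Psi>"
    then show "face_at s \<Phi> i = face_at s \<Psi> i" using face_at_conn[OF _ fl(1) _ i] by blast
  qed
  show "conn (adj_flag s) ({..<n} - J) \<Phi> \<Psi>"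
    if J: "J \<subseteq> {..<n}" "\<And>j. j \<in> J \<Longrightarrow> conn (adj_flag s) (cot n (int j)) \<Phi> \<Psi>" for J
    using conn_flags[OF fl]
  proof (rule conn_mono)
    have "face_at s \<Phi> (int j) = face_at s \<Psi> (int j)" if "j \<in> J" for j
      using eq[of "int j"] J that by force
    then show "{k. k < n \<and> face_at s \<Phi> (int k) \<noteq> face_at s \<Psi> (int k)} \<subseteq> {..<n} - J" by auto
  qed
  fix i j :: int assume ij: "-1 \<le> i" "i \<le> int n" "-1 \<le> j" "j \<le> int n"
  show "(face_at s \<Phi> i = face_at s \<Psi> j) = (i = j \<and> conn (adj_flag s) (cot n i) \<Phi> \<Psi>)"
    using eq[of i] face_at(2)[OF fl(1), of i] face_at(2)[OF fl(2), of j] ij by metis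
  show "((face_at s \<Phi> i, face_at s \<Psi> j) \<in> s) =
    (i \<le> j \<and> (\<exists>z\<in>flags s. face_at s z i = face_at s \<Phi> i \<and> face_at s z j = face_at s \<Psi> j))" (is "?L = ?R")
  proof
    assume L: ?L
    let ?F = "face_at s \<Phi> i" and ?G = "face_at s \<Psi> j"
    have rk: "face_rank s ?F = i" "face_rank s ?G = j" using face_at fl ij by auto
    have "(?F, ?F) \<in> s" "(?G, ?G) \<in> s" using L po(1) by (auto simp: refl_on_def Field_def)
    then have "{?F, ?G} \<in> Chains s" unfolding Chains_def using L by auto
    then obtain z where z: "z \<in> flags s" "{?F, ?G} \<subseteq> z" by (rule chain_extend)
    then have "face_at s z i = ?F" "face_at s z j = ?G" using face_atI(1)[OF z(1)] rk by auto
    then show ?R using rank_mono[OF L] rk z(1) by auto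
  next
    assume ?R
    then show ?L using face_at_mono ij by metis
  qed
next
  show "flags s \<noteq> {}" using chain_extend[of "{}"] by (auto simp: Chains_def)
  show "Field s = {face_at s x i |x i. x \<in> flags s \<and> - 1 \<le> i \<and> i \<le> int n}"
  proof (intro equalityI subsetI)
    fix F assume "F \<in> Field s"
    then have "{F} \<in> Chains s" using po(1) unfolding Chains_def refl_on_def by auto
    then obtain \<Phi> where "\<Phi> \<in> flags s" "F \<in> \<Phi>" using chain_extend by (metis insert_subset)
    then show "F \<in> {face_at s x i |x i. x \<in> flags s \<and> - 1 \<le> i \<and> i \<le> int n}"
      using face_atI[of \<Phi> F "face_rank s F"] by force
  next
    fix F assume "F \<in> {face_at s x i |x i. x \<in> flags s \<and> - 1 \<le> i \<and> i \<le> int n}"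
    then show "F \<in> Field s" using face_at(1) flag_Field by blast
  qed
next
  fix i \<Phi> assume i: "i < n" "\<Phi> \<in> flags s"
  show "adj_flag s i \<Phi> \<noteq> \<Phi>" using face_at_adj[OF i(2,1), of "int i"] i by auto
next
  fix i j \<Phi> assume "i < n" "j < n" "i + 2 \<le> j" "\<Phi> \<in> flags s"
  then show "adj_flag s i (adj_flag s j \<Phi>) = adj_flag s j (adj_flag s i \<Phi>)" by (intro adj_flag_commute)
qed (simp_all add: adj_flag_closed adj_flag_invol)

end

section \<open>Isomorphisms and automorphisms\<close>

definition chamber_iso :: "nat \<Rightarrow> 'x set \<Rightarrow> (nat \<Rightarrow> 'x \<Rightarrow> 'x) \<Rightarrow> 'y set \<Rightarrow> (nat \<Rightarrow> 'y \<Rightarrow> 'y) \<Rightarrow> ('x \<Rightarrow> 'y) \<Rightarrow> bool" where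
  "chamber_iso n X r X' r' f \<longleftrightarrow> bij_betw f X X' \<and> (\<forall>i<n. \<forall>x\<in>X. f (r i x) = r' i (f x))"

abbreviation chamber_aut :: "nat \<Rightarrow> 'x set \<Rightarrow> (nat \<Rightarrow> 'x \<Rightarrow> 'x) \<Rightarrow> ('x \<Rightarrow> 'x) \<Rightarrow> bool" where
  "chamber_aut n X r \<equiv> chamber_iso n X r X r"

definition poset_iso :: "'a rel \<Rightarrow> 'b rel \<Rightarrow> ('a \<Rightarrow> 'b) \<Rightarrow> bool" where
  "poset_iso s s' g \<longleftrightarrow> bij_betw g (Field s) (Field s') \<and>
     (\<forall>x \<in> Field s. \<forall>y \<in> Field s. (x, y) \<in> s \<longleftrightarrow> (g x, g y) \<in> s')"

lemma poset_isomorphic_iff: "poset_isomorphic s s' \<longleftrightarrow> (\<exists>g. poset_iso s s' g)"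
  unfolding poset_isomorphic_def poset_iso_def by blast

lemma chamber_iso_mem: "chamber_iso n X r X' r' f \<Longrightarrow> x \<in> X \<Longrightarrow> f x \<in> X'"
  unfolding chamber_iso_def bij_betw_def by blast

lemma chamber_iso_step: "chamber_iso n X r X' r' f \<Longrightarrow> i < n \<Longrightarrow> x \<in> X \<Longrightarrow> f (r i x) = r' i (f x)"
  unfolding chamber_iso_def by blast

lemma chamber_iso_inj: "chamber_iso n X r X' r' f \<Longrightarrow> x \<in> X \<Longrightarrow> y \<in> X \<Longrightarrow> f x = f y \<longleftrightarrow> x = y"
  unfolding chamber_iso_def bij_betw_def inj_on_def by blast

lemma chamber_iso_comp: "chamber_iso n X r X' r' f \<Longrightarrow> chamber_iso n X' r' X'' r'' g \<Longrightarrow> chamber_iso n X r X'' r'' (g \<circ> f)"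
  unfolding chamber_iso_def using bij_betw_trans bij_betwE by fastforce

lemma chamber_iso_id: "chamber_aut n X r id"
  unfolding chamber_iso_def by simp

lemma chamber_iso_inv:
  assumes "chamber_system n X r" "chamber_iso n X r X' r' f"
  shows "chamber_iso n X' r' X r (inv_into X f)"
proof -
  interpret chamber_system n X r by fact
  have f: "bij_betw f X X'" using assms(2) unfolding chamber_iso_def by blast
  have "inv_into X f (r' i y) = r i (inv_into X f y)" if "i < n" "y \<in> X'" for i y
  proof -
    obtain x where x: "x \<in> X" "y = f x" using f \<open>y \<in> X'\<close> unfolding bij_betw_def by blast
    then have "r' i y = f (r i x)" using chamber_iso_step[OF assms(2) \<open>i < n\<close>] by simp
    then show ?thesis using f x closed[OF \<open>i < n\<close>] by (simp add: bij_betw_def inv_into_f_f)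
  qed
  then show ?thesis unfolding chamber_iso_def using bij_betw_inv_into[OF f] by blast
qed

context chamber_system
begin

lemma map_fold:
  assumes "\<And>i x. i < n \<Longrightarrow> x \<in> X \<Longrightarrow> f (r i x) = r' i (f x)" "w \<in> lists {..<n}" "x \<in> X"
  shows "f (fold r w x) = fold r' w (f x)"
  using assms(2,3) by (induction w arbitrary: x) (auto simp: assms(1) closed)

lemma map_conn:
  assumes "\<And>i x. i < n \<Longrightarrow> x \<in> X \<Longrightarrow> f (r i x) = r' i (f x)" "conn r I x y" "I \<subseteq> {..<n}" "x \<in> X"
  shows "conn r' I (f x) (f y)"
proof -
  obtain w where w: "w \<in> lists I" "fold r w x = y" using assms(2) unfolding conn_def by blast
  then have "w \<in> lists {..<n}" using assms(3) lists_mono by blast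
  have "f (fold r w x) = fold r' w (f x)" by (rule map_fold) (use assms \<open>w \<in> lists {..<n}\<close> in auto)
  then show ?thesis using w unfolding conn_def by auto
qed

lemma map_unique:
  assumes "\<And>i x. i < n \<Longrightarrow> x \<in> X \<Longrightarrow> f (r i x) = r' i (f x)" "\<And>i x. i < n \<Longrightarrow> x \<in> X \<Longrightarrow> g (r i x) = r' i (g x)"
    "x \<in> X" "f x = g x" "y \<in> X"
  shows "f y = g y"
proof -
  obtain w where w: "w \<in> lists {..<n}" "fold r w x = y"
    using connected[OF assms(3,5)] unfolding conn_def by blast
  show ?thesis using map_fold[of f r', OF assms(1) w(1) assms(3)] map_fold[of g r', OF assms(2) w(1) assms(3)] w(2) assms(4) by simp
qed

end

section \<open>Colourings, chirality and regularity on chambers\<close>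

definition bicoloured :: "nat \<Rightarrow> 'x set \<Rightarrow> (nat \<Rightarrow> 'x \<Rightarrow> 'x) \<Rightarrow> ('x \<Rightarrow> bool) \<Rightarrow> bool" where
  "bicoloured n X r c \<longleftrightarrow> (\<forall>i<n. \<forall>x\<in>X. c (r i x) \<longleftrightarrow> \<not> c x)"

text \<open>The common ground of chiral and directly regular polytopes: the parity of words is well
  defined, and chambers of one parity are equivalent under automorphisms. This suffices for standard
  rotations to exist.\<close>

definition rotary_chambers :: "nat \<Rightarrow> 'x set \<Rightarrow> (nat \<Rightarrow> 'x \<Rightarrow> 'x) \<Rightarrow> ('x \<Rightarrow> bool) \<Rightarrow> bool" where
  "rotary_chambers n X r c \<longleftrightarrow> bicoloured n X r c \<and>
     (\<forall>x\<in>X. \<forall>y\<in>X. (c x \<longleftrightarrow> c y) \<longrightarrow> (\<exists>f. chamber_aut n X r f \<and> f x = y))"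

text \<open>Excluding \<open>r 0 x\<close> excludes the whole opposite colour, since the chambers of
  that colour are equivalent and automorphisms can be composed. The condition \<open>0 < n\<close>
  gives \<open>r 0\<close> a meaning.\<close>

definition chiral_chambers :: "nat \<Rightarrow> 'x set \<Rightarrow> (nat \<Rightarrow> 'x \<Rightarrow> 'x) \<Rightarrow> bool" where
  "chiral_chambers n X r \<longleftrightarrow> 0 < n \<and> (\<exists>c. rotary_chambers n X r c) \<and>
     (\<forall>x\<in>X. \<forall>f. chamber_aut n X r f \<longrightarrow> f x \<noteq> r 0 x)"

text \<open>The colouring stands for the index 2 of the rotation group;
  \<open>card_rotation_cosets_iff\<close> justifies this.\<close>

definition directly_regular_chambers :: "nat \<Rightarrow> 'x set \<Rightarrow> (nat \<Rightarrow> 'x \<Rightarrow> 'x) \<Rightarrow> bool" where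
  "directly_regular_chambers n X r \<longleftrightarrow> (\<exists>c. bicoloured n X r c) \<and>
     (\<forall>x\<in>X. \<forall>y\<in>X. \<exists>f. chamber_aut n X r f \<and> f x = y)"

lemma chamber_aut_conj:
  assumes X: "chamber_system n X r" and h: "chamber_iso n X r X' r' h" and f: "chamber_aut n X r f" and x: "x \<in> X"
  shows "\<exists>f'. chamber_aut n X' r' f' \<and> f' (h x) = h (f x)"
proof -
  have "chamber_aut n X' r' (h \<circ> f \<circ> inv_into X h)"
    using chamber_iso_comp chamber_iso_inv X h f by metis
  moreover have "inv_into X h (h x) = x" using h x unfolding chamber_iso_def bij_betw_def by simp
  ultimately show ?thesis by (metis comp_apply)
qed

lemma chamber_aut_transfer:
  assumes X: "chamber_system n X r" and h: "chamber_iso n X r X' r' h" and xy: "x \<in> X" "y \<in> X"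
  shows "(\<exists>f. chamber_aut n X' r' f \<and> f (h x) = h y) \<longleftrightarrow> (\<exists>f. chamber_aut n X r f \<and> f x = y)"
proof
  assume "\<exists>f. chamber_aut n X' r' f \<and> f (h x) = h y"
  then obtain f where f: "chamber_aut n X' r' f" "f (h x) = h y" by blast
  have "chamber_aut n X r (inv_into X h \<circ> (f \<circ> h))"
    using chamber_iso_comp[OF chamber_iso_comp[OF h f(1)] chamber_iso_inv[OF X h]] .
  moreover have "inv_into X h (h y) = y" using h xy unfolding chamber_iso_def bij_betw_def by simp
  ultimately show "\<exists>f. chamber_aut n X r f \<and> f x = y" using f(2) by (metis comp_apply)
next
  assume "\<exists>f. chamber_aut n X r f \<and> f x = y"
  then show "\<exists>f. chamber_aut n X' r' f \<and> f (h x) = h y" using chamber_aut_conj[OF X h _ xy(1)] by metis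
qed

lemma bicoloured_transfer:
  assumes h: "chamber_iso n X r X' r' h" and c: "bicoloured n X' r' c"
  shows "bicoloured n X r (c \<circ> h)"
  using c chamber_iso_mem[OF h] chamber_iso_step[OF h] unfolding bicoloured_def by simp

lemma chiral_chambers_transfer:
  assumes X: "chamber_system n X r" and h: "chamber_iso n X r X' r' h" and chi: "chiral_chambers n X' r'"
  shows "chiral_chambers n X r"
proof -
  interpret chamber_system n X r by fact
  obtain c where c: "0 < n" "rotary_chambers n X' r' c" using chi unfolding chiral_chambers_def by blast
  have "\<exists>f. chamber_aut n X r f \<and> f x = y" if "x \<in> X" "y \<in> X" "c (h x) = c (h y)" for x y
    using c(2) chamber_aut_transfer[OF X h that(1,2)] chamber_iso_mem[OF h] that unfolding rotary_chambers_def by blast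
  then have "rotary_chambers n X r (c \<circ> h)"
    using c(2) bicoloured_transfer[OF h] unfolding rotary_chambers_def by simp
  moreover have "f x \<noteq> r 0 x" if x: "x \<in> X" and f: "chamber_aut n X r f" for x f
  proof
    assume "f x = r 0 x"
    then obtain f' where "chamber_aut n X' r' f'" "f' (h x) = h (r 0 x)"
      using chamber_aut_transfer[OF X h x closed[OF c(1) x]] f by blast
    then show False using chi chamber_iso_step[OF h c(1) x] chamber_iso_mem[OF h x] unfolding chiral_chambers_def by auto
  qed
  ultimately show ?thesis using c(1) unfolding chiral_chambers_def by blast
qed

lemma directly_regular_chambers_transfer:
  assumes X: "chamber_system n X r" and h: "chamber_iso n X r X' r' h" and d: "directly_regular_chambers n X' r'"
  shows "directly_regular_chambers n X r"
proof -
  obtain c where "bicoloured n X' r' c" using d unfolding directly_regular_chambers_def by blast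
  then have "bicoloured n X r (c \<circ> h)" by (rule bicoloured_transfer[OF h])
  moreover have "\<exists>f. chamber_aut n X r f \<and> f x = y" if "x \<in> X" "y \<in> X" for x y
    using chamber_aut_transfer[OF X h that] d chamber_iso_mem[OF h] that unfolding directly_regular_chambers_def by blast
  ultimately show ?thesis unfolding directly_regular_chambers_def by blast
qed

section \<open>Posets and chamber systems up to isomorphism\<close>

lemma poset_iso_presentation:
  assumes P: "incidence_presentation n X r s face" and P': "incidence_presentation n X' r' s' face'"
    and f: "chamber_iso n X r X' r' f"
  obtains g where "poset_iso s s' g" "\<And>x i. x \<in> X \<Longrightarrow> -1 \<le> i \<Longrightarrow> i \<le> int n \<Longrightarrow> g (face x i) = face' (f x) i"
proof -
  interpret P: incidence_presentation n X r s face by fact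
  interpret P': incidence_presentation n X' r' s' face' by fact
  have step: "f (r i x) = r' i (f x)" if "i < n" "x \<in> X" for i x using chamber_iso_step[OF f that] .
  have h: "chamber_iso n X' r' X r (inv_into X f)" using chamber_iso_inv[OF P.chamber_system_axioms f] .
  have hf: "inv_into X f (f x) = x" if "x \<in> X" for x using that f unfolding chamber_iso_def bij_betw_def by simp
  have fX: "f x \<in> X'" if "x \<in> X" for x using chamber_iso_mem[OF f that] .
  have eq: "face' (f x) i = face' (f y) j \<longleftrightarrow> face x i = face y j"
    if "x \<in> X" "y \<in> X" "-1 \<le> i" "i \<le> int n" "-1 \<le> j" "j \<le> int n" for x y i j
  proof -
    have sub: "cot n i \<subseteq> {..<n}" by auto
    have "conn r (cot n i) x y \<longleftrightarrow> conn r' (cot n i) (f x) (f y)"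
    proof
      show "conn r (cot n i) x y \<Longrightarrow> conn r' (cot n i) (f x) (f y)"
        using P.map_conn[of f r' "cot n i" x y, OF step _ sub that(1)] .
      assume "conn r' (cot n i) (f x) (f y)"
      then have "conn r (cot n i) (inv_into X f (f x)) (inv_into X f (f y))"
        using P'.map_conn[of "inv_into X f" r "cot n i" "f x" "f y", OF chamber_iso_step[OF h] _ sub fX[OF that(1)]] by blast
      then show "conn r (cot n i) x y" using hf that by simp
    qed
    then show ?thesis using P.face_eq P'.face_eq fX that by auto
  qed
  \<comment> \<open>A face has many representatives \<open>(x, i)\<close>. One is chosen, and
    \<open>eq\<close> makes the choice immaterial.\<close>
  define g where "g F = (let (x, i) = SOME (x, i). x \<in> X \<and> -1 \<le> i \<and> i \<le> int n \<and> F = face x i in face' (f x) i)" for F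
  have g: "g (face x i) = face' (f x) i" if x: "x \<in> X" "-1 \<le> i" "i \<le> int n" for x i
  proof -
    let ?Q = "\<lambda>(y, j). y \<in> X \<and> -1 \<le> j \<and> j \<le> int n \<and> face x i = face y j"
    have "?Q (SOME p. ?Q p)" by (rule someI[of ?Q "(x, i)"]) (use x in auto)
    moreover obtain y j where yj1: "(SOME p. ?Q p) = (y, j)" by (cases "SOME p. ?Q p") auto
    ultimately have yj: "(SOME p. ?Q p) = (y, j)" "?Q (y, j)" by simp_all
    then have "g (face x i) = face' (f y) j" unfolding g_def by simp
    then show ?thesis using eq[of x y i j] x yj(2) by simp
  qed
  have "poset_iso s s' g" unfolding poset_iso_def
  proof (intro conjI ballI)
    have "inj_on g (Field s)"
    proof (rule inj_onI)
      fix F G assume FG: "F \<in> Field s" "G \<in> Field s" "g F = g G"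
      obtain x i where x: "x \<in> X" "-1 \<le> i" "i \<le> int n" "F = face x i" using P.FieldE[OF FG(1)] by blast
      obtain y j where y: "y \<in> X" "-1 \<le> j" "j \<le> int n" "G = face y j" using P.FieldE[OF FG(2)] by blast
      show "F = G" using eq[of x y i j] x y g FG(3) by simp
    qed
    moreover have "g ` Field s = Field s'"
    proof (intro equalityI subsetI)
      fix G assume "G \<in> g ` Field s"
      then obtain x i where "x \<in> X" "-1 \<le> i" "i \<le> int n" "G = g (face x i)" by (auto elim!: P.FieldE)
      then show "G \<in> Field s'" using g P'.face_mem fX by simp
    next
      fix G assume "G \<in> Field s'"
      then obtain y i where y: "y \<in> X'" "-1 \<le> i" "i \<le> int n" "G = face' y i" by (rule P'.FieldE)
      then obtain x where "x \<in> X" "y = f x" using f unfolding chamber_iso_def bij_betw_def by blast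
      then show "G \<in> g ` Field s" using y g P.face_mem by (metis imageI)
    qed
    ultimately show "bij_betw g (Field s) (Field s')" unfolding bij_betw_def by blast
    fix F G assume FG: "F \<in> Field s" "G \<in> Field s"
    obtain x i where x: "x \<in> X" "-1 \<le> i" "i \<le> int n" "F = face x i" using P.FieldE[OF FG(1)] by blast
    obtain y j where y: "y \<in> X" "-1 \<le> j" "j \<le> int n" "G = face y j" using P.FieldE[OF FG(2)] by blast
    have img: "X' = f ` X" using f unfolding chamber_iso_def bij_betw_def by blast
    have "(F, G) \<in> s \<longleftrightarrow> i \<le> j \<and> (\<exists>z \<in> X. face z i = face x i \<and> face z j = face y j)"
      using P.incident[of x y i j] x y by simp
    also have "\<dots> \<longleftrightarrow> i \<le> j \<and> (\<exists>z \<in> X. face' (f z) i = face' (f x) i \<and> face' (f z) j = face' (f y) j)"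
      using eq x y by auto
    also have "\<dots> \<longleftrightarrow> i \<le> j \<and> (\<exists>z \<in> X'. face' z i = face' (f x) i \<and> face' z j = face' (f y) j)"
      unfolding img by blast
    also have "\<dots> \<longleftrightarrow> (g F, g G) \<in> s'"
      using P'.incident[of "f x" "f y" i j] x y g fX by simp
    finally show "(F, G) \<in> s \<longleftrightarrow> (g F, g G) \<in> s'" .
  qed
  then show ?thesis using that g by blast
qed

text \<open>Facets are only known to be isomorphic to a given polytope. Moving the face map along
  the isomorphism makes the same chambers present the given polytope itself.\<close>

lemma presentation_transport:
  assumes P: "polytope_presentation n X r s face" and g: "poset_iso s s' g"
  shows "polytope_presentation n X r s' (\<lambda>x i. g (face x i))"
proof -
  interpret P: polytope_presentation n X r s face by fact
  have inj: "inj_on g (Field s)" "g ` Field s = Field s'" using g unfolding poset_iso_def bij_betw_def by auto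
  have eq: "g (face x i) = g (face y j) \<longleftrightarrow> face x i = face y j"
    if "x \<in> X" "y \<in> X" "-1 \<le> i" "i \<le> int n" "-1 \<le> j" "j \<le> int n" for x y i j
    using inj_on_eq_iff[OF inj(1) P.face_mem P.face_mem] that by blast
  show ?thesis
  proof (intro polytope_presentation.intro incidence_presentation.intro incidence_presentation_axioms.intro)
    show "Field s' = {g (face x i) |x i. x \<in> X \<and> - 1 \<le> i \<and> i \<le> int n}"
      unfolding inj(2)[symmetric] P.Field_eq by blast
    fix x y i j assume a: "x \<in> X" "y \<in> X" "-1 \<le> i" "i \<le> int n" "-1 \<le> j" "j \<le> int n"
    show "(g (face x i) = g (face y j)) = (i = j \<and> conn r (cot n i) x y)"
      using eq[OF a] P.face_eq[OF a] by simp
    have "((g (face x i), g (face y j)) \<in> s') = ((face x i, face y j) \<in> s)"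
      using g P.face_mem a unfolding poset_iso_def by blast
    also have "\<dots> = (i \<le> j \<and> (\<exists>z\<in>X. g (face z i) = g (face x i) \<and> g (face z j) = g (face y j)))"
      using P.incident[OF a] eq a by auto
    finally show "((g (face x i), g (face y j)) \<in> s') = (i \<le> j \<and> (\<exists>z\<in>X. g (face z i) = g (face x i) \<and> g (face z j) = g (face y j)))" .
  qed (rule P.chamber_system_axioms P.polytopal_chamber_system_axioms)+
qed

text \<open>Chambers correspond to flags in either presentation, so chambers with the same flag are
  matched. The steps agree because \<open>adj_flag\<close> refers to the poset alone.\<close>

lemma presentation_unique:
  assumes P: "polytope_presentation n X r s face" and P': "polytope_presentation n X' r' s face'"
  obtains f where "chamber_iso n X r X' r' f"
    "\<And>x i. x \<in> X \<Longrightarrow> -1 \<le> i \<Longrightarrow> i \<le> int n \<Longrightarrow> face' (f x) i = face x i"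
proof -
  interpret P: polytope_presentation n X r s face by fact
  interpret P': polytope_presentation n X' r' s face' by fact
  define f where "f x = inv_into X' P'.flag_of (P.flag_of x)" for x
  have ff: "f x \<in> X'" "P'.flag_of (f x) = P.flag_of x" if "x \<in> X" for x
  proof -
    have "P.flag_of x \<in> P'.flag_of ` X'" using P.flags_eq P'.flags_eq that by blast
    then show "f x \<in> X'" "P'.flag_of (f x) = P.flag_of x"
      unfolding f_def by (rule inv_into_into, rule f_inv_into_f)
  qed
  have "bij_betw f X X'" unfolding bij_betw_def
  proof (intro conjI inj_onI equalityI subsetI)
    fix x y assume "x \<in> X" "y \<in> X" "f x = f y"
    then show "x = y" using P.flag_of_inj ff by metis
  next
    fix y assume y: "y \<in> X'"
    then have "P'.flag_of y \<in> P.flag_of ` X" using P.flags_eq P'.flags_eq by blast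
    then obtain x where x: "x \<in> X" "P'.flag_of y = P.flag_of x" by blast
    then have "f x = y" using P'.flag_of_inj ff[OF x(1)] y by metis
    then show "y \<in> f ` X" using x by blast
  qed (use ff in auto)
  moreover have "f (r i x) = r' i (f x)" if i: "i < n" "x \<in> X" for i x
  proof -
    have "P'.flag_of (f (r i x)) = adj_flag s i (P.flag_of x)"
      using ff(2)[OF P.closed[OF i]] P.adj_flag_eq[OF i] by simp
    also have "\<dots> = P'.flag_of (r' i (f x))" using P'.adj_flag_eq[OF i(1) ff(1)[OF i(2)]] ff(2)[OF i(2)] by simp
    finally show ?thesis using P'.flag_of_inj ff(1) P.closed P'.closed i by blast
  qed
  ultimately have "chamber_iso n X r X' r' f" unfolding chamber_iso_def by blast
  moreover have "face' (f x) i = face x i" if x: "x \<in> X" "-1 \<le> i" "i \<le> int n" for x i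
  proof -
    have "face x i \<in> P'.flag_of (f x)" using ff(2)[OF x(1)] x unfolding P.flag_of_def by auto
    then obtain j where j: "-1 \<le> j" "j \<le> int n" "face x i = face' (f x) j" unfolding P'.flag_of_def by auto
    have "face_rank s (face x i) = i" "face_rank s (face' (f x) j) = j"
      using P.face_rank_face[OF x] P'.face_rank_face[OF ff(1)[OF x(1)] j(1,2)] by auto
    then show ?thesis using j by simp
  qed
  ultimately show ?thesis using that by blast
qed

section \<open>The automorphism group and its action on flags\<close>

lemma group_aut: "group (aut_group s)"
proof -
  let ?B = "BijGroup (Field s)" and ?A = "{f \<in> Bij (Field s). \<forall>x \<in> Field s. \<forall>y \<in> Field s. (x, y) \<in> s \<longleftrightarrow> (f x, f y) \<in> s}"
  have mem: "f x \<in> Field s" if "f \<in> Bij (Field s)" "x \<in> Field s" for f x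
    using that unfolding Bij_def bij_betw_def by blast
  interpret B: group ?B by (rule group_BijGroup)
  have "subgroup ?A ?B"
  proof (rule B.subgroupI)
    show "?A \<subseteq> carrier ?B" unfolding BijGroup_def by auto
    show "?A \<noteq> {}"
      using id_Bij[of "Field s"] by (intro ex_in_conv[THEN iffD1] exI[of _ "\<lambda>x\<in>Field s. x"]) auto
    fix f assume f: "f \<in> ?A"
    then have fB: "f \<in> Bij (Field s)" and bij: "bij_betw f (Field s) (Field s)" unfolding Bij_def by auto
    have inv: "inv\<^bsub>?B\<^esub> f = (\<lambda>x\<in>Field s. (inv_into (Field s) f) x)" using inv_BijGroup[OF fB] .
    have "(x, y) \<in> s \<longleftrightarrow> (inv_into (Field s) f x, inv_into (Field s) f y) \<in> s" if "x \<in> Field s" "y \<in> Field s" for x y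
    proof -
      have m: "inv_into (Field s) f x \<in> Field s" "inv_into (Field s) f y \<in> Field s"
        using bij that by (auto simp: bij_betw_def intro: inv_into_into)
      have "f (inv_into (Field s) f x) = x" "f (inv_into (Field s) f y) = y"
        using bij_betw_inv_into_right[OF bij] that by blast+
      then show ?thesis using f m by force
    qed
    moreover have "inv\<^bsub>?B\<^esub> f \<in> Bij (Field s)" using inv restrict_inv_into_Bij[OF fB] by simp
    ultimately show "inv\<^bsub>?B\<^esub> f \<in> ?A" unfolding inv by simp
    fix g assume g: "g \<in> ?A"
    then have gB: "g \<in> Bij (Field s)" by auto
    have "f \<otimes>\<^bsub>?B\<^esub> g = compose (Field s) f g" unfolding BijGroup_def using fB gB by simp
    moreover have "compose (Field s) f g \<in> Bij (Field s)" using compose_Bij[OF fB gB] .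
    ultimately show "f \<otimes>\<^bsub>?B\<^esub> g \<in> ?A" using f g mem[OF gB] by (auto simp: compose_eq)
  qed
  then show ?thesis unfolding aut_group_def by (rule B.subgroup_imp_group)
qed

lemma aut_carrier: "g \<in> carrier (aut_group s) \<longleftrightarrow> g \<in> extensional (Field s) \<and> poset_iso s s g"
  unfolding aut_group_def poset_iso_def Bij_def by auto

lemma aut_mult: "g \<in> carrier (aut_group s) \<Longrightarrow> h \<in> carrier (aut_group s) \<Longrightarrow> F \<in> Field s \<Longrightarrow>
    (g \<otimes>\<^bsub>aut_group s\<^esub> h) F = g (h F)"
  unfolding aut_group_def BijGroup_def by (simp add: compose_eq)

lemma aut_one: "F \<in> Field s \<Longrightarrow> \<one>\<^bsub>aut_group s\<^esub> F = F"
  unfolding aut_group_def BijGroup_def by simp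

context
  fixes n :: nat and s :: "'a rel"
  assumes polytope: "abstract_polytope n s"
begin

interpretation flags: polytope_presentation n "flags s" "adj_flag s" s "face_at s"
  using flags_presentation[OF polytope] .

lemma flags_flag_of: "\<Phi> \<in> flags s \<Longrightarrow> flags.flag_of \<Phi> = \<Phi>"
proof -
  assume \<Phi>: "\<Phi> \<in> flags s"
  then obtain \<Psi> where \<Psi>: "\<Psi> \<in> flags s" "\<Phi> = flags.flag_of \<Psi>" using flags.flags_eq by blast
  have "face_at s \<Phi> i = face_at s \<Psi> i" if i: "-1 \<le> i" "i \<le> int n" for i
  proof -
    have "\<exists>!F. F \<in> \<Phi> \<and> face_rank s F = i"
    proof (rule ex1I[of _ "face_at s \<Psi> i"])
      show "face_at s \<Psi> i \<in> \<Phi> \<and> face_rank s (face_at s \<Psi> i) = i"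
        using \<Psi> i flags.face_rank_face[OF \<Psi>(1)] unfolding flags.flag_of_def by auto
      fix F assume F: "F \<in> \<Phi> \<and> face_rank s F = i"
      then obtain j where "-1 \<le> j" "j \<le> int n" "F = face_at s \<Psi> j" using \<Psi>(2) unfolding flags.flag_of_def by auto
      then show "F = face_at s \<Psi> i" using F flags.face_rank_face[OF \<Psi>(1)] by auto
    qed
    from theI'[OF this] have "face_at s \<Phi> i \<in> \<Phi>" "face_rank s (face_at s \<Phi> i) = i" unfolding face_at_def by auto
    then obtain j where "-1 \<le> j" "j \<le> int n" "face_at s \<Phi> i = face_at s \<Psi> j" "j = i"
      using \<Psi>(2) flags.face_rank_face[OF \<Psi>(1)] unfolding flags.flag_of_def by auto
    then show ?thesis by simp
  qed
  then show "flags.flag_of \<Phi> = \<Phi>" using flags.flag_of_eq_iff[OF \<Phi> \<Psi>(1)] \<Psi>(2) by simp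
qed

lemma flag_sub_Field: "\<Phi> \<in> flags s \<Longrightarrow> \<Phi> \<subseteq> Field s"
  unfolding flags_def Chains_def Field_def by blast

lemma flag_eq_faces: "\<Phi> \<in> flags s \<Longrightarrow> \<Phi> = face_at s \<Phi> ` {-1..int n}"
  using flags_flag_of unfolding flags.flag_of_def by simp

text \<open>Composing the face map with \<open>g\<close> gives a second presentation of the same
  poset by its flags. Uniqueness of presentations turns \<open>g\<close> into a map of flags, which
  has to be the image map.\<close>

lemma poset_aut_chamber_aut:
  assumes g: "poset_iso s s g"
  shows "chamber_aut n (flags s) (adj_flag s) ((`) g)"
    and "\<Phi> \<in> flags s \<Longrightarrow> -1 \<le> i \<Longrightarrow> i \<le> int n \<Longrightarrow> face_at s (g ` \<Phi>) i = g (face_at s \<Phi> i)"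
proof -
  obtain f where f: "chamber_aut n (flags s) (adj_flag s) f"
    "\<And>\<Phi> i. \<Phi> \<in> flags s \<Longrightarrow> -1 \<le> i \<Longrightarrow> i \<le> int n \<Longrightarrow> face_at s (f \<Phi>) i = g (face_at s \<Phi> i)"
    using presentation_unique[OF presentation_transport[OF flags.polytope_presentation_axioms g] flags.polytope_presentation_axioms] by blast
  have eq: "f \<Phi> = g ` \<Phi>" if \<Phi>: "\<Phi> \<in> flags s" for \<Phi>
  proof -
    have "f \<Phi> = face_at s (f \<Phi>) ` {-1..int n}" using flag_eq_faces chamber_iso_mem[OF f(1) \<Phi>] .
    also have "\<dots> = g ` (face_at s \<Phi> ` {-1..int n})" unfolding image_image by (rule image_cong) (use f(2)[OF \<Phi>] in auto)
    finally show ?thesis using flag_eq_faces[OF \<Phi>] by simp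
  qed
  then show "chamber_aut n (flags s) (adj_flag s) ((`) g)"
    using f(1) flags.closed bij_betw_cong[of "flags s" f "(`) g" "flags s"] unfolding chamber_iso_def by auto
  show "\<Phi> \<in> flags s \<Longrightarrow> -1 \<le> i \<Longrightarrow> i \<le> int n \<Longrightarrow> face_at s (g ` \<Phi>) i = g (face_at s \<Phi> i)" using f(2) eq by auto
qed

lemma aut_flag_mem: "g \<in> carrier (aut_group s) \<Longrightarrow> \<Phi> \<in> flags s \<Longrightarrow> g ` \<Phi> \<in> flags s"
  using poset_aut_chamber_aut(1) chamber_iso_mem aut_carrier by metis

lemma aut_adj_flag: "g \<in> carrier (aut_group s) \<Longrightarrow> \<Phi> \<in> flags s \<Longrightarrow> i < n \<Longrightarrow> adj_flag s i (g ` \<Phi>) = g ` adj_flag s i \<Phi>"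
  using chamber_iso_step[OF poset_aut_chamber_aut(1)] aut_carrier by metis

lemma aut_fold: "g \<in> carrier (aut_group s) \<Longrightarrow> \<Phi> \<in> flags s \<Longrightarrow> w \<in> lists {..<n} \<Longrightarrow>
    fold (adj_flag s) w (g ` \<Phi>) = g ` fold (adj_flag s) w \<Phi>"
  using flags.map_fold[of "(`) g" "adj_flag s" w \<Phi>] aut_adj_flag by simp

lemma aut_mult_image: "g \<in> carrier (aut_group s) \<Longrightarrow> h \<in> carrier (aut_group s) \<Longrightarrow> \<Phi> \<in> flags s \<Longrightarrow>
    (g \<otimes>\<^bsub>aut_group s\<^esub> h) ` \<Phi> = g ` h ` \<Phi>"
  unfolding image_image using aut_mult[of g s h] flag_sub_Field[of \<Phi>] by (intro image_cong) auto

lemma aut_one_image: "\<Phi> \<in> flags s \<Longrightarrow> \<one>\<^bsub>aut_group s\<^esub> ` \<Phi> = \<Phi>"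
proof -
  assume "\<Phi> \<in> flags s"
  then have "\<one>\<^bsub>aut_group s\<^esub> ` \<Phi> = (\<lambda>x. x) ` \<Phi>" using aut_one[of _ s] flag_sub_Field by (intro image_cong) auto
  then show ?thesis by simp
qed

lemma aut_inv_image: "g \<in> carrier (aut_group s) \<Longrightarrow> \<Phi> \<in> flags s \<Longrightarrow> (inv\<^bsub>aut_group s\<^esub> g) ` g ` \<Phi> = \<Phi>"
  using aut_mult_image[of "inv\<^bsub>aut_group s\<^esub> g" g \<Phi>] group.inv_closed[OF group_aut, of g s]
    group.l_inv[OF group_aut, of g s] aut_one_image by simp

text \<open>Automorphisms commute with the steps between adjacent flags, so by connectedness one
  flag decides the images of all flags, and these decide the images of all faces. The descriptions
  by \<open>THE\<close> of standard reflections and rotations become meaningful through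
  this.\<close>

lemma aut_unique:
  assumes g: "g \<in> carrier (aut_group s)" and h: "h \<in> carrier (aut_group s)" and \<Phi>: "\<Phi> \<in> flags s" and eq: "g ` \<Phi> = h ` \<Phi>"
  shows "g = h"
proof (rule extensionalityI)
  show "g \<in> extensional (Field s)" "h \<in> extensional (Field s)" using g h aut_carrier by blast+
  fix F assume "F \<in> Field s"
  then obtain \<Psi> i where \<Psi>: "\<Psi> \<in> flags s" "-1 \<le> i" "i \<le> int n" "F = face_at s \<Psi> i" by (rule flags.FieldE)
  have "g ` \<Psi> = h ` \<Psi>"
    by (rule flags.map_unique[OF _ _ \<Phi> _ \<Psi>(1), of "(`) g" "adj_flag s" "(`) h"]) (use aut_adj_flag g h eq in auto)
  then show "g F = h F"
    using poset_aut_chamber_aut(2)[of g \<Psi> i] poset_aut_chamber_aut(2)[of h \<Psi> i] \<Psi> g h aut_carrier by metis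
qed

lemma chamber_aut_imp_aut:
  assumes "chamber_aut n (flags s) (adj_flag s) f"
  obtains g where "g \<in> carrier (aut_group s)" "\<And>\<Phi>. \<Phi> \<in> flags s \<Longrightarrow> g ` \<Phi> = f \<Phi>"
proof -
  obtain h where h: "poset_iso s s h"
    "\<And>\<Phi> i. \<Phi> \<in> flags s \<Longrightarrow> -1 \<le> i \<Longrightarrow> i \<le> int n \<Longrightarrow> h (face_at s \<Phi> i) = face_at s (f \<Phi>) i"
    using poset_iso_presentation[OF flags.incidence_presentation_axioms flags.incidence_presentation_axioms assms] by blast
  \<comment> \<open>Elements of the carrier are extensional functions, so the map has to be made
    undefined off the field.\<close>
  let ?g = "restrict h (Field s)"
  have "bij_betw ?g (Field s) (Field s)"
    using h(1) by (subst bij_betw_cong[of _ _ h]) (auto simp: poset_iso_def)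
  then have "poset_iso s s ?g" using h(1) unfolding poset_iso_def by simp
  then have "?g \<in> carrier (aut_group s)" using aut_carrier by blast
  moreover have "?g ` \<Phi> = f \<Phi>" if \<Phi>: "\<Phi> \<in> flags s" for \<Phi>
  proof -
    have "?g ` \<Phi> = h ` \<Phi>" using flag_sub_Field[OF \<Phi>] by (intro image_cong) auto
    also have "\<dots> = h ` face_at s \<Phi> ` {-1..int n}" using flag_eq_faces[OF \<Phi>] by simp
    also have "\<dots> = face_at s (f \<Phi>) ` {-1..int n}" unfolding image_image by (rule image_cong) (use h(2)[OF \<Phi>] in auto)
    also have "\<dots> = f \<Phi>" using flag_eq_faces chamber_iso_mem[OF assms \<Phi>] by simp
    finally show ?thesis .
  qed
  ultimately show ?thesis using that by blast
qed

lemma flag_orbit_iff: "\<Phi> \<in> flags s \<Longrightarrow> \<Psi> \<in> flags s \<Longrightarrow>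
    (\<Phi>, \<Psi>) \<in> flag_orbit_rel s \<longleftrightarrow> (\<exists>f. chamber_aut n (flags s) (adj_flag s) f \<and> f \<Phi> = \<Psi>)"
proof
  assume fl: "\<Phi> \<in> flags s" "\<Psi> \<in> flags s"
  show "(\<Phi>, \<Psi>) \<in> flag_orbit_rel s \<Longrightarrow> \<exists>f. chamber_aut n (flags s) (adj_flag s) f \<and> f \<Phi> = \<Psi>"
    unfolding flag_orbit_rel_def using poset_aut_chamber_aut(1) aut_carrier by fastforce
  assume "\<exists>f. chamber_aut n (flags s) (adj_flag s) f \<and> f \<Phi> = \<Psi>"
  then obtain f where f: "chamber_aut n (flags s) (adj_flag s) f" "f \<Phi> = \<Psi>" by blast
  obtain g where "g \<in> carrier (aut_group s)" "\<And>\<Phi>. \<Phi> \<in> flags s \<Longrightarrow> g ` \<Phi> = f \<Phi>"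
    using chamber_aut_imp_aut[OF f(1)] by blast
  then show "(\<Phi>, \<Psi>) \<in> flag_orbit_rel s" using fl f(2) unfolding flag_orbit_rel_def by auto
qed

lemma equiv_flag_orbit: "equiv (flags s) (flag_orbit_rel s)"
proof (rule equivI)
  show "refl_on (flags s) (flag_orbit_rel s)"
    using flag_orbit_iff chamber_iso_id by (fastforce intro: refl_onI simp: flag_orbit_rel_def)
  show "sym (flag_orbit_rel s)"
  proof (rule symI)
    fix \<Phi> \<Psi> assume a: "(\<Phi>, \<Psi>) \<in> flag_orbit_rel s"
    then have fl: "\<Phi> \<in> flags s" "\<Psi> \<in> flags s" unfolding flag_orbit_rel_def by auto
    then obtain f where f: "chamber_aut n (flags s) (adj_flag s) f" "f \<Phi> = \<Psi>" using a flag_orbit_iff by blast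
    have "inv_into (flags s) f \<Psi> = \<Phi>" using f fl unfolding chamber_iso_def bij_betw_def by auto
    then show "(\<Psi>, \<Phi>) \<in> flag_orbit_rel s"
      using flag_orbit_iff fl chamber_iso_inv[OF flags.chamber_system_axioms f(1)] by blast
  qed
  show "trans (flag_orbit_rel s)"
  proof (rule transI)
    fix \<Phi> \<Psi> \<Xi> assume a: "(\<Phi>, \<Psi>) \<in> flag_orbit_rel s" "(\<Psi>, \<Xi>) \<in> flag_orbit_rel s"
    then have fl: "\<Phi> \<in> flags s" "\<Psi> \<in> flags s" "\<Xi> \<in> flags s" unfolding flag_orbit_rel_def by auto
    then obtain f g where "chamber_aut n (flags s) (adj_flag s) f" "f \<Phi> = \<Psi>" "chamber_aut n (flags s) (adj_flag s) g" "g \<Psi> = \<Xi>"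
      using a flag_orbit_iff by metis
    then have "chamber_aut n (flags s) (adj_flag s) (g \<circ> f) \<and> (g \<circ> f) \<Phi> = \<Xi>" using chamber_iso_comp by auto
    then show "(\<Phi>, \<Xi>) \<in> flag_orbit_rel s" using flag_orbit_iff fl by blast
  qed
qed (auto simp: flag_orbit_rel_def)

lemma orbit_class_eq: "\<Phi> \<in> flags s \<Longrightarrow> \<Psi> \<in> flags s \<Longrightarrow>
    flag_orbit_rel s `` {\<Phi>} = flag_orbit_rel s `` {\<Psi>} \<longleftrightarrow> (\<exists>f. chamber_aut n (flags s) (adj_flag s) f \<and> f \<Phi> = \<Psi>)"
  using eq_equiv_class_iff[OF equiv_flag_orbit] flag_orbit_iff by metis

lemma regular_iff: "regular_polytope n s \<longleftrightarrow>
    (\<forall>\<Phi>\<in>flags s. \<forall>\<Psi>\<in>flags s. \<exists>f. chamber_aut n (flags s) (adj_flag s) f \<and> f \<Phi> = \<Psi>)" (is "_ \<longleftrightarrow> ?R")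
proof
  assume "regular_polytope n s"
  then obtain C where "flags s // flag_orbit_rel s = {C}" unfolding regular_polytope_def by (metis card_1_singletonE)
  then have "flag_orbit_rel s `` {\<Phi>} = C" if "\<Phi> \<in> flags s" for \<Phi>
    using quotientI[OF that, of "flag_orbit_rel s"] by simp
  then show ?R using orbit_class_eq by metis
next
  assume R: ?R
  obtain \<Phi> where \<Phi>: "\<Phi> \<in> flags s" using flags.nonempty by blast
  have "flags s // flag_orbit_rel s = {flag_orbit_rel s `` {\<Phi>}}"
  proof (intro equalityI subsetI)
    fix C assume "C \<in> flags s // flag_orbit_rel s"
    then obtain \<Psi> where \<Psi>: "\<Psi> \<in> flags s" "C = flag_orbit_rel s `` {\<Psi>}" by (rule quotientE)
    have "flag_orbit_rel s `` {\<Psi>} = flag_orbit_rel s `` {\<Phi>}"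
      unfolding orbit_class_eq[OF \<Psi>(1) \<Phi>] using R \<Psi>(1) \<Phi> by simp
    then show "C \<in> {flag_orbit_rel s `` {\<Phi>}}" using \<Psi>(2) by simp
  qed (use quotientI[OF \<Phi>, of "flag_orbit_rel s"] in simp)
  then show "regular_polytope n s" unfolding regular_polytope_def using polytope by simp
qed

text \<open>One of the two orbits serves as a colour: adjacent flags lie in different orbits, which
  makes the colouring proper. Conversely each colour lies in one orbit, and the exclusion of
  0-adjacent flags keeps the two orbits apart.\<close>

lemma chiral_iff_flags: "chiral_polytope n s \<longleftrightarrow> chiral_chambers n (flags s) (adj_flag s)"
proof
  let ?cl = "\<lambda>\<Phi>. flag_orbit_rel s `` {\<Phi>}"
  let ?adj = "adj_flag s"
  assume chi: "chiral_polytope n s"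
  then obtain C D where CD: "flags s // flag_orbit_rel s = {C, D}" "C \<noteq> D" unfolding chiral_polytope_def by (metis card_2_iff)
  have adj: "?cl (?adj i \<Phi>) \<noteq> ?cl \<Phi>" if "i < n" "\<Phi> \<in> flags s" for i \<Phi>
  proof -
    have "adjacent s \<Phi> (?adj i \<Phi>)" using flags.adjacent_step[OF that] flags_flag_of that flags.closed by simp
    then have "(\<Phi>, ?adj i \<Phi>) \<notin> flag_orbit_rel s" using chi unfolding chiral_polytope_def by blast
    then show ?thesis using eq_equiv_class_iff[OF equiv_flag_orbit] that flags.closed by metis
  qed
  have mem: "?cl \<Phi> \<in> {C, D}" if "\<Phi> \<in> flags s" for \<Phi> using quotientI[OF that, of "flag_orbit_rel s"] CD by simp
  \<comment> \<open>In rank 0 there is only one flag, too few for two orbits.\<close>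
  have n: "0 < n"
  proof (rule ccontr)
    assume "\<not> 0 < n"
    then have "\<Phi> = \<Psi>" if "\<Phi> \<in> flags s" "\<Psi> \<in> flags s" for \<Phi> \<Psi> using flags.connected[OF that] by simp
    moreover obtain \<Phi> \<Psi> where "\<Phi> \<in> flags s" "\<Psi> \<in> flags s" "C = ?cl \<Phi>" "D = ?cl \<Psi>"
      using CD(1) quotientE by (metis (no_types, lifting) insertI1 insertI2)
    ultimately show False using CD(2) by blast
  qed
  have "rotary_chambers n (flags s) ?adj (\<lambda>\<Phi>. ?cl \<Phi> = C)"
    unfolding rotary_chambers_def bicoloured_def
  proof (intro conjI allI impI ballI)
    fix i \<Phi> assume i: "i < n" "\<Phi> \<in> flags s"
    show "(?cl (?adj i \<Phi>) = C) = (\<not> ?cl \<Phi> = C)" using adj[OF i] mem[OF i(2)] mem[OF flags.closed[OF i]] CD by auto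
  next
    fix \<Phi> \<Psi> assume a: "\<Phi> \<in> flags s" "\<Psi> \<in> flags s" "(?cl \<Phi> = C) = (?cl \<Psi> = C)"
    then have "?cl \<Phi> = ?cl \<Psi>" using mem[OF a(1)] mem[OF a(2)] by auto
    then show "\<exists>f. chamber_aut n (flags s) ?adj f \<and> f \<Phi> = \<Psi>" unfolding orbit_class_eq[OF a(1,2)] .
  qed
  moreover have "f \<Phi> \<noteq> ?adj 0 \<Phi>" if "\<Phi> \<in> flags s" "chamber_aut n (flags s) ?adj f" for \<Phi> f
    using adj[OF n that(1)] orbit_class_eq[OF that(1) flags.closed[OF n that(1)]] that(2) by metis
  ultimately show "chiral_chambers n (flags s) ?adj" unfolding chiral_chambers_def using n by blast
next
  let ?cl = "\<lambda>\<Phi>. flag_orbit_rel s `` {\<Phi>}"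
  let ?adj = "adj_flag s"
  assume chi: "chiral_chambers n (flags s) ?adj"
  then obtain c where c: "rotary_chambers n (flags s) ?adj c" and n: "0 < n"
    and no: "\<And>x f. x \<in> flags s \<Longrightarrow> chamber_aut n (flags s) ?adj f \<Longrightarrow> f x \<noteq> ?adj 0 x" unfolding chiral_chambers_def by blast
  have c1: "c (?adj i x) \<longleftrightarrow> \<not> c x" if "i < n" "x \<in> flags s" for i x using c that unfolding rotary_chambers_def bicoloured_def by blast
  have c2: "?cl x = ?cl y" if "x \<in> flags s" "y \<in> flags s" "c x = c y" for x y
    using c that orbit_class_eq unfolding rotary_chambers_def by metis
  have c3: "c x = c y" if xy: "x \<in> flags s" "y \<in> flags s" "?cl x = ?cl y" for x y
  proof (rule ccontr)
    assume "c x \<noteq> c y"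
    then have "c (?adj 0 x) = c y" using c1 n xy by auto
    then have "?cl x = ?cl (?adj 0 x)" using c2[of "?adj 0 x" y] flags.closed[OF n xy(1)] xy by simp
    then show False using no xy(1) orbit_class_eq[OF xy(1) flags.closed[OF n xy(1)]] by blast
  qed
  obtain \<Phi> where \<Phi>: "\<Phi> \<in> flags s" using flags.nonempty by blast
  note \<Phi>' = flags.closed[OF n \<Phi>]
  have "flags s // flag_orbit_rel s = {?cl \<Phi>, ?cl (?adj 0 \<Phi>)}"
  proof (intro equalityI subsetI)
    fix C assume "C \<in> flags s // flag_orbit_rel s"
    then obtain \<Psi> where "\<Psi> \<in> flags s" "C = ?cl \<Psi>" by (rule quotientE)
    then show "C \<in> {?cl \<Phi>, ?cl (?adj 0 \<Phi>)}" using c2[of \<Psi> \<Phi>] c2[of \<Psi> "?adj 0 \<Phi>"] c1[OF n \<Phi>] \<Phi> \<Phi>' by blast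
  next
    fix C assume "C \<in> {?cl \<Phi>, ?cl (?adj 0 \<Phi>)}"
    then show "C \<in> flags s // flag_orbit_rel s" using quotientI \<Phi> \<Phi>' by auto
  qed
  moreover have "?cl \<Phi> \<noteq> ?cl (?adj 0 \<Phi>)" using c3[OF \<Phi> \<Phi>'] c1[OF n \<Phi>] by blast
  ultimately have card: "card (flags s // flag_orbit_rel s) = 2" by simp
  have "(\<Psi>, \<Xi>) \<notin> flag_orbit_rel s" if adj: "adjacent s \<Psi> \<Xi>" for \<Psi> \<Xi>
  proof
    assume rel: "(\<Psi>, \<Xi>) \<in> flag_orbit_rel s"
    have \<Psi>: "\<Psi> \<in> flags s" using adj unfolding adjacent_def by blast
    obtain i where i: "i < n" "\<Xi> = flags.flag_of (?adj i \<Psi>)" using flags.adjacent_imp_step[OF \<Psi>] flags_flag_of[OF \<Psi>] adj by auto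
    then have "\<Xi> = ?adj i \<Psi>" using flags_flag_of[OF flags.closed[OF i(1) \<Psi>]] by simp
    moreover have "?cl \<Psi> = ?cl \<Xi>" using equiv_class_eq[OF equiv_flag_orbit rel] .
    ultimately show False using c3[OF \<Psi> flags.closed[OF i(1) \<Psi>]] c1[OF i(1) \<Psi>] by simp
  qed
  then show "chiral_polytope n s" unfolding chiral_polytope_def using polytope card by blast
qed

end

section \<open>The rotation subgroup of a regular polytope\<close>

context
  fixes n :: nat and s :: "'a rel"
  assumes polytope: "abstract_polytope n s" and n: "0 < n"
    and reg: "\<And>\<Phi> \<Psi>. \<Phi> \<in> flags s \<Longrightarrow> \<Psi> \<in> flags s \<Longrightarrow> \<exists>f. chamber_aut n (flags s) (adj_flag s) f \<and> f \<Phi> = \<Psi>"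
  fixes \<Phi> :: "'a set"
  assumes \<Phi>: "\<Phi> \<in> flags s"
begin

interpretation flags: polytope_presentation n "flags s" "adj_flag s" s "face_at s"
  using flags_presentation[OF polytope] .

interpretation A: group "aut_group s" by (rule group_aut)

private abbreviation mult :: "('a \<Rightarrow> 'a) \<Rightarrow> ('a \<Rightarrow> 'a) \<Rightarrow> 'a \<Rightarrow> 'a" (infixl "\<cdot>" 70) where
  "g \<cdot> h \<equiv> g \<otimes>\<^bsub>aut_group s\<^esub> h"

private abbreviation \<rho> :: "nat \<Rightarrow> 'a \<Rightarrow> 'a" where
  "\<rho> \<equiv> standard_reflection s \<Phi>"

private abbreviation R :: "('a \<Rightarrow> 'a) set" where
  "R \<equiv> {\<rho> (i - 1) \<cdot> \<rho> i | i. 1 \<le> i \<and> i < n}"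

private abbreviation H :: "('a \<Rightarrow> 'a) set" where
  "H \<equiv> generate (aut_group s) R"

private lemma \<rho>: "i < n \<Longrightarrow> \<rho> i \<in> carrier (aut_group s)" "i < n \<Longrightarrow> \<rho> i ` \<Phi> = adj_flag s i \<Phi>"
proof -
  assume i: "i < n"
  obtain f where "chamber_aut n (flags s) (adj_flag s) f" "f \<Phi> = adj_flag s i \<Phi>"
    using reg[OF \<Phi> flags.closed[OF i \<Phi>]] by blast
  then obtain g where g: "g \<in> carrier (aut_group s)" "g ` \<Phi> = adj_flag s i \<Phi>"
    using chamber_aut_imp_aut[OF polytope] \<Phi> by metis
  have "\<rho> i \<in> carrier (aut_group s) \<and> \<rho> i ` \<Phi> = adj_flag s i \<Phi>"
    unfolding standard_reflection_def
  proof (rule theI[of _ g])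
    show "g \<in> carrier (aut_group s) \<and> g ` \<Phi> = adj_flag s i \<Phi>" using g by blast
    fix f assume "f \<in> carrier (aut_group s) \<and> f ` \<Phi> = adj_flag s i \<Phi>"
    then show "f = g" using aut_unique[OF polytope _ g(1) \<Phi>, of f] g(2) by simp
  qed
  then show "\<rho> i \<in> carrier (aut_group s)" "\<rho> i ` \<Phi> = adj_flag s i \<Phi>" by auto
qed

private lemma \<rho>_square: "i < n \<Longrightarrow> \<rho> i \<cdot> \<rho> i = \<one>\<^bsub>aut_group s\<^esub>"
proof (rule aut_unique[OF polytope _ _ \<Phi>])
  assume i: "i < n"
  show "(\<rho> i \<cdot> \<rho> i) ` \<Phi> = \<one>\<^bsub>aut_group s\<^esub> ` \<Phi>"
    using \<rho>[OF i] \<Phi> i by (simp add: aut_mult_image[OF polytope] aut_one_image[OF polytope]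
        aut_adj_flag[OF polytope, symmetric] flags.invol)
qed (use \<rho> in auto)

private lemma H_subgroup: "subgroup H (aut_group s)"
  by (rule A.generate_is_subgroup) (use \<rho> in auto)

private lemma H_carrier: "g \<in> H \<Longrightarrow> g \<in> carrier (aut_group s)"
  using subgroup.mem_carrier[OF H_subgroup] .

text \<open>The products \<open>\<rho> (i - 1) \<cdot> \<rho> i\<close> telescope to
  \<open>\<rho> 0 \<cdot> \<rho> i\<close>; the other order is the inverse.\<close>

private lemma \<rho>0_mem: "i < n \<Longrightarrow> \<rho> 0 \<cdot> \<rho> i \<in> H \<and> \<rho> i \<cdot> \<rho> 0 \<in> H"
proof -
  assume "i < n"
  then have *: "\<rho> 0 \<cdot> \<rho> i \<in> H"
  proof (induction i)
    case 0
    then show ?case using \<rho>_square[of 0] subgroup.one_closed[OF H_subgroup] by simp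
  next
    case (Suc i)
    then have c: "\<rho> 0 \<in> carrier (aut_group s)" "\<rho> i \<in> carrier (aut_group s)" "\<rho> (Suc i) \<in> carrier (aut_group s)"
      using \<rho> n by auto
    have "\<rho> i \<cdot> \<rho> (Suc i) \<in> R" using Suc by (intro CollectI exI[of _ "Suc i"]) auto
    from generate.eng[OF Suc.IH[OF Suc_lessD[OF Suc.prems]] generate.incl[OF this]]
    have "(\<rho> 0 \<cdot> \<rho> i) \<cdot> (\<rho> i \<cdot> \<rho> (Suc i)) \<in> H" .
    also have "(\<rho> 0 \<cdot> \<rho> i) \<cdot> (\<rho> i \<cdot> \<rho> (Suc i))
        = \<rho> 0 \<cdot> ((\<rho> i \<cdot> \<rho> i) \<cdot> \<rho> (Suc i))"
      using c by (simp add: A.m_assoc)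
    finally show ?case using \<rho>_square[of i] Suc c by simp
  qed
  have c: "\<rho> 0 \<in> carrier (aut_group s)" "\<rho> i \<in> carrier (aut_group s)" using \<rho> n \<open>i < n\<close> by auto
  have "inv\<^bsub>aut_group s\<^esub> (\<rho> 0 \<cdot> \<rho> i) = \<rho> i \<cdot> \<rho> 0"
    using A.inv_mult_group[OF c] A.inv_equality[OF \<rho>_square[OF n] c(1) c(1)]
      A.inv_equality[OF \<rho>_square[OF \<open>i < n\<close>] c(2) c(2)] by simp
  then show ?thesis using * subgroup.m_inv_closed[OF H_subgroup *] by simp
qed

text \<open>Along a path each step \<open>i\<close> multiplies \<open>g\<close> on the right by
  \<open>\<rho> i \<cdot> \<rho> 0\<close> or \<open>\<rho> 0 \<cdot> \<rho> i\<close> and exchanges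
  the two alternatives. So \<open>H\<close> has at most two orbits on flags, hence index at most
  2.\<close>

private lemma H_flags:
  assumes \<Psi>: "\<Psi> \<in> flags s"
  shows "\<exists>g \<in> H. \<Psi> = g ` \<Phi> \<or> \<Psi> = g ` adj_flag s 0 \<Phi>"
  using flags.connected[OF \<Phi> \<Psi>]
proof (induction rule: conn_induct)
  case base
  show ?case by (rule bexI[OF _ subgroup.one_closed[OF H_subgroup]]) (simp add: aut_one_image[OF polytope \<Phi>])
next
  case (step \<Psi> i)
  then have i: "i < n" by simp
  obtain g where g: "g \<in> H" "\<Psi> = g ` \<Phi> \<or> \<Psi> = g ` adj_flag s 0 \<Phi>" using step.IH by blast
  note gc = H_carrier[OF g(1)]
  note r = \<rho>[OF i] \<rho>[OF n]
  from g(2) show ?case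
  proof
    assume "\<Psi> = g ` \<Phi>"
    then have "adj_flag s i \<Psi> = g ` adj_flag s i \<Phi>" using aut_adj_flag[OF polytope gc \<Phi> i] by simp
    also have "adj_flag s i \<Phi> = \<rho> i ` \<rho> 0 ` adj_flag s 0 \<Phi>"
      using r aut_adj_flag[OF polytope r(3) \<Phi> n] flags.invol[OF n \<Phi>] by simp
    also have "\<dots> = (\<rho> i \<cdot> \<rho> 0) ` adj_flag s 0 \<Phi>"
      using aut_mult_image[OF polytope r(1,3) flags.closed[OF n \<Phi>]] by simp
    also have "g ` \<dots> = (g \<cdot> (\<rho> i \<cdot> \<rho> 0)) ` adj_flag s 0 \<Phi>"
      using aut_mult_image[OF polytope gc _ flags.closed[OF n \<Phi>], of "\<rho> i \<cdot> \<rho> 0"] r by simp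
    finally show ?thesis using generate.eng[OF g(1)] \<rho>0_mem[OF i] by blast
  next
    assume "\<Psi> = g ` adj_flag s 0 \<Phi>"
    then have "adj_flag s i \<Psi> = g ` adj_flag s i (adj_flag s 0 \<Phi>)"
      using aut_adj_flag[OF polytope gc flags.closed[OF n \<Phi>] i] by simp
    also have "adj_flag s i (adj_flag s 0 \<Phi>) = \<rho> 0 ` \<rho> i ` \<Phi>"
      using r aut_adj_flag[OF polytope r(3) \<Phi> i] by simp
    also have "\<dots> = (\<rho> 0 \<cdot> \<rho> i) ` \<Phi>"
      using aut_mult_image[OF polytope r(3,1) \<Phi>] by simp
    also have "g ` \<dots> = (g \<cdot> (\<rho> 0 \<cdot> \<rho> i)) ` \<Phi>"
      using aut_mult_image[OF polytope gc _ \<Phi>, of "\<rho> 0 \<cdot> \<rho> i"] r by simp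
    finally show ?thesis using generate.eng[OF g(1)] \<rho>0_mem[OF i] by blast
  qed
qed

private lemma aut_cases:
  assumes g: "g \<in> carrier (aut_group s)"
  shows "\<exists>h \<in> H. g = h \<or> g = h \<cdot> \<rho> 0"
proof -
  obtain h where h: "h \<in> H" "g ` \<Phi> = h ` \<Phi> \<or> g ` \<Phi> = h ` adj_flag s 0 \<Phi>"
    using H_flags[OF aut_flag_mem[OF polytope g \<Phi>]] by blast
  note hc = H_carrier[OF h(1)]
  from h(2) have "g = h \<or> g = h \<cdot> \<rho> 0"
  proof
    assume "g ` \<Phi> = h ` \<Phi>"
    then show ?thesis using aut_unique[OF polytope g hc \<Phi>] by simp
  next
    assume "g ` \<Phi> = h ` adj_flag s 0 \<Phi>"
    then have "g ` \<Phi> = (h \<cdot> \<rho> 0) ` \<Phi>" using aut_mult_image[OF polytope hc \<rho>(1)[OF n] \<Phi>] \<rho>(2)[OF n] by simp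
    then show ?thesis using aut_unique[OF polytope g _ \<Phi>] hc \<rho>(1)[OF n] by blast
  qed
  then show ?thesis using h(1) by blast
qed

text \<open>If the index is 2, the flags in the \<open>H\<close>-orbit of \<open>\<Phi>\<close> form
  one colour class: two adjacent flags in it would put some \<open>\<rho> i\<close> into
  \<open>H\<close>, and then \<open>\<rho> 0\<close>. If a colouring exists, \<open>H\<close>
  preserves colours while \<open>\<rho> 0\<close> does not, so the two cosets differ.\<close>

lemma card_rotation_cosets_iff: "card (rcosets\<^bsub>aut_group s\<^esub> H) = 2 \<longleftrightarrow> (\<exists>c. bicoloured n (flags s) (adj_flag s) c)"
proof
  have r0: "\<rho> 0 \<in> carrier (aut_group s)" using \<rho> n by blast
  have coset: "H #>\<^bsub>aut_group s\<^esub> (h \<cdot> g) = H #>\<^bsub>aut_group s\<^esub> g" if "h \<in> H" "g \<in> carrier (aut_group s)" for h g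
    using A.coset_mult_assoc[of H h g] A.coset_join2[OF H_carrier[OF that(1)] H_subgroup that(1)] that
      H_carrier subgroup.subset[OF H_subgroup] by simp
  have H1: "H #>\<^bsub>aut_group s\<^esub> h = H" if "h \<in> H" for h using A.coset_join2[OF H_carrier[OF that] H_subgroup that] .
  have cos: "rcosets\<^bsub>aut_group s\<^esub> H = {H, H #>\<^bsub>aut_group s\<^esub> \<rho> 0}"
  proof (intro equalityI subsetI)
    fix C assume "C \<in> rcosets\<^bsub>aut_group s\<^esub> H"
    then obtain g where g: "g \<in> carrier (aut_group s)" "C = H #>\<^bsub>aut_group s\<^esub> g" unfolding RCOSETS_def by blast
    then show "C \<in> {H, H #>\<^bsub>aut_group s\<^esub> \<rho> 0}" using aut_cases[OF g(1)] H1 coset[OF _ r0] by auto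
  next
    fix C assume "C \<in> {H, H #>\<^bsub>aut_group s\<^esub> \<rho> 0}"
    then show "C \<in> rcosets\<^bsub>aut_group s\<^esub> H"
      using H1[OF subgroup.one_closed[OF H_subgroup]] r0 unfolding RCOSETS_def by auto
  qed
  {
    assume two: "card (rcosets\<^bsub>aut_group s\<^esub> H) = 2"
    have notin: "\<rho> 0 \<notin> H"
    proof
      assume "\<rho> 0 \<in> H"
      then show False using cos H1 two by simp
    qed
    have notin': "\<rho> i \<notin> H" if i: "i < n" for i
    proof
      assume "\<rho> i \<in> H"
      have "(\<rho> 0 \<cdot> \<rho> i) \<cdot> \<rho> i \<in> H" using generate.eng[OF conjunct1[OF \<rho>0_mem[OF i]] \<open>\<rho> i \<in> H\<close>] .
      then show False using notin \<rho>_square[OF i] \<rho>(1)[OF i] r0 by (simp add: A.m_assoc)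
    qed
    let ?c = "\<lambda>\<Psi>. \<exists>g \<in> H. \<Psi> = g ` \<Phi>"
    have "bicoloured n (flags s) (adj_flag s) ?c" unfolding bicoloured_def
    proof (intro allI impI ballI)
      fix i \<Psi> assume i: "i < n" and \<Psi>: "\<Psi> \<in> flags s"
      show "?c (adj_flag s i \<Psi>) = (\<not> ?c \<Psi>)"
      proof
        assume "?c (adj_flag s i \<Psi>)"
        then obtain g' where g': "g' \<in> H" "adj_flag s i \<Psi> = g' ` \<Phi>" by blast
        show "\<not> ?c \<Psi>"
        proof
          assume "?c \<Psi>"
          then obtain g where g: "g \<in> H" "\<Psi> = g ` \<Phi>" by blast
          note gc = H_carrier[OF g(1)]
          have "adj_flag s i \<Psi> = (g \<cdot> \<rho> i) ` \<Phi>"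
            using g aut_adj_flag[OF polytope gc \<Phi> i] aut_mult_image[OF polytope gc \<rho>(1)[OF i] \<Phi>] \<rho>(2)[OF i] by simp
          then have "g' = g \<cdot> \<rho> i"
            using g'(2) aut_unique[OF polytope H_carrier[OF g'(1)] _ \<Phi>] gc \<rho>(1)[OF i] by simp
          then have "\<rho> i = inv\<^bsub>aut_group s\<^esub> g \<cdot> g'" using gc \<rho>(1)[OF i] by (simp add: A.m_assoc[symmetric])
          then have "\<rho> i \<in> H" using generate.eng[OF subgroup.m_inv_closed[OF H_subgroup g(1)] g'(1)] by simp
          then show False using notin'[OF i] by blast
        qed
      next
        assume "\<not> ?c \<Psi>"
        then obtain g where g: "g \<in> H" "\<Psi> = g ` adj_flag s 0 \<Phi>" using H_flags[OF \<Psi>] by blast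
        note gc = H_carrier[OF g(1)]
        have "adj_flag s i \<Psi> = g ` adj_flag s i (\<rho> 0 ` \<Phi>)"
          using g(2) aut_adj_flag[OF polytope gc flags.closed[OF n \<Phi>] i] \<rho>(2)[OF n] by simp
        also have "\<dots> = g ` \<rho> 0 ` \<rho> i ` \<Phi>" using aut_adj_flag[OF polytope r0 \<Phi> i] \<rho>(2)[OF i] by simp
        also have "\<dots> = (g \<cdot> (\<rho> 0 \<cdot> \<rho> i)) ` \<Phi>"
          using aut_mult_image[OF polytope r0 \<rho>(1)[OF i] \<Phi>]
            aut_mult_image[OF polytope gc A.m_closed[OF r0 \<rho>(1)[OF i]] \<Phi>] by simp
        finally show "?c (adj_flag s i \<Psi>)" using generate.eng[OF g(1)] \<rho>0_mem[OF i] by blast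
      qed
    qed
    then show "\<exists>c. bicoloured n (flags s) (adj_flag s) c" by blast
  next
    assume "\<exists>c. bicoloured n (flags s) (adj_flag s) c"
    then obtain c where c: "\<And>i \<Psi>. i < n \<Longrightarrow> \<Psi> \<in> flags s \<Longrightarrow> c (adj_flag s i \<Psi>) \<longleftrightarrow> \<not> c \<Psi>"
      unfolding bicoloured_def by blast
    have cH: "c (g ` \<Psi>) \<longleftrightarrow> c \<Psi>" if g: "g \<in> H" and \<Psi>: "\<Psi> \<in> flags s" for g \<Psi>
      using g \<Psi>
    proof (induction arbitrary: \<Psi> rule: generate.induct)
      case one
      then show ?case using aut_one_image[OF polytope] by simp
    next
      have hc: "h \<in> carrier (aut_group s)" if "h \<in> R" for h using that \<rho> by auto
      have inc: "c (h ` \<Psi>) \<longleftrightarrow> c \<Psi>" if h: "h \<in> R" and \<Psi>: "\<Psi> \<in> flags s" for h \<Psi>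
      proof -
        obtain i where i: "1 \<le> i" "i < n" "h = \<rho> (i - 1) \<cdot> \<rho> i" using h by blast
        then have i': "i - 1 < n" by simp
        have "h ` \<Phi> = adj_flag s i (adj_flag s (i - 1) \<Phi>)"
          using i aut_mult_image[OF polytope \<rho>(1)[OF i'] \<rho>(1)[OF i(2)] \<Phi>] \<rho>(2)[OF i(2)] \<rho>(2)[OF i']
            aut_adj_flag[OF polytope \<rho>(1)[OF i'] \<Phi> i(2)] by simp
        then have base: "c (h ` \<Phi>) \<longleftrightarrow> c \<Phi>" using c[OF i(2) flags.closed[OF i' \<Phi>]] c[OF i' \<Phi>] by simp
        \<comment> \<open>Each step changes both colours, so the agreement at \<open>\<Phi>\<close>
          spreads to all flags.\<close>
        have "(c (h ` \<Psi>) \<longleftrightarrow> c \<Psi>) \<and> \<Psi> \<in> flags s" using flags.connected[OF \<Phi> \<Psi>]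
        proof (induction rule: conn_induct)
          case (step \<Xi> j)
          then show ?case using aut_adj_flag[OF polytope hc[OF h], of \<Xi> j, symmetric] c[of j \<Xi>] c[of j "h ` \<Xi>"]
            aut_flag_mem[OF polytope hc[OF h], of \<Xi>] flags.closed by auto
        qed (use base \<Phi> in simp)
        then show ?thesis by blast
      qed
      {
        case (incl h)
        then show ?case using inc by blast
      next
        case (inv h)
        have "h ` (inv\<^bsub>aut_group s\<^esub> h) ` \<Psi> = \<Psi>"
          using aut_inv_image[OF polytope A.inv_closed[OF hc[OF inv(1)]] inv(2)] hc[OF inv(1)] by simp
        then show ?case using inc[OF inv(1) aut_flag_mem[OF polytope A.inv_closed[OF hc[OF inv(1)]] inv(2)]] by simp
      next
        case (eng h1 h2)
        then show ?case using aut_mult_image[OF polytope H_carrier H_carrier, of h1 h2 \<Psi>] aut_flag_mem[OF polytope H_carrier, of h2 \<Psi>] by simp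
      }
    qed
    have "\<rho> 0 \<notin> H" using cH[OF _ \<Phi>, of "\<rho> 0"] \<rho>(2)[OF n] c[OF n \<Phi>] by auto
    moreover have "\<rho> 0 \<in> H #>\<^bsub>aut_group s\<^esub> \<rho> 0" using A.rcos_self[OF r0 H_subgroup] .
    ultimately have "H \<noteq> H #>\<^bsub>aut_group s\<^esub> \<rho> 0" by blast
    then show "card (rcosets\<^bsub>aut_group s\<^esub> H) = 2" unfolding cos by simp
  }
qed

end

lemma directly_regular_iff_flags:
  assumes polytope: "abstract_polytope n s" and n: "0 < n"
  shows "directly_regular n s \<longleftrightarrow> directly_regular_chambers n (flags s) (adj_flag s)"
proof -
  interpret polytope_presentation n "flags s" "adj_flag s" s "face_at s"
    using flags_presentation[OF polytope] .
  let ?reg = "\<forall>\<Phi>\<in>flags s. \<forall>\<Psi>\<in>flags s. \<exists>f. chamber_aut n (flags s) (adj_flag s) f \<and> f \<Phi> = \<Psi>"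
  let ?index = "\<lambda>\<Phi>. card (rcosets\<^bsub>aut_group s\<^esub> (generate (aut_group s)
      {standard_reflection s \<Phi> (i - 1) \<otimes>\<^bsub>aut_group s\<^esub> standard_reflection s \<Phi> i | i. 1 \<le> i \<and> i < n}))"
  have "?index \<Phi> = 2 \<longleftrightarrow> (\<exists>c. bicoloured n (flags s) (adj_flag s) c)" if reg: ?reg and "\<Phi> \<in> flags s" for \<Phi>
    by (rule card_rotation_cosets_iff[OF polytope n]) (use that in auto)
  moreover have "flags s \<noteq> {}" by (rule nonempty)
  ultimately have "?reg \<Longrightarrow> (\<forall>\<Phi> \<in> flags s. ?index \<Phi> = 2) \<longleftrightarrow> (\<exists>c. bicoloured n (flags s) (adj_flag s) c)" by auto
  then show ?thesis
    unfolding directly_regular_def directly_regular_chambers_def regular_iff[OF polytope] by blast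
qed

context polytope_presentation
begin

lemma iso_flags: obtains h where "chamber_iso n X r (flags s) (adj_flag s) h"
    "\<And>x i. x \<in> X \<Longrightarrow> -1 \<le> i \<Longrightarrow> i \<le> int n \<Longrightarrow> face_at s (h x) i = face x i"
  by (rule presentation_unique[OF polytope_presentation_axioms flags_presentation[OF abstract_polytope]]) (rule that)

lemma iso_flags': obtains h where "chamber_iso n (flags s) (adj_flag s) X r h"
  by (rule presentation_unique[OF flags_presentation[OF abstract_polytope] polytope_presentation_axioms]) (rule that)

lemma flags_system: "chamber_system n (flags s) (adj_flag s)"
proof -
  interpret f: polytope_presentation n "flags s" "adj_flag s" s "face_at s"
    using flags_presentation[OF abstract_polytope] .
  show ?thesis by unfold_locales
qed

lemma chiral_iff: "chiral_polytope n s \<longleftrightarrow> chiral_chambers n X r"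
  unfolding chiral_iff_flags[OF abstract_polytope]
  using iso_flags iso_flags' chiral_chambers_transfer[OF chamber_system_axioms] chiral_chambers_transfer[OF flags_system] by metis

lemma directly_regular_iff: "0 < n \<Longrightarrow> directly_regular n s \<longleftrightarrow> directly_regular_chambers n X r"
  using directly_regular_iff_flags[OF abstract_polytope]
    iso_flags iso_flags' directly_regular_chambers_transfer[OF chamber_system_axioms] directly_regular_chambers_transfer[OF flags_system] by metis

end

section \<open>Facets\<close>

text \<open>For \<open>m = n - 1\<close> these are the chambers of one facet, for
  \<open>m = n - 2\<close> the chambers on one side of a wall between two facets, and for
  \<open>m = n\<close> a whole orbit.\<close>

definition residue :: "(nat \<Rightarrow> 'x \<Rightarrow> 'x) \<Rightarrow> nat \<Rightarrow> 'x \<Rightarrow> 'x set" where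
  "residue r m x = {y. conn r {..<m} x y}"

lemma residue_self [simp]: "x \<in> residue r m x"
  unfolding residue_def by simp

context chamber_system
begin

lemma residue_sub: "m \<le> n \<Longrightarrow> x \<in> X \<Longrightarrow> residue r m x \<subseteq> X"
  unfolding residue_def using conn_closed[of "{..<m}" x] by auto

lemma residue_chamber_system:
  assumes m: "m \<le> n" and x: "x \<in> X"
  shows "chamber_system m (residue r m x) r"
proof
  note sub = residue_sub[OF m x]
  fix i y assume i: "i < m" "y \<in> residue r m x"
  show "r i y \<in> residue r m x" using i conn_trans[OF _ conn_step[of i "{..<m}"]] unfolding residue_def by auto
  show "r i (r i y) = y" using invol i sub m by auto
next
  fix i j y assume "i < m" "j < m" "i + 2 \<le> j" "y \<in> residue r m x"
  moreover from this have "i < n" "j < n" "y \<in> X" using residue_sub[OF m x] m by auto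
  ultimately show "r i (r j y) = r j (r i y)" using commute by blast
next
  fix y z assume yz: "y \<in> residue r m x" "z \<in> residue r m x"
  then have "conn r {..<m} y x" using conn_sym[of "{..<m}" x y] m x unfolding residue_def by auto
  then show "conn r {..<m} y z" using yz(2) conn_trans unfolding residue_def by fast
qed (auto simp: residue_def intro!: exI[of _ x])

end

text \<open>An automorphism maps residues to residues, so one chamber of the residue with its image
  there forces the residue onto itself. In particular an automorphism taking a chamber to its
  0-neighbour restricts to the facet, because the letter 0 does not leave it.\<close>

lemma (in chamber_system) chamber_aut_residue:
  assumes m: "m \<le> n" and x: "x \<in> X" and f: "chamber_aut n X r f" and y: "y \<in> residue r m x" "f y \<in> residue r m x"
  shows "chamber_aut m (residue r m x) r f"
proof -
  interpret R: chamber_system m "residue r m x" r by (rule residue_chamber_system[OF m x])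
  note sub = residue_sub[OF m x]
  have step: "f (r i z) = r i (f z)" if "i < n" "z \<in> X" for i z using chamber_iso_step[OF f that] .
  have into: "f z \<in> residue r m x" if "z \<in> residue r m x" for z
  proof -
    have "conn r {..<m} (f y) (f z)"
      by (rule map_conn[of f r, OF step]) (use R.connected[OF y(1) that] sub y m in auto)
    then show ?thesis using y(2) conn_trans unfolding residue_def by fast
  qed
  have onto: "z \<in> f ` residue r m x" if z: "z \<in> residue r m x" for z
  proof -
    obtain w where w: "w \<in> lists {..<m}" "fold r w (f y) = z" using R.connected[OF y(2) z] unfolding conn_def by blast
    have "f (fold r w y) = z" by (subst map_fold[of f r, OF step]) (use w y sub m in auto)
    moreover have "fold r w y \<in> residue r m x" using R.fold_closed[OF w(1) y(1)] .
    ultimately show ?thesis by blast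
  qed
  have "bij_betw f (residue r m x) (residue r m x)"
    unfolding bij_betw_def
  proof
    show "inj_on f (residue r m x)" using f sub unfolding chamber_iso_def bij_betw_def by (meson inj_on_subset)
  qed (use into onto in auto)
  then show ?thesis unfolding chamber_iso_def using step sub m by auto
qed

lemma (in chamber_system) directly_regular_residue:
  assumes m: "m \<le> n" and x: "x \<in> X" and d: "directly_regular_chambers n X r"
  shows "directly_regular_chambers m (residue r m x) r"
proof -
  note sub = residue_sub[OF m x]
  obtain c where "bicoloured n X r c" using d unfolding directly_regular_chambers_def by blast
  then have "bicoloured m (residue r m x) r c" using sub m unfolding bicoloured_def by auto
  moreover have "\<exists>f. chamber_aut m (residue r m x) r f \<and> f y = z" if yz: "y \<in> residue r m x" "z \<in> residue r m x" for y z
  proof -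
    obtain f where "chamber_aut n X r f" "f y = z" using d sub yz unfolding directly_regular_chambers_def by blast
    then show ?thesis using chamber_aut_residue[OF m x] yz by blast
  qed
  ultimately show ?thesis unfolding directly_regular_chambers_def by blast
qed

lemma facet_presentation:
  assumes P: "polytope_presentation (Suc m) X r s face" and x: "x \<in> X"
  shows "polytope_presentation m (residue r m x) r (facet s (face x (int m))) face"
proof -
  interpret P: polytope_presentation "Suc m" X r s face by fact
  let ?F = "face x (int m)" and ?Y = "residue r m x"
  have sub: "?Y \<subseteq> X" using P.residue_sub x by simp
  interpret R: chamber_system m ?Y r using P.residue_chamber_system x by simp
  have cot_m: "cot (Suc m) (int m) = {..<m}" by auto
  have cot_sub: "cot m i = {..<Suc m} - {q. q < Suc m \<and> (int q = i \<or> q = m)}" for i by auto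
  have mem: "y \<in> ?Y" if "y \<in> X" "face y (int m) = ?F" for y
    using that x P.face_eq[of x y "int m" "int m"] unfolding residue_def cot_m by auto
  have Fm: "face y (int m) = ?F" if "y \<in> ?Y" for y
    using that x P.face_eq[of x y "int m" "int m"] sub unfolding residue_def cot_m by auto
  \<comment> \<open>Inside the facet the letter \<open>m\<close> is missing. Two chambers of the
    facet sharing a face of rank \<open>i\<close> also share the face of rank \<open>m\<close>, and
    the intersection property for both ranks gives a path without \<open>m\<close>.\<close>
  have conn_m: "conn r (cot m i) y z \<longleftrightarrow> conn r (cot (Suc m) i) y z" if yz: "y \<in> ?Y" "z \<in> ?Y" for i y z
  proof
    show "conn r (cot m i) y z \<Longrightarrow> conn r (cot (Suc m) i) y z" by (rule conn_mono) auto
    assume c: "conn r (cot (Suc m) i) y z"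
    show "conn r (cot m i) y z" unfolding cot_sub
    proof (rule P.intersection)
      fix q assume "q \<in> {q. q < Suc m \<and> (int q = i \<or> q = m)}"
      then consider "int q = i" | "q = m" by blast
      then show "conn r (cot (Suc m) (int q)) y z"
      proof cases
        case 2
        then show ?thesis using R.connected[OF yz] cot_m by simp
      qed (use c in simp)
    qed (use yz sub in auto)
  qed
  have under: "G \<in> under s ?F \<longleftrightarrow> (\<exists>y \<in> ?Y. \<exists>i. -1 \<le> i \<and> i \<le> int m \<and> G = face y i)" for G
  proof
    assume "G \<in> under s ?F"
    then have "(G, ?F) \<in> s" unfolding under_def by simp
    then obtain z i j where z: "z \<in> X" "-1 \<le> i" "i \<le> j" "j \<le> int (Suc m)" "G = face z i" "?F = face z j"
      by (rule P.incidentE)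
    then have "j = int m" using P.face_eq[of x z "int m" j] x by simp
    then show "\<exists>y \<in> ?Y. \<exists>i. -1 \<le> i \<and> i \<le> int m \<and> G = face y i" using z mem[of z] by auto
  next
    assume "\<exists>y \<in> ?Y. \<exists>i. -1 \<le> i \<and> i \<le> int m \<and> G = face y i"
    then obtain y i where y: "y \<in> ?Y" "-1 \<le> i" "i \<le> int m" "G = face y i" by blast
    then have "(face y i, face y (int m)) \<in> s" using P.incidentI[of y i "int m"] subsetD[OF sub y(1)] by simp
    then show "G \<in> under s ?F" unfolding under_def y(4) Fm[OF y(1)] by blast
  qed
  show ?thesis
  proof (intro polytope_presentation.intro incidence_presentation.intro incidence_presentation_axioms.intro
      polytopal_chamber_system.intro polytopal_chamber_system_axioms.intro)
    show "chamber_system m ?Y r" "chamber_system m ?Y r" by (rule R.chamber_system_axioms)+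
    have "Field (facet s ?F) = under s ?F"
    proof (intro equalityI subsetI)
      fix G assume "G \<in> Field (facet s ?F)"
      then show "G \<in> under s ?F" unfolding facet_def Field_def by auto
    next
      fix G assume G: "G \<in> under s ?F"
      then obtain y i where y: "y \<in> ?Y" "-1 \<le> i" "i \<le> int m" "G = face y i" unfolding under by blast
      then have "(G, G) \<in> s" using P.incidentI[of y i i] sub by auto
      then show "G \<in> Field (facet s ?F)" using G unfolding facet_def Field_def by auto
    qed
    then show "Field (facet s ?F) = {face y i |y i. y \<in> ?Y \<and> - 1 \<le> i \<and> i \<le> int m}"
      using under by blast
    fix y z i j assume yz: "y \<in> ?Y" "z \<in> ?Y" and ij: "-1 \<le> i" "i \<le> int m" "-1 \<le> j" "j \<le> int m"
    have yzX: "y \<in> X" "z \<in> X" using yz sub by auto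
    show "(face y i = face z j) = (i = j \<and> conn r (cot m i) y z)"
      using P.face_eq[OF yzX, of i j] conn_m[OF yz] ij by simp
    have "(face y i, face z j) \<in> facet s ?F \<longleftrightarrow> (face y i, face z j) \<in> s"
      using under yz ij unfolding facet_def by blast
    also have "\<dots> \<longleftrightarrow> i \<le> j \<and> (\<exists>v\<in>X. face v i = face y i \<and> face v j = face z j)"
      using P.incident[OF yzX, of i j] ij by simp
    also have "\<dots> \<longleftrightarrow> i \<le> j \<and> (\<exists>v\<in>?Y. face v i = face y i \<and> face v j = face z j)"
    proof (intro conj_cong refl iffI)
      assume le: "i \<le> j" and "\<exists>v\<in>X. face v i = face y i \<and> face v j = face z j"
      then obtain v where v: "v \<in> X" "face v i = face y i" "face v j = face z j" by blast
      \<comment> \<open>The chamber \<open>v\<close> need not belong to the facet; continuing it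
        with the faces of \<open>z\<close> from rank \<open>j\<close> on brings it there.\<close>
      obtain u where u: "u \<in> X" "\<And>i. -1 \<le> i \<Longrightarrow> i \<le> j \<Longrightarrow> face u i = face v i"
        "\<And>i. j \<le> i \<Longrightarrow> i \<le> int (Suc m) \<Longrightarrow> face u i = face z i"
        using P.splice[OF v(1) yzX(2), of j] v(3) ij by auto
      have "face u (int m) = ?F" using u(3)[of "int m"] Fm[OF yz(2)] ij by simp
      then have "u \<in> ?Y" using mem u(1) by blast
      moreover have "face u i = face y i" "face u j = face z j" using u(2)[of i] u(2)[of j] v ij le by auto
      ultimately show "\<exists>v\<in>?Y. face v i = face y i \<and> face v j = face z j" by blast
    next
      assume "\<exists>v\<in>?Y. face v i = face y i \<and> face v j = face z j"
      then obtain v where v: "v \<in> ?Y" "face v i = face y i \<and> face v j = face z j" by blast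
      show "\<exists>v\<in>X. face v i = face y i \<and> face v j = face z j"
        using v(2) subsetD[OF sub v(1)] by blast
    qed
    finally show "((face y i, face z j) \<in> facet s ?F) = (i \<le> j \<and> (\<exists>v\<in>?Y. face v i = face y i \<and> face v j = face z j))" .
  next
    fix y z J assume yz: "y \<in> ?Y" "z \<in> ?Y" and J: "J \<subseteq> {..<m}" "\<And>j. j \<in> J \<Longrightarrow> conn r (cot m (int j)) y z"
    have "conn r ({..<Suc m} - insert m J) y z"
    proof (rule P.intersection)
      fix j assume "j \<in> insert m J"
      then consider "j = m" | "j \<in> J" by blast
      then show "conn r (cot (Suc m) (int j)) y z"
      proof cases
        case 1
        show ?thesis unfolding 1 cot_m by (rule R.connected[OF yz])
      next
        case 2
        show ?thesis using J(2)[OF 2] unfolding conn_m[OF yz] .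
      qed
    qed (use yz sub J in auto)
    moreover have "{..<Suc m} - insert m J = {..<m} - J" by auto
    ultimately show "conn r ({..<m} - J) y z" by simp
  next
    fix i y assume "i < m" "y \<in> ?Y"
    then show "r i y \<noteq> y" using P.fixpoint_free sub by auto
  qed
qed

section \<open>The quotient criterion\<close>

text \<open>If the facet rank \<open>m\<close> is in \<open>J\<close>, a path exists in the image.
  Its lift starts in the facet of \<open>x\<close> and never leaves it, and its end has the same
  image as \<open>y\<close>, so injectivity on the facet identifies the two. Nonempty sets
  \<open>J\<close> without \<open>m\<close> are reduced to this case by splitting the path at the
  largest rank in \<open>J\<close>.\<close>

lemma (in chamber_system) quotient_criterion:
  assumes X': "polytopal_chamber_system n X' r'" and n: "n = Suc m"
    and p: "\<And>x. x \<in> X \<Longrightarrow> p x \<in> X'" "\<And>i x. i < n \<Longrightarrow> x \<in> X \<Longrightarrow> p (r i x) = r' i (p x)"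
    and inj: "\<And>x y. x \<in> X \<Longrightarrow> y \<in> X \<Longrightarrow> conn r {..<m} x y \<Longrightarrow> p x = p y \<Longrightarrow> x = y"
  shows "polytopal_chamber_system n X r"
proof unfold_locales
  interpret X': polytopal_chamber_system n X' r' by fact
  fix x y J assume xy: "x \<in> X" "y \<in> X" and J: "J \<subseteq> {..<n}" "\<And>j. j \<in> J \<Longrightarrow> conn r (cot n (int j)) x y"
  have facet_case: "conn r ({..<n} - J) x y"
    if xy: "x \<in> X" "y \<in> X" and J: "J \<subseteq> {..<n}" "\<And>j. j \<in> J \<Longrightarrow> conn r (cot n (int j)) x y" "m \<in> J" for x y J
  proof -
    have "conn r' (cot n (int j)) (p x) (p y)" if "j \<in> J" for j
      by (rule map_conn[of p r', OF p(2)]) (use J(2)[OF that] xy in auto)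
    then have "conn r' ({..<n} - J) (p x) (p y)" using X'.intersection[OF p(1)[OF xy(1)] p(1)[OF xy(2)] J(1)] by blast
    then obtain w where w: "w \<in> lists ({..<n} - J)" "fold r' w (p x) = p y" unfolding conn_def by blast
    have wn: "w \<in> lists {..<n}" using w(1) lists_mono[of "{..<n} - J" "{..<n}"] by blast
    let ?z = "fold r w x"
    have zX: "?z \<in> X" using fold_closed[OF wn xy(1)] .
    have pz: "p ?z = p y" using map_fold[of p r', OF p(2) wn xy(1)] w(2) by simp
    have "conn r ({..<n} - J) x ?z" using conn_word[OF w(1)] .
    then have "conn r {..<m} x ?z" by (rule conn_mono) (use J(3) n in \<open>auto simp: less_Suc_eq\<close>)
    then have "conn r {..<m} ?z x" using conn_sym[of "{..<m}" x ?z] n xy by auto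
    moreover have "conn r {..<m} x y" using J(2)[OF J(3)] by (rule conn_mono) (use n in auto)
    ultimately have "?z = y" using inj[OF zX xy(2) conn_trans pz] by blast
    then show ?thesis using \<open>conn r ({..<n} - J) x ?z\<close> by simp
  qed
  show "conn r ({..<n} - J) x y"
  proof (cases "m \<in> J \<or> J = {}")
    case True
    then show ?thesis using facet_case[OF xy J] connected[OF xy] by auto
  next
    case False
    have fin: "finite J" using J(1) finite_subset by blast
    \<comment> \<open>The maximum serves two ends: letters above \<open>j\<close> keep every face
      with rank in \<open>J\<close>, and letters below \<open>j\<close> keep the facet, so the
      second half of the path falls under \<open>facet_case\<close> with \<open>m\<close> added to
      \<open>J\<close>.\<close>
    define j where "j = Max J"
    have j: "j \<in> J" "\<And>i. i \<in> J \<Longrightarrow> i \<le> j" unfolding j_def using fin False by auto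
    have jm: "j < m" using j(1) J(1) False n by (metis lessThan_iff less_SucE subsetD)
    obtain z where z: "z \<in> X" "conn r {k. k < n \<and> int j < int k} x z" "conn r {k. k < n \<and> int k < int j} z y"
      using conn_cot_split[OF J(2)[OF j(1)] xy(1)] .
    have zx: "conn r {k. k < n \<and> int j < int k} z x" using conn_sym[OF z(2) _ xy(1)] by auto
    have "conn r ({..<n} - insert m J) z y"
    proof (rule facet_case[OF z(1) xy(2)])
      fix i assume "i \<in> insert m J"
      then consider "i = m" | "i \<in> J" by blast
      then show "conn r (cot n (int i)) z y"
      proof cases
        case 1
        show ?thesis using z(3) by (rule conn_mono) (use 1 jm in auto)
      next
        case 2
        have "conn r (cot n (int i)) z x" using zx by (rule conn_mono) (use j(2)[OF 2] in auto)
        then show ?thesis using conn_trans[OF _ J(2)[OF 2]] by blast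
      qed
    qed (use J n in auto)
    then have "conn r ({..<n} - J) z y" by (rule conn_mono) auto
    moreover have "conn r ({..<n} - J) x z" using z(2) by (rule conn_mono) (use j(2) in force)
    ultimately show ?thesis using conn_trans[of r _ x z y] by blast
  qed
next
  interpret X': polytopal_chamber_system n X' r' by fact
  fix i x assume "i < n" "x \<in> X"
  then show "r i x \<noteq> x" using X'.fixpoint_free[of i "p x"] p by metis
qed

text \<open>A face is coded as its rank paired with its residue, and countability numbers these
  pairs. The type \<open>nat rel\<close> is dictated by the polytopes over which
  \<open>universal_chiral\<close> quantifies.\<close>

lemma (in polytopal_chamber_system) nat_presentation:
  obtains s :: "nat rel" and face where "polytope_presentation n X r s face"
proof -
  define face0 where "face0 x i = (i, {y. conn r (cot n i) x y})" for x i
  define S where "S = (\<lambda>(x, i). face0 x i) ` (X \<times> {-1..int n})"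
  define face where "face x i = to_nat_on S (face0 x i)" for x i
  define s where "s = {(face x i, face y j) | x i y j. x \<in> X \<and> y \<in> X \<and> -1 \<le> i \<and> i \<le> int n \<and> -1 \<le> j \<and> j \<le> int n \<and>
    i \<le> j \<and> (\<exists>z \<in> X. face z i = face x i \<and> face z j = face y j)}"
  have "inj_on (to_nat_on S) S" unfolding S_def using countable by (intro inj_on_to_nat_on countable_image) auto
  then have "face x i = face y j \<longleftrightarrow> face0 x i = face0 y j"
    if "x \<in> X" "y \<in> X" "-1 \<le> i" "i \<le> int n" "-1 \<le> j" "j \<le> int n" for x y i j
    unfolding face_def using that by (intro inj_on_eq_iff[of "to_nat_on S" S]) (auto simp: S_def)
  moreover have "face0 x i = face0 y j \<longleftrightarrow> i = j \<and> conn r (cot n i) x y"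
    if xy: "x \<in> X" "y \<in> X" for x y i j
  proof
    assume "face0 x i = face0 y j"
    then show "i = j \<and> conn r (cot n i) x y" unfolding face0_def using conn_refl by fastforce
  next
    assume a: "i = j \<and> conn r (cot n i) x y"
    then have "conn r (cot n i) y x" using conn_sym[of "cot n i" x y] xy by auto
    then show "face0 x i = face0 y j" unfolding face0_def using a conn_trans by fast
  qed
  ultimately have face_eq: "face x i = face y j \<longleftrightarrow> i = j \<and> conn r (cot n i) x y"
    if "x \<in> X" "y \<in> X" "-1 \<le> i" "i \<le> int n" "-1 \<le> j" "j \<le> int n" for x y i j
    using that by simp
  have incident: "(face x i, face y j) \<in> s \<longleftrightarrow> i \<le> j \<and> (\<exists>z \<in> X. face z i = face x i \<and> face z j = face y j)"
    if xy: "x \<in> X" "y \<in> X" "-1 \<le> i" "i \<le> int n" "-1 \<le> j" "j \<le> int n" for x y i j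
  proof
    assume "(face x i, face y j) \<in> s"
    then obtain x' i' y' j' where a: "face x i = face x' i'" "face y j = face y' j'" "x' \<in> X" "y' \<in> X"
      "-1 \<le> i'" "i' \<le> int n" "-1 \<le> j'" "j' \<le> int n" "i' \<le> j'" "\<exists>z \<in> X. face z i' = face x' i' \<and> face z j' = face y' j'"
      unfolding s_def by blast
    have "i = i'" using face_eq[OF xy(1) a(3) xy(3,4) a(5,6)] a(1) by simp
    moreover have "j = j'" using face_eq[OF xy(2) a(4) xy(5,6) a(7,8)] a(2) by simp
    ultimately show "i \<le> j \<and> (\<exists>z \<in> X. face z i = face x i \<and> face z j = face y j)" using a by simp
  next
    assume "i \<le> j \<and> (\<exists>z \<in> X. face z i = face x i \<and> face z j = face y j)"
    then show "(face x i, face y j) \<in> s" unfolding s_def using xy by blast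
  qed
  have "polytope_presentation n X r s face"
  proof (intro polytope_presentation.intro incidence_presentation.intro incidence_presentation_axioms.intro)
    show "Field s = {face x i |x i. x \<in> X \<and> - 1 \<le> i \<and> i \<le> int n}"
    proof (intro equalityI subsetI)
      fix F assume "F \<in> Field s"
      then show "F \<in> {face x i |x i. x \<in> X \<and> - 1 \<le> i \<and> i \<le> int n}" unfolding Field_def s_def by blast
    next
      fix F assume "F \<in> {face x i |x i. x \<in> X \<and> - 1 \<le> i \<and> i \<le> int n}"
      then obtain x i where x: "x \<in> X" "-1 \<le> i" "i \<le> int n" "F = face x i" by blast
      then have "(F, F) \<in> s" using incident[of x x i i] by blast
      then show "F \<in> Field s" unfolding Field_def by blast
    qed
  qed (use face_eq incident in \<open>blast intro: chamber_system_axioms polytopal_chamber_system_axioms\<close>)+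
  then show ?thesis using that by blast
qed

text \<open>Connectedness is the axiom that no formula for the steps provides; passing to an orbit
  supplies it. The abelian cover and the coset chambers are both obtained in this way.\<close>

lemma orbit_chamber_system:
  assumes "\<And>i x. i < n \<Longrightarrow> x \<in> T \<Longrightarrow> q i x \<in> T" "\<And>i x. i < n \<Longrightarrow> x \<in> T \<Longrightarrow> q i (q i x) = x"
    and "\<And>i j x. i < n \<Longrightarrow> j < n \<Longrightarrow> i + 2 \<le> j \<Longrightarrow> x \<in> T \<Longrightarrow> q i (q j x) = q j (q i x)" and b: "b \<in> T"
  shows "chamber_system n (residue q n b) q" and "residue q n b \<subseteq> T"
proof -
  have T: "y \<in> T \<and> conn q {..<n} y b" if "conn q {..<n} b y" for y
    using that
  proof (induction rule: conn_induct)
    case (step z i)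
    have "conn q {..<n} (q i z) (q i (q i z))" using step.hyps by (intro conn_step)
    then have "conn q {..<n} (q i z) z" using assms(2)[of i z] step by simp
    then show ?case using step assms(1)[of i z] conn_trans by fastforce
  qed (use b in simp)
  then show "residue q n b \<subseteq> T" unfolding residue_def by blast
  then have sub: "y \<in> T" if "y \<in> residue q n b" for y using that by blast
  show "chamber_system n (residue q n b) q"
  proof
    fix i y assume i: "i < n" "y \<in> residue q n b"
    show "q i y \<in> residue q n b" using i conn_trans[OF _ conn_step[of i "{..<n}"]] unfolding residue_def by auto
    show "q i (q i y) = y" using assms(2) i sub by blast
  next
    fix i j y assume "i < n" "j < n" "i + 2 \<le> j" "y \<in> residue q n b"
    then show "q i (q j y) = q j (q i y)" using assms(3) sub by blast
  next
    fix y z assume "y \<in> residue q n b" "z \<in> residue q n b"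
    then show "conn q {..<n} y z" using T[of y] conn_trans[of q _ y b z] unfolding residue_def by blast
  qed (use residue_self in fast)
qed

lemma residue_iso:
  assumes X: "chamber_system n X r" and X': "chamber_system n X' r'" and m: "m \<le> n" and x: "x \<in> X"
    and p: "\<And>x. x \<in> X \<Longrightarrow> p x \<in> X'" "\<And>i x. i < n \<Longrightarrow> x \<in> X \<Longrightarrow> p (r i x) = r' i (p x)"
    and inj: "\<And>x y. x \<in> X \<Longrightarrow> y \<in> X \<Longrightarrow> conn r {..<m} x y \<Longrightarrow> p x = p y \<Longrightarrow> x = y"
  shows "chamber_iso m (residue r m x) r (residue r' m (p x)) r' p"
proof -
  interpret X: chamber_system n X r by fact
  interpret R: chamber_system m "residue r m x" r by (rule X.residue_chamber_system[OF m x])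
  note sub = X.residue_sub[OF m x]
  have "p ` residue r m x = residue r' m (p x)"
  proof (intro equalityI subsetI)
    fix z assume "z \<in> p ` residue r m x"
    then obtain y where y: "conn r {..<m} x y" "z = p y" unfolding residue_def by blast
    have "conn r' {..<m} (p x) (p y)" by (rule X.map_conn[of p r', OF p(2)]) (use y x m in auto)
    then show "z \<in> residue r' m (p x)" using y unfolding residue_def by simp
  next
    fix z assume "z \<in> residue r' m (p x)"
    then obtain w where w: "w \<in> lists {..<m}" "fold r' w (p x) = z" unfolding residue_def conn_def by blast
    have "p (fold r w x) = z" by (subst X.map_fold[of p r', OF p(2)]) (use w x m in auto)
    moreover have "fold r w x \<in> residue r m x" using conn_word[OF w(1)] unfolding residue_def by simp
    ultimately show "z \<in> p ` residue r m x" by blast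
  qed
  moreover have "inj_on p (residue r m x)"
  proof (rule inj_onI)
    fix y z assume "y \<in> residue r m x" "z \<in> residue r m x" "p y = p z"
    then show "y = z" using inj[OF _ _ R.connected] sub by blast
  qed
  ultimately show ?thesis unfolding chamber_iso_def bij_betw_def using p(2) sub m by auto
qed

section \<open>An infinite cover with the same facets\<close>

text \<open>The universal abelian cover of the adjacency graph of the facets: a chamber of the cover is a
  chamber together with an integral chain recording the walls crossed on the way to it, the
  indicator function of a residue of type \<open>{0..<k}\<close> standing for an oriented wall of a facet.\<close>

definition wall_chain :: "(nat \<Rightarrow> 'x \<Rightarrow> 'x) \<Rightarrow> nat \<Rightarrow> 'x \<Rightarrow> 'x \<Rightarrow> int" where
  "wall_chain r k y z = of_bool (z \<in> residue r k y)"

text \<open>Only the letter \<open>Suc k\<close>, the largest one in the application, passes to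
  another facet. Crossing adds the side of the wall that is left and subtracts the side that is
  entered, so crossing back cancels.\<close>

definition cover_step :: "(nat \<Rightarrow> 'x \<Rightarrow> 'x) \<Rightarrow> nat \<Rightarrow> nat \<Rightarrow> 'x \<times> ('x \<Rightarrow> int) \<Rightarrow> 'x \<times> ('x \<Rightarrow> int)" where
  "cover_step r k i = (\<lambda>(y, c). (r i y,
     if i = Suc k then \<lambda>z. c z + wall_chain r k y z - wall_chain r k (r i y) z else c))"

locale facet_cover = polytopal_chamber_system n X r
  for n :: nat and X :: "'x set" and r +
  fixes k :: nat and b :: 'x and col :: "'x \<Rightarrow> bool"
  assumes n: "n = Suc (Suc k)" and b: "b \<in> X" and rotary: "rotary_chambers n X r col"
begin

abbreviation q :: "nat \<Rightarrow> 'x \<times> ('x \<Rightarrow> int) \<Rightarrow> 'x \<times> ('x \<Rightarrow> int)" where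
  "q \<equiv> cover_step r k"

definition Y :: "('x \<times> ('x \<Rightarrow> int)) set" where
  "Y = residue q n (b, \<lambda>_. 0)"

definition T :: "('x \<times> ('x \<Rightarrow> int)) set" where
  "T = {(y, c). y \<in> X \<and> (\<forall>z. z \<notin> X \<longrightarrow> c z = 0)}"

lemma fst_q: "fst (q i x) = r i (fst x)"
  unfolding cover_step_def by (simp add: case_prod_unfold)

lemma wall_outside: "y \<in> X \<Longrightarrow> z \<notin> X \<Longrightarrow> wall_chain r k y z = 0"
  using residue_sub[of k y] n unfolding wall_chain_def by auto

lemma wall_step: "i < k \<Longrightarrow> y \<in> X \<Longrightarrow> wall_chain r k (r i y) = wall_chain r k y"
proof -
  assume i: "i < k" "y \<in> X"
  have "conn r {..<k} y (r i y)" using i by (intro conn_step) simp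
  moreover from this have "conn r {..<k} (r i y) y" using i n by (intro conn_sym[of "{..<k}" y]) auto
  ultimately have "residue r k (r i y) = residue r k y" using conn_trans unfolding residue_def by fast
  then show ?thesis unfolding wall_chain_def by simp
qed

lemma Y_system: "chamber_system n Y q" and Y_sub: "Y \<subseteq> T"
proof -
  have 1: "q i x \<in> T" if "i < n" "x \<in> T" for i x
    using that closed wall_outside unfolding T_def cover_step_def by (auto split: prod.splits)
  have 2: "q i (q i x) = x" if "i < n" "x \<in> T" for i x
    using that invol unfolding T_def cover_step_def by (auto split: prod.splits)
  have 3: "q i (q j x) = q j (q i x)" if ij: "i < n" "j < n" "i + 2 \<le> j" "x \<in> T" for i j x
  proof -
    obtain y c where x: "x = (y, c)" "y \<in> X" using ij(4) unfolding T_def by auto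
    \<comment> \<open>Since \<open>j\<close> is at most \<open>Suc k\<close>, a letter at least 2
      below it stays within the wall, so the change of the chain made by \<open>j\<close> is the
      same before and after \<open>i\<close>.\<close>
    have "i < k" using ij n by simp
    then show ?thesis unfolding x cover_step_def
      using commute[OF ij(1-3) x(2)] wall_step[of i y] wall_step[of i "r j y"] closed[OF ij(2) x(2)] x(2) by auto
  qed
  have 4: "(b, \<lambda>_. 0) \<in> T" using b unfolding T_def by simp
  show "chamber_system n Y q" "Y \<subseteq> T" unfolding Y_def by (rule orbit_chamber_system[of n T q "(b, \<lambda>_. 0)", OF 1 2 3 4], assumption+)+
qed

sublocale Y: chamber_system n Y q by (rule Y_system)

lemma fst_Y: "x \<in> Y \<Longrightarrow> fst x \<in> X"
  using Y_sub unfolding T_def by auto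

lemma base_Y: "(b, \<lambda>_. 0) \<in> Y"
  unfolding Y_def by simp

lemma snd_facet: "conn q {..<Suc k} x y \<Longrightarrow> snd y = snd x"
  by (induction rule: conn_induct) (auto simp: cover_step_def split: prod.splits)

text \<open>The chain is constant on a facet, so projecting it away loses nothing there. This feeds
  the quotient criterion and also identifies the facets of the cover with those below.\<close>

lemma facet_inj: "conn q {..<Suc k} x y \<Longrightarrow> fst x = fst y \<Longrightarrow> x = y"
  using snd_facet by (metis prod.collapse)

lemma polytopal: "polytopal_chamber_system n Y q"
  using facet_inj fst_Y fst_q
  by (intro Y.quotient_criterion[of X r "Suc k" fst] polytopal_chamber_system_axioms) (auto simp: n)

lemma facet_iso: "x \<in> Y \<Longrightarrow> chamber_iso (Suc k) (residue q (Suc k) x) q (residue r (Suc k) (fst x)) r fst"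
  using facet_inj fst_Y fst_q
  by (intro residue_iso[OF Y_system chamber_system_axioms]) (auto simp: n)

text \<open>An automorphism \<open>f\<close> downstairs carries walls to walls. It lifts to
  \<open>h\<close>, which transports the chain by \<open>f\<close> and adds the constant chain that
  takes the transported \<open>c0\<close> to \<open>c1\<close>. The steps of the cover only add to
  the chain, so they commute with such a translation; this closed formula for the lift is what the
  abelian cover offers.\<close>

lemma rotary_cover: "rotary_chambers n Y q (col \<circ> fst)"
  unfolding rotary_chambers_def
proof (intro conjI ballI impI)
  have col: "bicoloured n X r col" using rotary unfolding rotary_chambers_def by blast
  then show "bicoloured n Y q (col \<circ> fst)" using fst_Y unfolding bicoloured_def by (simp add: fst_q)
  fix x0 x1 assume x: "x0 \<in> Y" "x1 \<in> Y" and same: "(col \<circ> fst) x0 = (col \<circ> fst) x1"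
  obtain y0 c0 y1 c1 where xe: "x0 = (y0, c0)" "x1 = (y1, c1)" by (metis prod.exhaust)
  have yX: "y0 \<in> X" "y1 \<in> X" "\<And>z. z \<notin> X \<Longrightarrow> c1 z = 0" using x xe Y_sub unfolding T_def by auto
  obtain f where f: "chamber_aut n X r f" "f y0 = y1"
    using rotary same yX(1,2) xe unfolding rotary_chambers_def by (metis comp_apply fst_conv)
  define g where "g = inv_into X f"
  have g: "chamber_aut n X r g" unfolding g_def by (rule chamber_iso_inv[OF chamber_system_axioms f(1)])
  have bij: "bij_betw f X X" using f(1) unfolding chamber_iso_def by blast
  have gf: "g (f y) = y" "f (g y) = y" if "y \<in> X" for y
    using that bij unfolding g_def by (auto simp: bij_betw_def f_inv_into_f)
  have gX: "g y \<in> X" "f y \<in> X" if "y \<in> X" for y using that chamber_iso_mem g f(1) by metis+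
  have wall: "wall_chain r k y (g z) = wall_chain r k (f y) z" if "y \<in> X" "z \<in> X" for y z
  proof -
    have kn: "{..<k} \<subseteq> {..<n}" using n by auto
    have "conn r {..<k} y (g z) \<longleftrightarrow> conn r {..<k} (f y) z"
    proof
      assume "conn r {..<k} y (g z)"
      then have "conn r {..<k} (f y) (f (g z))"
        using map_conn[of f r "{..<k}" y "g z"] chamber_iso_step[OF f(1)] kn that by blast
      then show "conn r {..<k} (f y) z" using gf that by simp
    next
      assume "conn r {..<k} (f y) z"
      then have "conn r {..<k} (g (f y)) (g z)"
        using map_conn[of g r "{..<k}" "f y" z] chamber_iso_step[OF g] kn that gX by blast
      then show "conn r {..<k} y (g z)" using gf that by simp
    qed
    then show ?thesis unfolding wall_chain_def residue_def by simp
  qed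
  \<comment> \<open>\<open>g\<close> is the inverse of \<open>f\<close>. The value 0 off
    \<open>X\<close> keeps the chains within \<open>T\<close>, where they are determined by their
    values on \<open>X\<close>.\<close>
  define h where "h = (\<lambda>(y, c). (f y, \<lambda>z. if z \<in> X then c1 z + c (g z) - c0 (g z) else 0))"
  have h0: "h x0 = x1" unfolding h_def xe using f(2) yX by auto
  have step: "h (q i x) = q i (h x)" if i: "i < n" and xY: "x \<in> Y" for i x
  proof -
    obtain y c where x: "x = (y, c)" "y \<in> X" using xY fst_Y by (metis prod.collapse)
    have "f (r i y) = r i (f y)" using chamber_iso_step[OF f(1) i x(2)] .
    then show ?thesis unfolding x h_def cover_step_def
      using wall[OF x(2)] wall[OF closed[OF i x(2)]] wall_outside[OF gX(2)[OF x(2)]]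
        wall_outside[OF closed[OF i gX(2)[OF x(2)]]] by (auto simp: fun_eq_iff)
  qed
  have img: "h (fold q w x0) = fold q w x1" if "w \<in> lists {..<n}" for w
    using Y.map_fold[of h q, OF step that x(1)] h0 by simp
  have "h ` Y = Y"
  proof (intro equalityI subsetI)
    fix z assume "z \<in> h ` Y"
    then obtain y where "y \<in> Y" "z = h y" by blast
    then obtain w where w: "w \<in> lists {..<n}" "z = h (fold q w x0)" using Y.connected[OF x(1)] unfolding conn_def by blast
    then show "z \<in> Y" using img[OF w(1)] Y.fold_closed[OF w(1) x(2)] by simp
  next
    fix z assume "z \<in> Y"
    then obtain w where w: "w \<in> lists {..<n}" "fold q w x1 = z" using Y.connected[OF x(2)] unfolding conn_def by blast
    then have "z = h (fold q w x0)" using img[OF w(1)] by simp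
    then show "z \<in> h ` Y" using Y.fold_closed[OF w(1) x(1)] by (rule image_eqI)
  qed
  moreover have "inj_on h Y"
  proof (rule inj_onI)
    fix x x' assume xx: "x \<in> Y" "x' \<in> Y" "h x = h x'"
    obtain y c y' c' where e: "x = (y, c)" "x' = (y', c')" by (metis prod.exhaust)
    have yc: "y \<in> X" "y' \<in> X" "\<And>z. z \<notin> X \<Longrightarrow> c z = 0 \<and> c' z = 0" using xx e Y_sub unfolding T_def by auto
    have "f y = f y'" using xx(3) unfolding e h_def by simp
    then have y: "y = y'" using yc gf by metis
    have "c z = c' z" for z
    proof (cases "z \<in> X")
      case True
      have "snd (h x) (f z) = snd (h x') (f z)" using xx(3) by simp
      then show ?thesis unfolding e h_def using gX(2)[OF True] gf(1)[OF True] by simp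
    qed (use yc in simp)
    then show "x = x'" unfolding e using y by auto
  qed
  ultimately have "chamber_aut n Y q h" unfolding chamber_iso_def bij_betw_def using step by blast
  then show "\<exists>f. chamber_aut n Y q f \<and> f x0 = x1" using h0 by blast
qed

text \<open>Turning around a face of rank \<open>n - 3\<close> by the letters \<open>Suc k\<close>
  and \<open>k\<close> walks through the facets around it. The coordinate of the chain at
  \<open>b\<close> grows whenever the side of the wall containing \<open>b\<close> is left, and it
  never falls, so the walk cannot come back to its start; in a finite set an injective map would
  return.\<close>

lemma infinite_Y: "infinite Y"
proof
  assume fin: "finite Y"
  have kn: "k < n" "Suc k < n" using n by auto
  define g where "g x = q k (q (Suc k) x)" for x
  define p0 where "p0 = (b, \<lambda>_ :: 'x. 0 :: int)"
  have p0Y: "p0 \<in> Y" unfolding p0_def by (rule base_Y)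
  have gY: "g x \<in> Y" if "x \<in> Y" for x unfolding g_def using Y.closed kn that by blast
  have ginj: "x = y" if "x \<in> Y" "y \<in> Y" "g x = g y" for x y
    using that Y.invol[OF kn(1)] Y.invol[OF kn(2)] Y.closed[OF kn(2)] unfolding g_def by metis
  have pY: "(g ^^ j) p0 \<in> Y" for j by (induction j) (use p0Y gY in auto)
  have col: "col (r i y) \<longleftrightarrow> \<not> col y" if "i < n" "y \<in> X" for i y
    using rotary that unfolding rotary_chambers_def bicoloured_def by blast
  have inv: "conn r {k, Suc k} b (fst ((g ^^ j) p0)) \<and> (col (fst ((g ^^ j) p0)) \<longleftrightarrow> col b)" for j
  proof (induction j)
    case (Suc j)
    let ?y = "fst ((g ^^ j) p0)"
    have yX: "?y \<in> X" using fst_Y pY by blast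
    have e: "fst ((g ^^ Suc j) p0) = r k (r (Suc k) ?y)" unfolding g_def by (simp add: fst_q)
    have s: "conn r {k, Suc k} ?y (r (Suc k) ?y)" "conn r {k, Suc k} (r (Suc k) ?y) (r k (r (Suc k) ?y))"
      by (rule conn_step, simp)+
    have "conn r {k, Suc k} b (r k (r (Suc k) ?y))" using conn_trans[OF conn_trans[OF conjunct1[OF Suc.IH] s(1)] s(2)] .
    then show ?case unfolding e using Suc.IH col[OF kn(2) yX] col[OF kn(1) closed[OF kn(2) yX]] by simp
  qed (simp add: p0_def)
  \<comment> \<open>Entering on the side that contains \<open>b\<close> would lower the coordinate.
    The chamber entered would be joined to \<open>b\<close> both by the letters \<open>k\<close>,
    \<open>Suc k\<close> and by letters below \<open>k\<close>, so it would be \<open>b\<close>; but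
    an odd number of steps leads to it, against the colouring.\<close>
  have return: "wall_chain r k (r (Suc k) (fst ((g ^^ j) p0))) b = 0" for j
  proof (rule ccontr)
    let ?y = "r (Suc k) (fst ((g ^^ j) p0))"
    have yX: "?y \<in> X" "fst ((g ^^ j) p0) \<in> X" using fst_Y pY closed[OF kn(2)] by blast+
    assume "wall_chain r k ?y b \<noteq> 0"
    then have c1: "conn r {..<k} ?y b" unfolding wall_chain_def residue_def by (auto split: if_splits)
    have "conn r {k, Suc k} (fst ((g ^^ j) p0)) ?y" by (rule conn_step) simp
    then have c2: "conn r {k, Suc k} b ?y" using inv conn_trans by metis
    have c3: "conn r {k, Suc k} ?y b" using conn_sym[OF c2] kn b by auto
    have "?y = b"
    proof (rule conn_cot_eq[OF yX(1) b])
      fix i assume "i < n"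
      show "conn r (cot n (int i)) ?y b"
      proof (cases "i < k")
        case True
        show ?thesis using c3 by (rule conn_mono) (use True n in auto)
      next
        case False
        show ?thesis using c1 by (rule conn_mono) (use False n in auto)
      qed
    qed
    then show False using inv[of j] col[OF kn(2) yX(2)] by auto
  qed
  have snd_step: "snd ((g ^^ Suc j) p0) b = snd ((g ^^ j) p0) b + wall_chain r k (fst ((g ^^ j) p0)) b" for j
    using return[of j] unfolding g_def by (simp add: cover_step_def case_prod_unfold)
  have pos: "snd ((g ^^ Suc j) p0) b \<ge> 1" for j
  proof (induction j)
    case 0
    show ?case unfolding snd_step by (simp add: p0_def wall_chain_def)
  next
    case (Suc j)
    then show ?case unfolding snd_step[of "Suc j"] by (simp add: wall_chain_def)
  qed
  have "\<not> inj_on (\<lambda>j. (g ^^ j) p0) UNIV"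
    using fin pY finite_imageD[of "\<lambda>j. (g ^^ j) p0" UNIV] finite_subset[of "range (\<lambda>j. (g ^^ j) p0)" Y] by auto
  then obtain i j where "(g ^^ i) p0 = (g ^^ j) p0" "i < j" unfolding inj_on_def by (metis linorder_neqE_nat)
  then obtain d where "(g ^^ i) p0 = (g ^^ (i + Suc d)) p0" by (metis add_Suc_right less_imp_Suc_add)
  \<comment> \<open>Injectivity of \<open>g\<close> on \<open>Y\<close> cancels the first
    \<open>i\<close> rounds.\<close>
  then have "p0 = (g ^^ Suc d) p0"
  proof (induction i)
    case (Suc i)
    have "(g ^^ i) p0 = (g ^^ (i + Suc d)) p0"
      by (rule ginj[OF pY pY]) (use Suc.prems in simp)
    then show ?case by (rule Suc.IH)
  qed simp
  then have "snd p0 b \<ge> 1" using pos[of d] by metis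
  then show False unfolding p0_def by simp
qed

end

section \<open>Infinity of the universal chiral polytope\<close>

lemma finite_flags: "finite (Field s) \<Longrightarrow> finite (flags s)"
  by (rule finite_subset[of _ "Pow (Field s)"]) (auto simp: flags_def Chains_def Field_def)

lemma facet_presents:
  assumes P: "polytope_presentation (Suc m) X r P face" and iso: "facets_isomorphic (Suc m) P K" and x: "x \<in> X"
  obtains face' where "polytope_presentation m (residue r m x) r K face'"
proof -
  interpret polytope_presentation "Suc m" X r P face by fact
  have "face_rank P (face x (int m)) = int m" "face x (int m) \<in> Field P"
    using face_rank_face[OF x] face_mem[OF x] by auto
  then obtain g where "poset_iso (facet P (face x (int m))) K g"
    using iso unfolding facets_isomorphic_def poset_isomorphic_iff by auto
  then show ?thesis using that presentation_transport[OF facet_presentation[OF P x]] by blast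
qed

text \<open>A finite \<open>P\<close> cannot cover an infinite polytope, and universality would make
  it cover the abelian cover of its own facet graph. That cover is chiral: an automorphism taking a
  chamber to its 0-neighbour would restrict to one facet, where chirality of \<open>K\<close>
  forbids it.\<close>

lemma universal_chiral_infinite:
  assumes univ: "universal_chiral n K P" and n: "n = Suc (Suc k)"
    and P: "chiral_polytope (Suc k) K"
  shows "infinite (Field P)"
proof
  assume fin: "finite (Field P)"
  have chi: "chiral_polytope n P" and facets: "facets_isomorphic n P K"
    and max: "\<And>R :: nat rel. chiral_polytope n R \<Longrightarrow> facets_isomorphic n R K \<Longrightarrow> covers P R"
    using univ unfolding universal_chiral_def by auto
  have pP: "abstract_polytope n P" using chi unfolding chiral_polytope_def by blast
  interpret F: polytope_presentation n "flags P" "adj_flag P" P "face_at P" by (rule flags_presentation[OF pP])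
  obtain col where col: "rotary_chambers n (flags P) (adj_flag P) col"
    using chi F.chiral_iff unfolding chiral_chambers_def by blast
  obtain b where b: "b \<in> flags P" using F.nonempty by blast
  interpret C: facet_cover n "flags P" "adj_flag P" k b col by unfold_locales (use n b col in auto)
  interpret Y: polytopal_chamber_system n C.Y C.q by (rule C.polytopal)
  obtain R :: "nat rel" and face where R: "polytope_presentation n C.Y C.q R face" by (rule Y.nat_presentation)
  interpret R: polytope_presentation n C.Y C.q R face by fact
  have pres: "\<exists>face'. polytope_presentation (Suc k) (residue (adj_flag P) (Suc k) \<Psi>) (adj_flag P) K face'"
    if "\<Psi> \<in> flags P" for \<Psi>
    using facet_presents[of "Suc k" "flags P" "adj_flag P" P "face_at P" K \<Psi>] F.polytope_presentation_axioms facets that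
    unfolding n by blast
  have "chiral_chambers n C.Y C.q" unfolding chiral_chambers_def
  proof (intro conjI ballI allI impI)
    show "0 < n" using n by simp
    show "\<exists>c. rotary_chambers n C.Y C.q c" using C.rotary_cover by blast
    fix x f assume x: "x \<in> C.Y" and f: "chamber_aut n C.Y C.q f"
    show "f x \<noteq> C.q 0 x"
    proof
      let ?res = "residue C.q (Suc k) x" and ?res' = "residue (adj_flag P) (Suc k) (fst x)"
      assume fx: "f x = C.q 0 x"
      have q0: "C.q 0 x \<in> ?res" unfolding residue_def by (simp add: conn_step)
      then have "chamber_aut (Suc k) ?res C.q f"
        using C.Y.chamber_aut_residue[of "Suc k" x f x] x f fx n by simp
      then obtain f' where f': "chamber_aut (Suc k) ?res' (adj_flag P) f'" "f' (fst x) = fst (f x)"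
        using chamber_aut_conj[OF C.Y.residue_chamber_system[of "Suc k" x] C.facet_iso[OF x], of f x] x n by auto
      obtain face' where "polytope_presentation (Suc k) ?res' (adj_flag P) K face'" using pres[OF C.fst_Y[OF x]] by blast
      then have "chiral_chambers (Suc k) ?res' (adj_flag P)" using polytope_presentation.chiral_iff P by blast
      then show False using f' fx C.fst_q[of 0 x] unfolding chiral_chambers_def by auto
    qed
  qed
  then have "chiral_polytope n R" using R.chiral_iff by blast
  moreover have "facets_isomorphic n R K" unfolding facets_isomorphic_def
  proof (intro ballI impI)
    fix F assume F: "F \<in> Field R" "face_rank R F = int n - 1"
    then obtain x where x: "x \<in> C.Y" "F = face x (int n - 1)" using R.face_rank_eqE by blast
    have Fx: "F = face x (int (Suc k))" using x(2) n by simp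
    have "polytope_presentation (Suc k) (residue C.q (Suc k) x) C.q (facet R F) face"
      unfolding Fx by (rule facet_presentation) (use R x n in auto)
    moreover obtain face' where "polytope_presentation (Suc k) (residue (adj_flag P) (Suc k) (fst x)) (adj_flag P) K face'"
      using pres[OF C.fst_Y[OF x(1)]] by blast
    ultimately obtain g where "poset_iso (facet R F) K g"
      using poset_iso_presentation[OF polytope_presentation.axioms(1) polytope_presentation.axioms(1) C.facet_iso[OF x(1)]] by metis
    then show "poset_isomorphic (facet R F) K" unfolding poset_isomorphic_iff by blast
  qed
  ultimately have "covers P R" by (rule max)
  then obtain h where "h ` Field P = Field R" unfolding covers_def by blast
  then have "finite (Field R)" using fin by (metis finite_imageI)
  then have "finite (flags R)" by (rule finite_flags)
  then have "finite (R.flag_of ` C.Y)" using R.flags_eq by simp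
  moreover have "inj_on R.flag_of C.Y" using R.flag_of_inj by (intro inj_onI)
  ultimately have "finite C.Y" using finite_imageD by blast
  then show False using C.infinite_Y by blast
qed

section \<open>Words\<close>

text \<open>Automorphisms commute with passing to adjacent flags.  Hence the image of a flag under a product
  of rotations (acting on the left) is reached by passing to adjacent flags in the order in which
  the letters are read from left to right.\<close>

definition reflection_word :: "word \<Rightarrow> nat list" where
  "reflection_word u = concat (map (\<lambda>(i, b). if b then [i, i - 1] else [i - 1, i]) u)"

definition bar_word :: "word \<Rightarrow> word" where
  "bar_word u = concat (map bar_letter u)"

lemma reflection_word_simps [simp]:
  "reflection_word [] = []"
  "reflection_word ((i, b) # u) = (if b then [i, i - 1] else [i - 1, i]) @ reflection_word u"
  "reflection_word (u @ v) = reflection_word u @ reflection_word v"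
  unfolding reflection_word_def by simp_all

lemma bar_word_simps [simp]:
  "bar_word [] = []"
  "bar_word (l # u) = bar_letter l @ bar_word u"
  "bar_word (u @ v) = bar_word u @ bar_word v"
  unfolding bar_word_def by simp_all

lemma words_simps [simp]:
  "[] \<in> words m"
  "(i, b) # u \<in> words m \<longleftrightarrow> 1 \<le> i \<and> i < m \<and> u \<in> words m"
  "u @ v \<in> words m \<longleftrightarrow> u \<in> words m \<and> v \<in> words m"
  unfolding words_def by auto

lemma tau_word_words: "1 \<le> i \<Longrightarrow> j < m \<Longrightarrow> tau_word i j \<in> words m"
  unfolding tau_word_def words_def by auto

lemma tau_word_Suc: "i \<le> Suc j \<Longrightarrow> tau_word i (Suc j) = tau_word i j @ [(Suc j, False)]"
  unfolding tau_word_def by simp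

lemma tau_word_Cons: "i \<le> j \<Longrightarrow> tau_word i j = (i, False) # tau_word (Suc i) j"
  unfolding tau_word_def using upt_conv_Cons[of i "Suc j"] by simp

lemma reflection_word_lists: "u \<in> words m \<Longrightarrow> m \<le> n \<Longrightarrow> reflection_word u \<in> lists {..<n}"
  by (induction u) (auto split: if_splits)

lemma bar_word_words: "u \<in> words m \<Longrightarrow> bar_word u \<in> words m"
  by (induction u) auto

definition inv_word :: "word \<Rightarrow> word" where
  "inv_word u = rev (map (\<lambda>(i, b). (i, \<not> b)) u)"

lemma inv_word_simps [simp]: "inv_word [] = []" "inv_word ((i, b) # u) = inv_word u @ [(i, \<not> b)]"
  unfolding inv_word_def by simp_all

lemma inv_word_words: "u \<in> words m \<Longrightarrow> inv_word u \<in> words m"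
  by (induction u) auto

lemma word_eq_inv: "u \<in> words m \<Longrightarrow> word_eq m (inv_word u @ u) []"
proof (induction u)
  case Nil
  then show ?case by (simp add: word_eq.refl)
next
  case (Cons l u)
  obtain i b where l: "l = (i, b)" by (metis prod.exhaust)
  have i: "1 \<le> i" "i < m" "u \<in> words m" using Cons.prems l by auto
  have "word_eq m ([(i, \<not> b)] @ [(i, b)]) []" using word_eq.cancel[OF i(1,2), of "\<not> b"] by simp
  then have "word_eq m (([(i, \<not> b)] @ [(i, b)]) @ u) ([] @ u)" by (rule word_eq.append) (rule word_eq.refl)
  then have "word_eq m (inv_word u @ (([(i, \<not> b)] @ [(i, b)]) @ u)) (inv_word u @ ([] @ u))"
    by (rule word_eq.append[OF word_eq.refl])
  then show ?case using Cons.IH[OF i(3)] word_eq.trans l by simp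
qed

section \<open>Words acting on chambers\<close>

context chamber_system
begin

text \<open>In terms of reflections \<open>\<sigma>\<^sub>i\<dots>\<sigma>\<^sub>j\<close>
  telescopes to \<open>\<rho>\<^sub>i\<^sub>-\<^sub>1\<rho>\<^sub>j\<close>.\<close>

lemma tau_word_act:
  assumes "1 \<le> i" "i \<le> j" "j < n" "x \<in> X"
  shows "fold r (reflection_word (tau_word i j)) x = r j (r (i - 1) x)"
  using assms(2,3)
proof (induction j rule: dec_induct)
  case base
  have "tau_word i i = [(i, False)]" unfolding tau_word_def by simp
  then show ?case by simp
next
  case (step j)
  have "tau_word i (Suc j) = tau_word i j @ [(Suc j, False)]" using tau_word_Suc step by simp
  then have "fold r (reflection_word (tau_word i (Suc j))) x = r (Suc j) (r j (r j (r (i - 1) x)))"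
    using step by simp
  then show ?case using invol[of j "r (i - 1) x"] closed[of "i - 1" x] assms step by simp
qed

text \<open>The relators act trivially because the letters \<open>i - 1\<close> and \<open>j\<close>
  commute. Since \<open>word_eq\<close> also relates words with letters out of range, the induction
  carries along that membership in \<open>words m\<close> is invariant. With \<open>m\<close> below
  the rank, facet words of \<open>K\<close> act on the flags of \<open>P\<close>.\<close>

lemma word_eq_act:
  assumes eq: "word_eq m u v" and m: "m \<le> n" and u: "u \<in> words m"
  shows "v \<in> words m \<and> (\<forall>x \<in> X. fold r (reflection_word u) x = fold r (reflection_word v) x)"
proof -
  have "(u \<in> words m \<longleftrightarrow> v \<in> words m) \<and>
    (u \<in> words m \<longrightarrow> (\<forall>x \<in> X. fold r (reflection_word u) x = fold r (reflection_word v) x))"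
    using eq
  proof induction
    case (append u u' v v')
    then show ?case using fold_closed[OF reflection_word_lists[OF _ m]] by auto
  next
    case (cancel i b)
    have "i - 1 < n" "i < n" using cancel m by auto
    then show ?case using cancel invol closed by auto
  next
    case (relator i j)
    have ij: "i - 1 < n" "j < n" "i - 1 + 2 \<le> j" "i \<le> j" using relator m by auto
    have "fold r (reflection_word (tau_word i j @ tau_word i j)) x = x" if x: "x \<in> X" for x
    proof -
      have y: "r j (r (i - 1) x) \<in> X" using closed ij x by blast
      have "fold r (reflection_word (tau_word i j @ tau_word i j)) x = r j (r (i - 1) (r j (r (i - 1) x)))"
        using tau_word_act[OF relator(1) ij(4,2)] x y by simp
      also have "r (i - 1) (r j (r (i - 1) x)) = r j (r (i - 1) (r (i - 1) x))"
        using commute[OF ij(1-3)] closed[OF ij(1) x] by simp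
      finally show ?thesis using invol ij(1,2) x by simp
    qed
    then show ?case using tau_word_words relator by auto
  qed auto
  then show ?thesis using u by blast
qed

text \<open>The formulas for \<open>bar\<close> are conjugation by \<open>\<rho>\<^sub>0\<close>: it
  inverts \<open>\<rho>\<^sub>0\<rho>\<^sub>1\<close>, turns
  \<open>\<rho>\<^sub>1\<rho>\<^sub>2\<close> into
  \<open>\<rho>\<^sub>0\<rho>\<^sub>1\<rho>\<^sub>0\<rho>\<^sub>2 =
  \<sigma>\<^sub>1\<sigma>\<^sub>1\<sigma>\<^sub>2\<close>, and fixes the later rotations. On
  chambers, conjugation becomes a shift of the start to the 0-neighbour, which makes sense even
  where no automorphism \<open>\<rho>\<^sub>0\<close> exists.\<close>

lemma bar_word_act:
  assumes m: "m \<le> n" and u: "u \<in> words m" and n: "0 < n" and x: "x \<in> X"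
  shows "fold r (reflection_word (bar_word u)) (r 0 x) = r 0 (fold r (reflection_word u) x)"
  using u x
proof (induction u arbitrary: x)
  case (Cons l u)
  obtain i b where l: "l = (i, b)" by (metis prod.exhaust)
  have i: "1 \<le> i" "i < n" "i < m" "u \<in> words m" "i - 1 < n" using Cons.prems l m by auto
  let ?y = "fold r (if b then [i, i - 1] else [i - 1, i]) x"
  have yX: "?y \<in> X" using closed i Cons.prems by simp
  have "fold r (reflection_word (bar_letter l)) (r 0 x) = r 0 ?y"
  proof -
    consider "i = 1" | "i = 2" | "3 \<le> i" using i by linarith
    then show ?thesis
    proof cases
      case 1
      then show ?thesis using l invol n closed i Cons.prems by simp
    next
      case 2
      have n2: "0 < n" "1 < n" "2 < n" using i 2 by auto
      have c: "r 0 (r 2 z) = r 2 (r 0 z)" if "z \<in> X" for z using commute[of 0 2 z] n2 that by simp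
      show ?thesis
      proof (cases b)
        case True
        have "fold r (reflection_word (bar_letter l)) (r 0 x) = r 0 (r 1 (r 0 (r 1 (r 1 (r 2 (r 0 x))))))"
          using l 2 True by (simp add: numeral_2_eq_2)
        also have "\<dots> = r 0 (r 1 (r 0 (r 2 (r 0 x))))"
          using invol[OF n2(2)] closed n2 Cons.prems by simp
        also have "\<dots> = r 0 (r 1 (r 2 x))"
          using c[of "r 0 x"] invol[OF n2(1)] closed n2 Cons.prems by simp
        finally show ?thesis using 2 True by (simp add: numeral_2_eq_2)
      next
        case False
        have "fold r (reflection_word (bar_letter l)) (r 0 x) = r 2 (r 1 (r 1 (r 0 (r 1 (r 0 (r 0 x))))))"
          using l 2 False by (simp add: numeral_2_eq_2)
        also have "\<dots> = r 2 (r 0 (r 1 x))"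
          using invol n2 closed Cons.prems by simp
        also have "\<dots> = r 0 (r 2 (r 1 x))" using c[of "r 1 x"] closed n2 Cons.prems by simp
        finally show ?thesis using 2 False by (simp add: numeral_2_eq_2)
      qed
    next
      case 3
      have "r 0 (r i z) = r i (r 0 z)" "r 0 (r (i - 1) z) = r (i - 1) (r 0 z)" if "z \<in> X" for z
        using commute[of 0 i z] commute[of 0 "i - 1" z] 3 i that n by auto
      then show ?thesis using l 3 i closed Cons.prems by simp
    qed
  qed
  then show ?case using Cons.IH[OF i(4) yX] l by simp
qed simp

end

section \<open>The group \<open>W\<^sup>+\<close>\<close>

lemma word_eq_words: "word_eq m u v \<Longrightarrow> u \<in> words m \<longleftrightarrow> v \<in> words m"
  by (induction rule: word_eq.induct) (auto simp: tau_word_words)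

lemma word_rel_equiv: "equiv (words m) (word_rel m)"
proof (rule equivI)
  show "refl_on (words m) (word_rel m)" unfolding word_rel_def by (intro refl_onI) (auto intro: word_eq.refl)
  show "sym (word_rel m)" unfolding word_rel_def by (intro symI) (auto intro: word_eq.sym)
  show "trans (word_rel m)" unfolding word_rel_def by (intro transI) (auto intro: word_eq.trans)
qed (auto simp: word_rel_def)

abbreviation word_class :: "nat \<Rightarrow> word \<Rightarrow> word set" where
  "word_class m u \<equiv> word_rel m `` {u}"

lemma word_class_mem: "u \<in> words m \<Longrightarrow> v \<in> word_class m u \<longleftrightarrow> word_eq m u v"
  unfolding word_rel_def using word_eq_words by auto

lemma word_class_eq: "u \<in> words m \<Longrightarrow> v \<in> words m \<Longrightarrow> word_class m u = word_class m v \<longleftrightarrow> word_eq m u v"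
  using eq_equiv_class_iff[OF word_rel_equiv] unfolding word_rel_def by simp

lemma WplusE:
  assumes "C \<in> carrier (Wplus m)"
  obtains u where "u \<in> words m" "C = word_class m u"
  using assms unfolding Wplus_def by (auto elim!: quotientE)

lemma word_class_carrier: "u \<in> words m \<Longrightarrow> word_class m u \<in> carrier (Wplus m)"
  unfolding Wplus_def by (simp add: quotientI)

text \<open>Products and \<open>bar\<close> on classes are defined as unions over all
  representatives; for maps compatible with the congruence all members of the union are
  equal.\<close>

lemma UN_word_class:
  assumes u: "u \<in> words m" and f: "\<And>v. word_eq m u v \<Longrightarrow> v \<in> words m \<Longrightarrow> f v \<in> words m \<and> word_eq m (f u) (f v)"
  shows "(\<Union>v \<in> word_class m u. word_class m (f v)) = word_class m (f u)"
proof -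
  have "word_class m (f v) = word_class m (f u)" if "v \<in> word_class m u" for v
  proof -
    have v: "word_eq m u v" "v \<in> words m" using that word_class_mem[OF u] word_eq_words u by auto
    show ?thesis using f[OF v] f[OF word_eq.refl u] word_class_eq[of "f v" m "f u"] word_eq.sym by blast
  qed
  moreover have "u \<in> word_class m u" using word_class_mem[OF u] word_eq.refl by blast
  ultimately show ?thesis by blast
qed

lemma Wplus_mult:
  assumes u: "u \<in> words m" and v: "v \<in> words m"
  shows "word_class m u \<otimes>\<^bsub>Wplus m\<^esub> word_class m v = word_class m (u @ v)"
proof -
  have "(\<Union>v' \<in> word_class m v. word_class m (u' @ v')) = word_class m (u' @ v)" if "u' \<in> words m" for u'
    using UN_word_class[OF v, of "\<lambda>v'. u' @ v'"] that word_eq.append[OF word_eq.refl] by auto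
  moreover have "u' \<in> words m" if "u' \<in> word_class m u" for u'
    using that word_class_mem[OF u] word_eq_words u by blast
  ultimately have "word_class m u \<otimes>\<^bsub>Wplus m\<^esub> word_class m v = (\<Union>u' \<in> word_class m u. word_class m (u' @ v))"
    unfolding Wplus_def by simp
  also have "\<dots> = word_class m (u @ v)"
    using UN_word_class[OF u, of "\<lambda>u'. u' @ v"] v word_eq.append[OF _ word_eq.refl] by auto
  finally show ?thesis .
qed

lemma Wplus_one: "\<one>\<^bsub>Wplus m\<^esub> = word_class m []"
  unfolding Wplus_def by simp

lemma Wplus_group: "group (Wplus m)"
proof (rule groupI)
  show "\<one>\<^bsub>Wplus m\<^esub> \<in> carrier (Wplus m)" unfolding Wplus_one by (simp add: word_class_carrier)
  fix C assume "C \<in> carrier (Wplus m)"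
  then obtain u where u: "u \<in> words m" "C = word_class m u" by (rule WplusE)
  show "\<one>\<^bsub>Wplus m\<^esub> \<otimes>\<^bsub>Wplus m\<^esub> C = C" unfolding Wplus_one u(2) using Wplus_mult[of "[]" m u] u by simp
  show "\<exists>D \<in> carrier (Wplus m). D \<otimes>\<^bsub>Wplus m\<^esub> C = \<one>\<^bsub>Wplus m\<^esub>"
  proof
    show "word_class m (inv_word u) \<in> carrier (Wplus m)" using word_class_carrier inv_word_words u by blast
    show "word_class m (inv_word u) \<otimes>\<^bsub>Wplus m\<^esub> C = \<one>\<^bsub>Wplus m\<^esub>"
      unfolding Wplus_one u(2) Wplus_mult[OF inv_word_words[OF u(1)] u(1)]
      using word_class_eq[of "inv_word u @ u" m "[]"] word_eq_inv u inv_word_words by simp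
  qed
  fix D assume "D \<in> carrier (Wplus m)"
  then obtain v where v: "v \<in> words m" "D = word_class m v" by (rule WplusE)
  show "C \<otimes>\<^bsub>Wplus m\<^esub> D \<in> carrier (Wplus m)" unfolding u v Wplus_mult[OF u(1) v(1)] using u v by (simp add: word_class_carrier)
  fix E assume "E \<in> carrier (Wplus m)"
  then obtain w where w: "w \<in> words m" "E = word_class m w" by (rule WplusE)
  show "C \<otimes>\<^bsub>Wplus m\<^esub> D \<otimes>\<^bsub>Wplus m\<^esub> E = C \<otimes>\<^bsub>Wplus m\<^esub> (D \<otimes>\<^bsub>Wplus m\<^esub> E)"
    unfolding u v w using u(1) v(1) w(1) by (simp add: Wplus_mult)
qed

lemma Wplus_relator:
  assumes "1 \<le> i" "i < j" "j < m"
  shows "word_class m (tau_word i j) \<otimes>\<^bsub>Wplus m\<^esub> word_class m (tau_word i j) = \<one>\<^bsub>Wplus m\<^esub>"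
  using assms word_class_eq[of "tau_word i j @ tau_word i j" m "[]"] word_eq.relator tau_word_words[of i j m]
  by (simp add: Wplus_mult Wplus_one)

lemma bar_word_tau: "3 \<le> i \<Longrightarrow> bar_word (tau_word i j) = tau_word i j"
proof -
  have "bar_word (map (\<lambda>k. (k, False)) ks) = map (\<lambda>k. (k, False)) ks" if "\<forall>k \<in> set ks. 3 \<le> k" for ks
    using that by (induction ks) auto
  then show "3 \<le> i \<Longrightarrow> bar_word (tau_word i j) = tau_word i j" unfolding tau_word_def by simp
qed

text \<open>The relators decide. Modulo the congruence, \<open>bar\<close> fixes
  \<open>tau_word 1 j\<close> and all \<open>tau_word i j\<close> with \<open>i\<close> at least 3.
  Only \<open>tau_word 2 j\<close> changes, to \<open>\<sigma>\<^sub>1\<close> followed by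
  \<open>tau_word 1 j\<close>, and the square of that has to be shown trivial.\<close>

lemma word_eq_bar:
  assumes "word_eq m u v"
  shows "word_eq m (bar_word u) (bar_word v)"
  using assms
proof induction
  case (append u u' v v')
  then show ?case by (auto intro: word_eq.append)
next
  case (cancel i b)
  have c: "word_eq m [(1, b), (1, \<not> b)] []" for b using cancel by (intro word_eq.cancel) auto
  consider "i = 1" | "i = 2" | "3 \<le> i" using cancel by linarith
  then show ?case
  proof cases
    case 1
    then show ?thesis using c[of "\<not> b"] by simp
  next
    case 2
    have m: "2 < m" using cancel 2 by simp
    then have w: "[(2, True), (1, True), (1, True)] \<in> words m" "[(1, False), (1, False), (2, False)] \<in> words m"
      by auto
    have 1: "word_eq m ([(2, True), (1, True), (1, True)] @ [(1, False), (1, False), (2, False)]) []"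
      using word_eq_inv[OF w(2)] by simp
    have 2: "word_eq m ([(1, False), (1, False), (2, False)] @ [(2, True), (1, True), (1, True)]) []"
      using word_eq_inv[OF w(1)] by simp
    show ?thesis using 1 2 \<open>i = 2\<close> by (cases b) simp_all
  next
    case 3
    then show ?thesis using word_eq.cancel[OF cancel, of b] by simp
  qed
next
  case (relator i j)
  interpret W: group "Wplus m" by (rule Wplus_group)
  have w1: "[(1, b)] \<in> words m" for b using relator by simp
  let ?S = "word_class m [(1, False)]" and ?S' = "word_class m [(1, True)]"
  have S: "?S \<in> carrier (Wplus m)" "?S' \<in> carrier (Wplus m)" using w1 word_class_carrier by blast+
  have c1: "word_eq m [(1, b), (1, \<not> b)] []" for b using relator by (intro word_eq.cancel) auto
  have SS': "?S \<otimes>\<^bsub>Wplus m\<^esub> ?S' = \<one>\<^bsub>Wplus m\<^esub>" "?S' \<otimes>\<^bsub>Wplus m\<^esub> ?S = \<one>\<^bsub>Wplus m\<^esub>"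
    using word_class_eq[of "[(1, False), (1, True)]" m "[]"] word_class_eq[of "[(1, True), (1, False)]" m "[]"]
      c1[of False] c1[of True] w1 by (simp_all add: Wplus_mult Wplus_one)
  consider "i = 1" | "i = 2" | "3 \<le> i" using relator by linarith
  then show ?case
  proof cases
    case 1
    have j: "2 \<le> j" "1 \<le> j" using relator 1 by auto
    have t: "tau_word 1 j = (1, False) # (2, False) # tau_word 3 j"
      using tau_word_Cons[of 1 j] tau_word_Cons[of 2 j] j by (simp add: numeral_2_eq_2 numeral_3_eq_3)
    have "bar_word (tau_word 1 j) = ([(1, True), (1, False)] @ [(1, False), (2, False)]) @ tau_word 3 j"
      unfolding t using bar_word_tau[of 3 j] by simp
    moreover have "word_eq m (([(1, True), (1, False)] @ [(1, False), (2, False)]) @ tau_word 3 j)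
        (([] @ [(1, False), (2, False)]) @ tau_word 3 j)"
      using c1[of True] by (intro word_eq.append word_eq.refl) simp
    ultimately have "word_eq m (bar_word (tau_word 1 j)) (tau_word 1 j)" unfolding t by simp
    then have "word_eq m (bar_word (tau_word 1 j) @ bar_word (tau_word 1 j)) (tau_word 1 j @ tau_word 1 j)"
      using word_eq.append by blast
    then show ?thesis using word_eq.trans word_eq.relator[OF relator] 1 by simp
  next
    case 2
    have j: "2 < j" "j < m" using relator 2 by auto
    have t: "tau_word 2 j = (2, False) # tau_word 3 j" "tau_word 1 j = (1, False) # tau_word 2 j"
      using tau_word_Cons[of 1 j] tau_word_Cons[of 2 j] j by (simp_all add: numeral_2_eq_2 numeral_3_eq_3)
    let ?T = "word_class m (tau_word 1 j)" and ?U = "word_class m (tau_word 2 j)"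
    have tw: "tau_word 1 j \<in> words m" "tau_word 2 j \<in> words m" using tau_word_words j by auto
    have T: "?T \<in> carrier (Wplus m)" "?U \<in> carrier (Wplus m)" using word_class_carrier tw by blast+
    have TT: "?T \<otimes>\<^bsub>Wplus m\<^esub> ?T = \<one>\<^bsub>Wplus m\<^esub>" "?U \<otimes>\<^bsub>Wplus m\<^esub> ?U = \<one>\<^bsub>Wplus m\<^esub>"
      using Wplus_relator j by auto
    have TU: "?T = ?S \<otimes>\<^bsub>Wplus m\<^esub> ?U" using Wplus_mult[OF w1 tw(2)] t(2) by simp
    have U: "?S' \<otimes>\<^bsub>Wplus m\<^esub> ?T = ?U" unfolding TU using W.m_assoc[OF S(2) S(1) T(2)] SS'(2) T by simp
    \<comment> \<open>\<open>T\<close> and \<open>U\<close> have trivial squares and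
      \<open>T = S U\<close>. The element \<open>T S'\<close> is conjugate to
      \<open>S' T = U\<close>, so its square is trivial, and so is that of its inverse
      \<open>S T\<close>.\<close>
    have "?T \<otimes>\<^bsub>Wplus m\<^esub> ?S' \<otimes>\<^bsub>Wplus m\<^esub> (?T \<otimes>\<^bsub>Wplus m\<^esub> ?S') = ?S \<otimes>\<^bsub>Wplus m\<^esub> (?S' \<otimes>\<^bsub>Wplus m\<^esub> ?T \<otimes>\<^bsub>Wplus m\<^esub> (?S' \<otimes>\<^bsub>Wplus m\<^esub> ?T)) \<otimes>\<^bsub>Wplus m\<^esub> ?S'"
      using S T SS' by (simp add: W.m_assoc[symmetric])
    also have "\<dots> = \<one>\<^bsub>Wplus m\<^esub>" unfolding U TT using S SS' by simp
    finally have TS': "?T \<otimes>\<^bsub>Wplus m\<^esub> ?S' \<otimes>\<^bsub>Wplus m\<^esub> (?T \<otimes>\<^bsub>Wplus m\<^esub> ?S') = \<one>\<^bsub>Wplus m\<^esub>" .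
    have invT: "inv\<^bsub>Wplus m\<^esub> ?T = ?T" using W.inv_equality[OF TT(1) T(1) T(1)] .
    have invS: "inv\<^bsub>Wplus m\<^esub> ?S' = ?S" using W.inv_equality[OF SS'(1) S(2) S(1)] .
    have "inv\<^bsub>Wplus m\<^esub> (?T \<otimes>\<^bsub>Wplus m\<^esub> ?S' \<otimes>\<^bsub>Wplus m\<^esub> (?T \<otimes>\<^bsub>Wplus m\<^esub> ?S')) = ?S \<otimes>\<^bsub>Wplus m\<^esub> ?T \<otimes>\<^bsub>Wplus m\<^esub> (?S \<otimes>\<^bsub>Wplus m\<^esub> ?T)"
      using S T by (simp add: W.inv_mult_group invT invS del: One_nat_def)
    then have ST: "?S \<otimes>\<^bsub>Wplus m\<^esub> ?T \<otimes>\<^bsub>Wplus m\<^esub> (?S \<otimes>\<^bsub>Wplus m\<^esub> ?T) = \<one>\<^bsub>Wplus m\<^esub>" unfolding TS' by simp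
    have b: "bar_word (tau_word 2 j) = [(1, False)] @ tau_word 1 j" unfolding t using bar_word_tau[of 3 j] by simp
    have "word_class m (bar_word (tau_word 2 j @ tau_word 2 j)) = word_class m []"
      using ST tw w1 unfolding bar_word_simps b by (simp add: Wplus_mult Wplus_one)
    then show ?thesis unfolding 2
      using word_class_eq[of "bar_word (tau_word 2 j @ tau_word 2 j)" m "[]"] tw by (simp add: bar_word_words)
  next
    case 3
    then show ?thesis using bar_word_tau[of i j] word_eq.relator[OF relator] by simp
  qed
qed (auto intro: word_eq.refl word_eq.sym word_eq.trans)

lemma word_eq_bar_bar: "u \<in> words m \<Longrightarrow> word_eq m (bar_word (bar_word u)) u"
proof (induction u)
  case (Cons l u)
  obtain i b where l: "l = (i, b)" by (metis prod.exhaust)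
  have i: "1 \<le> i" "i < m" "u \<in> words m" using Cons.prems l by auto
  have c1: "word_eq m [(1, b), (1, \<not> b)] []" for b using i by (intro word_eq.cancel) auto
  have "word_eq m (bar_word (bar_letter l)) [l]"
  proof (cases "i = 2")
    case True
    have d: "word_eq m ([(1, c)] @ [(1, c), (1, \<not> c)] @ [(1, \<not> c)]) []" for c
    proof -
      have "word_eq m ([(1, c)] @ [(1, c), (1, \<not> c)] @ [(1, \<not> c)]) ([(1, c)] @ [] @ [(1, \<not> c)])"
        using c1[of c] by (intro word_eq.append word_eq.refl)
      then show ?thesis using c1[of c] word_eq.trans by simp
    qed
    have "word_eq m (([(1, True)] @ [(1, True), (1, False)] @ [(1, False)]) @ [(2, False)]) ([] @ [(2, False)])"
      using d[of True] by (intro word_eq.append word_eq.refl) simp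
    moreover have "word_eq m ([(2, True)] @ ([(1, True)] @ [(1, True), (1, False)] @ [(1, False)])) ([(2, True)] @ [])"
      using d[of True] by (intro word_eq.append word_eq.refl) simp
    ultimately show ?thesis using True l by (cases b) simp_all
  next
    case False
    then show ?thesis using l word_eq.refl by (cases "i = 1") auto
  qed
  then have "word_eq m (bar_word (bar_letter l) @ bar_word (bar_word u)) ([l] @ u)"
    using Cons.IH[OF i(3)] by (rule word_eq.append)
  then show ?case by simp
qed (simp add: word_eq.refl)

lemma bar_class: "u \<in> words m \<Longrightarrow> bar m (word_class m u) = word_class m (bar_word u)"
  unfolding bar_def using UN_word_class[of u m bar_word] word_eq_bar bar_word_words by (simp add: bar_word_def)

lemma r_coset_Wplus_subgroup_eq: "R #>\<^bsub>(Wplus m)\<lparr>carrier := S\<rparr>\<^esub> a = R #>\<^bsub>Wplus m\<^esub> a"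
  unfolding r_coset_def by simp

section \<open>Rotations\<close>

lemma (in group) eval_word_closed:
  "u \<in> words m \<Longrightarrow> (\<And>i. 1 \<le> i \<Longrightarrow> i < m \<Longrightarrow> s i \<in> carrier G) \<Longrightarrow> eval_word G s u \<in> carrier G"
  unfolding eval_word_def by (induction u) auto

lemma (in group) eval_word_append:
  assumes "\<And>i. 1 \<le> i \<Longrightarrow> i < m \<Longrightarrow> s i \<in> carrier G" "u \<in> words m" "v \<in> words m"
  shows "eval_word G s (u @ v) = eval_word G s u \<otimes> eval_word G s v"
  using assms(2)
proof (induction u)
  case Nil
  then show ?case using eval_word_closed[OF assms(3,1)] by (simp add: eval_word_def)
next
  case (Cons l u)
  obtain i b where l: "l = (i, b)" by (metis prod.exhaust)
  then have i: "s i \<in> carrier G" "u \<in> words m" using Cons.prems assms(1) by auto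
  have cons: "eval_word G s (l # w) = (if b then inv (s i) else s i) \<otimes> eval_word G s w" for w
    unfolding l eval_word_def by simp
  show ?case unfolding append_Cons cons Cons.IH[OF i(2)]
    using i eval_word_closed[OF i(2) assms(1)] eval_word_closed[OF assms(3,1)] by (simp add: m_assoc)
qed

context
  fixes n :: nat and s :: "'a rel" and c :: "'a set \<Rightarrow> bool" and \<Phi> :: "'a set"
  assumes polytope: "abstract_polytope n s"
    and rotary: "rotary_chambers n (flags s) (adj_flag s) c" and \<Phi>: "\<Phi> \<in> flags s"
begin

interpretation flags: polytope_presentation n "flags s" "adj_flag s" s "face_at s"
  using flags_presentation[OF polytope] .

interpretation A: group "aut_group s" by (rule group_aut)

private abbreviation \<sigma> where "\<sigma> \<equiv> standard_rotation s \<Phi>"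
private abbreviation G where "G \<equiv> rotation_group n s \<Phi>"

lemma colour_step: "i < n \<Longrightarrow> \<Psi> \<in> flags s \<Longrightarrow> c (adj_flag s i \<Psi>) \<longleftrightarrow> \<not> c \<Psi>"
  using rotary unfolding rotary_chambers_def bicoloured_def by blast

lemma same_colour_aut:
  assumes "\<Psi> \<in> flags s" "\<Xi> \<in> flags s" "c \<Psi> = c \<Xi>"
  obtains g where "g \<in> carrier (aut_group s)" "g ` \<Psi> = \<Xi>"
proof -
  obtain f where f: "chamber_aut n (flags s) (adj_flag s) f" "f \<Psi> = \<Xi>"
    using rotary assms unfolding rotary_chambers_def by blast
  obtain g where "g \<in> carrier (aut_group s)" "\<And>\<Phi>. \<Phi> \<in> flags s \<Longrightarrow> g ` \<Phi> = f \<Phi>"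
    using chamber_aut_imp_aut[OF polytope f(1)] by blast
  then show ?thesis using that f(2) assms(1) by blast
qed

text \<open>Two adjacencies restore the colour, so the required automorphism exists; it is unique
  because automorphisms act freely on flags.\<close>

lemma standard_rotation:
  assumes i: "1 \<le> i" "i < n"
  shows "\<sigma> i \<in> carrier (aut_group s)" "\<sigma> i ` \<Phi> = adj_flag s i (adj_flag s (i - 1) \<Phi>)"
proof -
  have i': "i - 1 < n" using i by simp
  have cl: "adj_flag s i (adj_flag s (i - 1) \<Phi>) \<in> flags s" using flags.closed i i' \<Phi> by blast
  have "c \<Phi> = c (adj_flag s i (adj_flag s (i - 1) \<Phi>))"
    using colour_step[OF i(2) flags.closed[OF i' \<Phi>]] colour_step[OF i' \<Phi>] by simp
  then obtain g where g: "g \<in> carrier (aut_group s)" "g ` \<Phi> = adj_flag s i (adj_flag s (i - 1) \<Phi>)"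
    using same_colour_aut[OF \<Phi> cl] by blast
  have "\<sigma> i \<in> carrier (aut_group s) \<and> \<sigma> i ` \<Phi> = adj_flag s i (adj_flag s (i - 1) \<Phi>)"
    unfolding standard_rotation_def
  proof (rule theI[of _ g])
    fix f assume "f \<in> carrier (aut_group s) \<and> f ` \<Phi> = adj_flag s i (adj_flag s (i - 1) \<Phi>)"
    then show "f = g" using aut_unique[OF polytope _ g(1) \<Phi>, of f] g(2) by simp
  qed (use g in blast)
  then show "\<sigma> i \<in> carrier (aut_group s)" "\<sigma> i ` \<Phi> = adj_flag s i (adj_flag s (i - 1) \<Phi>)" by auto
qed

lemma rotation_group: "group G" and rotation_carrier: "carrier G \<subseteq> carrier (aut_group s)"
  unfolding rotation_group_def using A.group_subgroup_generated A.carrier_subgroup_generated_subset by blast+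

lemma rotation_mem: "1 \<le> i \<Longrightarrow> i < n \<Longrightarrow> \<sigma> i \<in> carrier G"
  unfolding rotation_group_def carrier_subgroup_generated using standard_rotation by (intro generate.incl) auto

lemma rotation_mult: "monoid.mult G = monoid.mult (aut_group s)" and rotation_one: "\<one>\<^bsub>G\<^esub> = \<one>\<^bsub>aut_group s\<^esub>"
  unfolding rotation_group_def by simp_all

lemma rotation_inv: "g \<in> carrier G \<Longrightarrow> inv\<^bsub>G\<^esub> g = inv\<^bsub>aut_group s\<^esub> g"
  unfolding rotation_group_def using A.inv_subgroup_generated by blast

lemma rotation_inclusion: "(\<lambda>g. g) \<in> hom G (aut_group s)"
  using rotation_carrier rotation_mult by (intro homI) auto

lemma eval_rotation:
  assumes u: "u \<in> words n"
  shows "eval_word G \<sigma> u \<in> carrier G" "eval_word G \<sigma> u ` \<Phi> = fold (adj_flag s) (reflection_word u) \<Phi>"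
proof -
  interpret G: group G by (rule rotation_group)
  show mem: "eval_word G \<sigma> u \<in> carrier G" using G.eval_word_closed[OF u] rotation_mem by blast
  show "eval_word G \<sigma> u ` \<Phi> = fold (adj_flag s) (reflection_word u) \<Phi>"
    using u
  proof (induction u)
    case Nil
    then show ?case using aut_one_image[OF polytope \<Phi>] by (simp add: eval_word_def rotation_one)
  next
    case (Cons l u)
    obtain i b where l: "l = (i, b)" by (metis prod.exhaust)
    have i: "1 \<le> i" "i < n" "u \<in> words n" "i - 1 < n" using Cons.prems l by auto
    let ?g = "if b then inv\<^bsub>G\<^esub> (\<sigma> i) else \<sigma> i"
    have g: "?g \<in> carrier (aut_group s)" using rotation_mem[OF i(1,2)] rotation_carrier by auto
    have g\<Phi>: "?g ` \<Phi> = fold (adj_flag s) (if b then [i, i - 1] else [i - 1, i]) \<Phi>"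
    proof (cases b)
      case True
      let ?\<Psi> = "adj_flag s (i - 1) (adj_flag s i \<Phi>)"
      have \<Psi>: "?\<Psi> \<in> flags s" using flags.closed i \<Phi> by blast
      note \<sigma> = standard_rotation[OF i(1,2)]
      have "\<sigma> i ` ?\<Psi> = adj_flag s (i - 1) (\<sigma> i ` adj_flag s i \<Phi>)"
        by (rule aut_adj_flag[OF polytope \<sigma>(1) flags.closed[OF i(2) \<Phi>] i(4), symmetric])
      also have "\<sigma> i ` adj_flag s i \<Phi> = adj_flag s i (\<sigma> i ` \<Phi>)"
        by (rule aut_adj_flag[OF polytope \<sigma>(1) \<Phi> i(2), symmetric])
      finally have "\<sigma> i ` ?\<Psi> = \<Phi>"
        unfolding \<sigma>(2) using flags.invol[OF i(2) flags.closed[OF i(4) \<Phi>]] flags.invol[OF i(4) \<Phi>] by simp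
      then have "(inv\<^bsub>aut_group s\<^esub> (\<sigma> i)) ` \<Phi> = ?\<Psi>"
        using aut_inv_image[OF polytope standard_rotation(1)[OF i(1,2)] \<Psi>] by simp
      then show ?thesis using True rotation_inv[OF rotation_mem[OF i(1,2)]] by simp
    next
      case False
      then show ?thesis using standard_rotation(2)[OF i(1,2)] by simp
    qed
    have eu: "eval_word G \<sigma> u \<in> carrier (aut_group s)"
      using G.eval_word_closed[OF i(3)] rotation_mem rotation_carrier by blast
    have "eval_word G \<sigma> (l # u) = ?g \<otimes>\<^bsub>aut_group s\<^esub> eval_word G \<sigma> u"
      unfolding l eval_word_def by (simp add: rotation_mult)
    then have "eval_word G \<sigma> (l # u) ` \<Phi> = ?g ` fold (adj_flag s) (reflection_word u) \<Phi>"
      using aut_mult_image[OF polytope g eu \<Phi>] Cons.IH[OF i(3)] by simp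
    also have "\<dots> = fold (adj_flag s) (reflection_word u) (?g ` \<Phi>)"
      using aut_fold[OF polytope g \<Phi> reflection_word_lists[OF i(3)]] by simp
    finally show ?case unfolding g\<Phi> l by simp
  qed
qed

lemma eval_rotation_eq:
  assumes u: "u \<in> words n" and v: "v \<in> words n"
  shows "eval_word G \<sigma> u = eval_word G \<sigma> v \<longleftrightarrow>
    fold (adj_flag s) (reflection_word u) \<Phi> = fold (adj_flag s) (reflection_word v) \<Phi>"
  using eval_rotation(2)[OF u] eval_rotation(2)[OF v]
    aut_unique[OF polytope subsetD[OF rotation_carrier eval_rotation(1)[OF u]]
      subsetD[OF rotation_carrier eval_rotation(1)[OF v]] \<Phi>] by auto

lemma Wplus_hom_class:
  assumes u: "u \<in> words n"
  shows "Wplus_hom G \<sigma> (word_class n u) = eval_word G \<sigma> u"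
proof -
  have "eval_word G \<sigma> v = eval_word G \<sigma> u" if "v \<in> word_class n u" for v
    using that word_class_mem[OF u] flags.word_eq_act[OF _ order_refl u] eval_rotation_eq[OF u] \<Phi> by metis
  moreover have "u \<in> word_class n u" using word_class_mem[OF u] word_eq.refl by blast
  ultimately have "eval_word G \<sigma> ` word_class n u = {eval_word G \<sigma> u}" by blast
  then show ?thesis unfolding Wplus_hom_def by simp
qed

lemma Wplus_hom_group_hom: "group_hom (Wplus n) G (Wplus_hom G \<sigma>)"
proof -
  interpret G: group G by (rule rotation_group)
  have "Wplus_hom G \<sigma> \<in> hom (Wplus n) G"
  proof (rule homI)
    fix C assume "C \<in> carrier (Wplus n)"
    then obtain u where u: "u \<in> words n" "C = word_class n u" by (rule WplusE)
    then show "Wplus_hom G \<sigma> C \<in> carrier G" using Wplus_hom_class eval_rotation by simp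
    fix D assume "D \<in> carrier (Wplus n)"
    then obtain v where v: "v \<in> words n" "D = word_class n v" by (rule WplusE)
    show "Wplus_hom G \<sigma> (C \<otimes>\<^bsub>Wplus n\<^esub> D) = Wplus_hom G \<sigma> C \<otimes>\<^bsub>G\<^esub> Wplus_hom G \<sigma> D"
      unfolding u(2) v(2) Wplus_mult[OF u(1) v(1)]
      using Wplus_hom_class u(1) v(1) G.eval_word_append[of n \<sigma> u v] rotation_mem by simp
  qed
  then show ?thesis by (simp add: group_hom_def group_hom_axioms_def Wplus_group rotation_group)
qed

text \<open>Automorphisms act freely on flags, so a product of rotations is trivial as soon as it
  fixes the base flag. From here on \<open>M\<close> is handled as the stabiliser of a flag under
  words.\<close>

lemma relation_subgroup_class:
  assumes u: "u \<in> words n"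
  shows "word_class n u \<in> relation_subgroup n s \<Phi> \<longleftrightarrow> fold (adj_flag s) (reflection_word u) \<Phi> = \<Phi>"
proof -
  have "word_class n u \<in> relation_subgroup n s \<Phi> \<longleftrightarrow> eval_word G \<sigma> u = \<one>\<^bsub>G\<^esub>"
    unfolding relation_subgroup_def kernel_def using Wplus_hom_class[OF u] word_class_carrier[OF u] by simp
  also have "\<dots> \<longleftrightarrow> eval_word G \<sigma> u = eval_word G \<sigma> []" by (simp add: eval_word_def)
  also have "\<dots> \<longleftrightarrow> fold (adj_flag s) (reflection_word u) \<Phi> = \<Phi>" using eval_rotation_eq[OF u, of "[]"] by simp
  finally show ?thesis .
qed

lemma relation_subgroup_carrier: "relation_subgroup n s \<Phi> \<subseteq> carrier (Wplus n)"
  unfolding relation_subgroup_def kernel_def by blast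

end

text \<open>A mirror image is the same polytope with the 0-adjacent flag as base flag: by
  \<open>bar_word_act\<close>, a word fixes \<open>\<Phi>\<close> exactly if its bar fixes the
  neighbour. That \<open>bar\<close> is an involution on classes gives the second inclusion.\<close>

lemma bar_relation_subgroup:
  assumes polytope: "abstract_polytope n s"
    and rotary: "rotary_chambers n (flags s) (adj_flag s) c" and \<Phi>: "\<Phi> \<in> flags s" and n: "0 < n"
  shows "bar n ` relation_subgroup n s \<Phi> = relation_subgroup n s (adj_flag s 0 \<Phi>)"
proof -
  interpret flags: polytope_presentation n "flags s" "adj_flag s" s "face_at s"
    using flags_presentation[OF polytope] .
  let ?\<Phi>' = "adj_flag s 0 \<Phi>"
  have \<Phi>': "?\<Phi>' \<in> flags s" using flags.closed n \<Phi> by blast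
  note rel = relation_subgroup_class[OF polytope rotary \<Phi>] and rel' = relation_subgroup_class[OF polytope rotary \<Phi>']
  have act: "fold (adj_flag s) (reflection_word (bar_word u)) ?\<Phi>' = adj_flag s 0 (fold (adj_flag s) (reflection_word u) \<Phi>)"
    if "u \<in> words n" for u using flags.bar_word_act[OF order_refl that n \<Phi>] .
  show ?thesis
  proof (intro equalityI subsetI)
    fix C assume "C \<in> bar n ` relation_subgroup n s \<Phi>"
    then obtain D where D: "D \<in> relation_subgroup n s \<Phi>" "C = bar n D" by blast
    then obtain u where u: "u \<in> words n" "D = word_class n u"
      using relation_subgroup_carrier[OF polytope rotary \<Phi>] WplusE by blast
    then have "fold (adj_flag s) (reflection_word u) \<Phi> = \<Phi>" using rel D by simp
    then show "C \<in> relation_subgroup n s ?\<Phi>'"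
      using D(2) u(2) bar_class[OF u(1)] rel'[OF bar_word_words[OF u(1)]] act[OF u(1)] by simp
  next
    fix C assume C: "C \<in> relation_subgroup n s ?\<Phi>'"
    then obtain u where u: "u \<in> words n" "C = word_class n u"
      using relation_subgroup_carrier[OF polytope rotary \<Phi>'] WplusE by blast
    have bu: "bar_word u \<in> words n" using bar_word_words u by blast
    have "fold (adj_flag s) (reflection_word u) ?\<Phi>' = ?\<Phi>'" using rel'[OF u(1)] C u by simp
    moreover have "fold (adj_flag s) (reflection_word (bar_word (bar_word u))) ?\<Phi>' = fold (adj_flag s) (reflection_word u) ?\<Phi>'"
      using flags.word_eq_act[OF word_eq_bar_bar[OF u(1)] order_refl bar_word_words[OF bu]] \<Phi>' by blast
    ultimately have e: "adj_flag s 0 (fold (adj_flag s) (reflection_word (bar_word u)) \<Phi>) = adj_flag s 0 \<Phi>"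
      using act[OF bu] by simp
    have "fold (adj_flag s) (reflection_word (bar_word u)) \<Phi> \<in> flags s"
      using flags.fold_closed[OF reflection_word_lists[OF bu order_refl] \<Phi>] .
    then have "fold (adj_flag s) (reflection_word (bar_word u)) \<Phi> = \<Phi>" using e flags.invol[OF n] \<Phi> by metis
    then have "word_class n (bar_word u) \<in> relation_subgroup n s \<Phi>" using rel[OF bu] by simp
    moreover have "bar n (word_class n (bar_word u)) = C"
      using bar_class[OF bu] word_class_eq[OF bar_word_words[OF bu] u(1)] word_eq_bar_bar[OF u(1)] u(2) by simp
    ultimately show "C \<in> bar n ` relation_subgroup n s \<Phi>" by blast
  qed
qed

text \<open>Total chirality says that every coset of \<open>M\<close> meets \<open>M M'\<close>,
  that is, \<open>M M'\<close> is the whole group. The word \<open>a\<close> represents the factor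
  in \<open>M\<close> and \<open>b\<close> the factor in \<open>M'\<close>, the stabiliser of the
  0-adjacent flag.\<close>

lemma totally_chiral_decomposition:
  assumes tc: "totally_chiral n s \<Phi>" and \<Phi>: "\<Phi> \<in> flags s" and u: "u \<in> words n"
  obtains a b where "a \<in> words n" "b \<in> words n" "word_eq n u (a @ b)"
    "fold (adj_flag s) (reflection_word a) \<Phi> = \<Phi>"
    "fold (adj_flag s) (reflection_word b) (adj_flag s 0 \<Phi>) = adj_flag s 0 \<Phi>"
proof -
  have chi: "chiral_polytope n s" using tc unfolding totally_chiral_def by blast
  then have polytope: "abstract_polytope n s" unfolding chiral_polytope_def by blast
  obtain c where rotary: "rotary_chambers n (flags s) (adj_flag s) c" and n: "0 < n"
    using chi chiral_iff_flags[OF polytope] unfolding chiral_chambers_def by blast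
  interpret flags: polytope_presentation n "flags s" "adj_flag s" s "face_at s"
    using flags_presentation[OF polytope] .
  have \<Phi>': "adj_flag s 0 \<Phi> \<in> flags s" using flags.closed n \<Phi> by blast
  let ?M = "relation_subgroup n s \<Phi>" and ?M' = "relation_subgroup n s (adj_flag s 0 \<Phi>)"
  interpret h: group_hom "Wplus n" "rotation_group n s \<Phi>" "Wplus_hom (rotation_group n s \<Phi>) (standard_rotation s \<Phi>)"
    by (rule Wplus_hom_group_hom[OF polytope rotary \<Phi>])
  have M: "subgroup ?M (Wplus n)" unfolding relation_subgroup_def by (rule h.subgroup_kernel)
  let ?U = "word_class n u"
  have U: "?U \<in> carrier (Wplus n)" using word_class_carrier u by blast
  have "?M #>\<^bsub>Wplus n\<^esub> ?U \<in> carrier (Wplus n Mod ?M)" unfolding FactGroup_def RCOSETS_def using U by auto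
  also have "carrier (Wplus n Mod ?M) = carrier (chirality_group n s \<Phi>)" using tc unfolding totally_chiral_def by simp
  also have "\<dots> = (\<lambda>a. ?M #>\<^bsub>Wplus n\<^esub> a) ` (?M <#>\<^bsub>Wplus n\<^esub> ?M')"
    unfolding chirality_group_def Let_def FactGroup_def RCOSETS_def bar_relation_subgroup[OF polytope rotary \<Phi> n]
    by (auto simp: r_coset_Wplus_subgroup_eq)
  finally obtain a0 where a0: "a0 \<in> ?M <#>\<^bsub>Wplus n\<^esub> ?M'" "?M #>\<^bsub>Wplus n\<^esub> ?U = ?M #>\<^bsub>Wplus n\<^esub> a0" by blast
  then obtain y z where yz: "y \<in> ?M" "z \<in> ?M'" "a0 = y \<otimes>\<^bsub>Wplus n\<^esub> z" unfolding set_mult_def by blast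
  have "?U \<in> ?M #>\<^bsub>Wplus n\<^esub> a0" using h.G.rcos_self[OF U M] a0(2) by simp
  \<comment> \<open>Equality of cosets leaves a factor \<open>x\<close> in \<open>M\<close> open; it
    is absorbed into the part from \<open>M\<close>.\<close>
  then obtain x where x: "x \<in> ?M" "?U = x \<otimes>\<^bsub>Wplus n\<^esub> (y \<otimes>\<^bsub>Wplus n\<^esub> z)" unfolding r_coset_def yz(3) by blast
  have car: "x \<in> carrier (Wplus n)" "y \<in> carrier (Wplus n)" "z \<in> carrier (Wplus n)"
    using x yz relation_subgroup_carrier[OF polytope rotary \<Phi>] relation_subgroup_carrier[OF polytope rotary \<Phi>'] by blast+
  have xy: "x \<otimes>\<^bsub>Wplus n\<^esub> y \<in> ?M" using subgroup.m_closed[OF M x(1) yz(1)] .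
  obtain a where a: "a \<in> words n" "x \<otimes>\<^bsub>Wplus n\<^esub> y = word_class n a"
    using xy relation_subgroup_carrier[OF polytope rotary \<Phi>] WplusE by blast
  obtain b where b: "b \<in> words n" "z = word_class n b" using car(3) by (rule WplusE)
  have "?U = word_class n (a @ b)" using x(2) h.G.m_assoc[OF car] a b Wplus_mult by simp
  then have "word_eq n u (a @ b)" using word_class_eq[of u n "a @ b"] u a b by simp
  moreover have "fold (adj_flag s) (reflection_word a) \<Phi> = \<Phi>"
    using relation_subgroup_class[OF polytope rotary \<Phi> a(1)] xy a(2) by simp
  moreover have "fold (adj_flag s) (reflection_word b) (adj_flag s 0 \<Phi>) = adj_flag s 0 \<Phi>"
    using relation_subgroup_class[OF polytope rotary \<Phi>' b(1)] yz(2) b(2) by simp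
  ultimately show ?thesis using that a(1) b(1) by blast
qed

section \<open>The coset poset\<close>

text \<open>The chamber \<open>(h, False)\<close> stands for the image of the base flag \<open>\<Phi>\<close> under \<open>h\<^sup>-\<^sup>1\<close>, and \<open>(h, True)\<close>
  for that of the flag \<open>0\<close>-adjacent to \<open>\<Phi>\<close>; the inverse turns left cosets into the right cosets of
  the coset poset.  The step comes from \<open>\<sigma>\<^sub>1\<dots>\<sigma>\<^sub>i = \<rho>\<^sub>0\<rho>\<^sub>i\<close>.\<close>

definition coset_step :: "('g, 'z) monoid_scheme \<Rightarrow> (nat \<Rightarrow> 'g) \<Rightarrow> nat \<Rightarrow> 'g \<times> bool \<Rightarrow> 'g \<times> bool" where
  "coset_step G s i = (\<lambda>(h, e). (if e then inv\<^bsub>G\<^esub> (tau G s (Suc 0) i) \<otimes>\<^bsub>G\<^esub> h else tau G s (Suc 0) i \<otimes>\<^bsub>G\<^esub> h, \<not> e))"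

text \<open>The odd chambers have no coset of their own; a face of an odd chamber is the face of an
  adjacent even one.\<close>

definition coset_face :: "nat \<Rightarrow> ('g, 'z) monoid_scheme \<Rightarrow> (nat \<Rightarrow> 'g) \<Rightarrow> 'g \<times> bool \<Rightarrow> int \<Rightarrow> int \<times> 'g set" where
  "coset_face n G s c i = (i, rotation_subgroup n G s {k. k < n \<and> int k \<noteq> i} #>\<^bsub>G\<^esub>
     (if snd c then fst (coset_step G s (if i = 0 then 1 else 0) c) else fst c))"

locale rotation_data =
  fixes n :: nat and G :: "('g, 'z) monoid_scheme" (structure) and s :: "nat \<Rightarrow> 'g"
  assumes group: "group G" and n: "3 \<le> n"
    and s_mem: "1 \<le> i \<Longrightarrow> i < n \<Longrightarrow> s i \<in> carrier G"
    and generated: "carrier G = generate G (s ` {1..<n})"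
    and relator: "1 \<le> i \<Longrightarrow> i < j \<Longrightarrow> j < n \<Longrightarrow> tau G s i j \<otimes> tau G s i j = \<one>"

sublocale rotation_data \<subseteq> group G by (rule group)

context rotation_data
begin

abbreviation t :: "nat \<Rightarrow> 'g" where "t i \<equiv> tau G s (Suc 0) i"
abbreviation r :: "nat \<Rightarrow> 'g \<times> bool \<Rightarrow> 'g \<times> bool" where "r \<equiv> coset_step G s"
abbreviation X :: "('g \<times> bool) set" where "X \<equiv> carrier G \<times> UNIV"
abbreviation \<Gamma> :: "nat set \<Rightarrow> 'g set" where "\<Gamma> I \<equiv> rotation_subgroup n G s I"
abbreviation face :: "'g \<times> bool \<Rightarrow> int \<Rightarrow> int \<times> 'g set" where "face \<equiv> coset_face n G s"

lemma tau_mem: "1 \<le> i \<Longrightarrow> j < n \<Longrightarrow> tau G s i j \<in> carrier G"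
proof -
  assume ij: "1 \<le> i" "j < n"
  have "foldr (\<lambda>k x. s k \<otimes> x) ks \<one> \<in> carrier G" if "\<forall>k \<in> set ks. 1 \<le> k \<and> k < n" for ks
    using that by (induction ks) (auto simp: s_mem)
  then show "tau G s i j \<in> carrier G" unfolding tau_def using ij by (simp del: upt_Suc)
qed

lemma tau_split:
  assumes "i \<le> j" "j < n"
  shows "t j = t i \<otimes> tau G s (Suc i) j"
proof -
  have fold: "foldr (\<lambda>k x. s k \<otimes> x) ks a = foldr (\<lambda>k x. s k \<otimes> x) ks \<one> \<otimes> a"
    if "\<forall>k \<in> set ks. 1 \<le> k \<and> k < n" "a \<in> carrier G" for ks a
    using that
  proof (induction ks)
    case (Cons k ks)
    have "foldr (\<lambda>k x. s k \<otimes> x) ks \<one> \<in> carrier G" if "\<forall>k \<in> set ks. 1 \<le> k \<and> k < n"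
      using that by (induction ks) (auto simp: s_mem)
    then show ?case using Cons s_mem by (simp add: m_assoc)
  qed simp
  have e: "[Suc 0..<Suc j] = [Suc 0..<Suc i] @ [Suc i..<Suc j]"
    using upt_add_eq_append[of "Suc 0" "Suc i" "j - i"] assms by simp
  show ?thesis unfolding tau_def e foldr_append
    by (rule fold) (use tau_mem[of "Suc i" j] assms in \<open>auto simp: tau_def\<close>)
qed

lemma t_mem: "i < n \<Longrightarrow> t i \<in> carrier G"
  using tau_mem by simp

lemma t_zero [simp]: "t 0 = \<one>"
  unfolding tau_def by simp

text \<open>With \<open>t i\<close> in the role of \<open>\<rho>\<^sub>0\<rho>\<^sub>i\<close>, the
  right side is
  \<open>\<rho>\<^sub>i\<^sub>-\<^sub>1\<rho>\<^sub>0\<rho>\<^sub>0\<rho>\<^sub>j\<close>.\<close>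

lemma tau_eq: "1 \<le> i \<Longrightarrow> i \<le> j \<Longrightarrow> j < n \<Longrightarrow> tau G s i j = inv (t (i - 1)) \<otimes> t j"
  using tau_split[of "i - 1" j] t_mem[of "i - 1"] t_mem[of j] tau_mem[of i j] by (simp add: m_assoc[symmetric])

text \<open>These are the commutations of the letters \<open>i\<close> and \<open>j\<close>, at even
  chambers and at odd ones. Both say that \<open>tau G s (Suc i) j\<close> is its own inverse, the
  second after conjugation by \<open>t i\<close>.\<close>

lemma t_commute:
  assumes ij: "i < n" "j < n" "i + 2 \<le> j"
  shows "inv (t i) \<otimes> t j = inv (t j) \<otimes> t i" "t i \<otimes> inv (t j) = t j \<otimes> inv (t i)"
proof -
  note c = t_mem[OF ij(1)] t_mem[OF ij(2)]
  let ?D = "inv (t i) \<otimes> t j"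
  have "tau G s (Suc i) j = ?D" using tau_eq[of "Suc i" j] ij by simp
  then have "?D \<otimes> ?D = \<one>" using relator[of "Suc i" j] ij by simp
  then have "inv ?D = ?D" using c by (intro inv_equality) auto
  then show 1: "inv (t i) \<otimes> t j = inv (t j) \<otimes> t i" using c by (simp add: inv_mult_group)
  have "t i \<otimes> inv (t j) = t i \<otimes> (inv (t j) \<otimes> t i) \<otimes> inv (t i)" using c by (simp add: m_assoc)
  also have "\<dots> = t j \<otimes> inv (t i)" unfolding 1[symmetric] using c by (simp add: m_assoc[symmetric])
  finally show "t i \<otimes> inv (t j) = t j \<otimes> inv (t i)" .
qed

lemma \<Gamma>_subgroup: "subgroup (\<Gamma> I) G"
  unfolding rotation_subgroup_def by (rule generate_is_subgroup) (auto intro: tau_mem)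

lemma \<Gamma>_carrier: "g \<in> \<Gamma> I \<Longrightarrow> g \<in> carrier G"
  using subgroup.mem_carrier[OF \<Gamma>_subgroup] .

lemma \<Gamma>_mem:
  assumes "i \<in> I" "j \<in> I" "i < n" "j < n"
  shows "inv (t i) \<otimes> t j \<in> \<Gamma> I"
proof -
  have *: "inv (t i) \<otimes> t j \<in> \<Gamma> I" if "i < j" "i \<in> I" "j \<in> I" "j < n" for i j
  proof -
    have "inv (t i) \<otimes> t j = tau G s (Suc i) j" using tau_eq[of "Suc i" j] that by simp
    then have "\<exists>i' j'. inv (t i) \<otimes> t j = tau G s i' j' \<and> 1 \<le> i' \<and> i' \<le> j' \<and> j' < n \<and> i' - 1 \<in> I \<and> j' \<in> I"
      using that by (intro exI[of _ "Suc i"] exI[of _ j]) auto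
    then show ?thesis unfolding rotation_subgroup_def by (intro generate.incl) blast
  qed
  consider "i < j" | "i = j" | "j < i" by linarith
  then show ?thesis
  proof cases
    case 2
    then show ?thesis using t_mem assms subgroup.one_closed[OF \<Gamma>_subgroup] by simp
  next
    case 3
    have "inv (inv (t j) \<otimes> t i) \<in> \<Gamma> I" using subgroup.m_inv_closed[OF \<Gamma>_subgroup *[OF 3]] assms by blast
    then show ?thesis using t_mem assms by (simp add: inv_mult_group)
  qed (use * assms in blast)
qed

lemma r_even [simp]: "r i (h, False) = (t i \<otimes> h, True)" and r_odd [simp]: "r i (h, True) = (inv (t i) \<otimes> h, False)"
  unfolding coset_step_def by simp_all

lemma \<Gamma>_imp_conn:
  assumes "g \<in> \<Gamma> I" "h \<in> carrier G" "I \<subseteq> {..<n}"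
  shows "conn r I (h, False) (g \<otimes> h, False)"
proof -
  have step2: "conn r I (h, False) (inv (t i) \<otimes> t j \<otimes> h, False)"
    if "i \<in> I" "j \<in> I" "h \<in> carrier G" for i j h
  proof -
    have "i < n" "j < n" using that assms by auto
    then have "r i (r j (h, False)) = (inv (t i) \<otimes> t j \<otimes> h, False)" using t_mem that by (simp add: m_assoc)
    then show ?thesis using conn_trans[OF conn_step[OF that(2)] conn_step[OF that(1)]] by metis
  qed
  show ?thesis using assms(1,2) unfolding rotation_subgroup_def
  proof (induction arbitrary: h rule: generate.induct)
    case one
    then show ?case by simp
  next
    case (incl g)
    then obtain i j where ij: "g = tau G s i j" "1 \<le> i" "i \<le> j" "j < n" "i - 1 \<in> I" "j \<in> I" by blast
    then show ?case using step2[OF ij(5,6) incl.prems] tau_eq[OF ij(2-4)] by simp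
  next
    case (inv g)
    then obtain i j where ij: "g = tau G s i j" "1 \<le> i" "i \<le> j" "j < n" "i - 1 \<in> I" "j \<in> I" by blast
    have "inv g = inv (t j) \<otimes> t (i - 1)"
      unfolding ij(1) tau_eq[OF ij(2-4)] using t_mem ij by (simp add: inv_mult_group)
    then show ?case using step2[OF ij(6,5) inv.prems] by simp
  next
    case (eng g1 g2)
    have g: "g1 \<in> carrier G" "g2 \<in> carrier G" using eng \<Gamma>_carrier[of _ I] unfolding rotation_subgroup_def by auto
    have "conn r I (g2 \<otimes> h, False) (g1 \<otimes> (g2 \<otimes> h), False)" using eng g by simp
    then show ?case using eng.IH(2)[OF eng.prems] conn_trans g eng.prems by (metis m_assoc)
  qed
qed

text \<open>Two consecutive steps from an even chamber multiply by some
  \<open>inv (t i) \<otimes> t j\<close> with both indices in \<open>I\<close>, an element of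
  \<open>\<Gamma> I\<close>. After an odd number of steps one factor \<open>t a\<close> is still
  pending.\<close>

lemma conn_imp_\<Gamma>:
  assumes "conn r I (h, False) y" "h \<in> carrier G" "I \<subseteq> {..<n}"
  shows "if snd y then \<exists>a \<in> I. \<exists>g \<in> \<Gamma> I. fst y = t a \<otimes> (g \<otimes> h) else \<exists>g \<in> \<Gamma> I. fst y = g \<otimes> h"
  using assms(1)
proof (induction rule: conn_induct)
  case base
  then show ?case using subgroup.one_closed[OF \<Gamma>_subgroup] assms(2) by (auto intro!: bexI[of _ \<one>])
next
  case (step y i)
  have i: "i < n" "t i \<in> carrier G" using step assms t_mem by auto
  obtain h' e where y: "y = (h', e)" by (metis prod.exhaust)
  show ?case
  proof (cases e)
    case True
    then obtain a g where a: "a \<in> I" "g \<in> \<Gamma> I" "h' = t a \<otimes> (g \<otimes> h)" using step.IH y by auto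
    have an: "a < n" using a assms by auto
    have "inv (t i) \<otimes> t a \<otimes> g \<in> \<Gamma> I"
      using \<Gamma>_mem[OF step.hyps(2) a(1) i(1) an] a(2) subgroup.m_closed[OF \<Gamma>_subgroup] by blast
    moreover have "inv (t i) \<otimes> h' = inv (t i) \<otimes> t a \<otimes> g \<otimes> h"
      unfolding a(3) using i t_mem[OF an] \<Gamma>_carrier[OF a(2)] assms(2) by (simp add: m_assoc)
    ultimately show ?thesis unfolding y using True by auto
  next
    case False
    then show ?thesis using step y by auto
  qed
qed

lemma conn_even_iff:
  assumes "h \<in> carrier G" "h' \<in> carrier G" "I \<subseteq> {..<n}"
  shows "conn r I (h, False) (h', False) \<longleftrightarrow> \<Gamma> I #> h = \<Gamma> I #> h'"
proof
  assume "conn r I (h, False) (h', False)"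
  then obtain g where g: "g \<in> \<Gamma> I" "h' = g \<otimes> h" using conn_imp_\<Gamma>[of I h "(h', False)"] assms by auto
  then have "h' \<in> \<Gamma> I #> h" unfolding r_coset_def by blast
  then show "\<Gamma> I #> h = \<Gamma> I #> h'" using repr_independence[OF _ assms(1) \<Gamma>_subgroup] by blast
next
  assume "\<Gamma> I #> h = \<Gamma> I #> h'"
  then have "h' \<in> \<Gamma> I #> h" using rcos_self[OF assms(2) \<Gamma>_subgroup] by blast
  then obtain g where "g \<in> \<Gamma> I" "h' = g \<otimes> h" unfolding r_coset_def by blast
  then show "conn r I (h, False) (h', False)" using \<Gamma>_imp_conn assms by blast
qed

lemma coset_chamber_system: "chamber_system n X r"
proof -
  have 1: "r i c \<in> X" if "i < n" "c \<in> X" for i c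
    using that t_mem unfolding coset_step_def by (auto split: prod.splits)
  have 2: "r i (r i c) = c" if "i < n" "c \<in> X" for i c
    using that t_mem unfolding coset_step_def by (auto split: prod.splits simp: m_assoc[symmetric])
  have 3: "r i (r j c) = r j (r i c)" if ij: "i < n" "j < n" "i + 2 \<le> j" "c \<in> X" for i j c
  proof -
    obtain h e where c: "c = (h, e)" "h \<in> carrier G" using ij(4) by auto
    show ?thesis using t_commute[OF ij(1-3)] t_mem[OF ij(1)] t_mem[OF ij(2)] c
      by (cases e) (simp_all add: m_assoc[symmetric])
  qed
  have 4: "(\<one>, False) \<in> X" by simp
  note orbit = orbit_chamber_system[of n X r "(\<one>, False)", OF 1 2 3 4]
  have even: "conn r {..<n} (\<one>, False) (h, False)" if h: "h \<in> carrier G" for h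
  proof -
    have "s i = tau G s i i" if "1 \<le> i" "i < n" for i unfolding tau_def using s_mem that by simp
    then have "s ` {1..<n} \<subseteq> {tau G s i j | i j. 1 \<le> i \<and> i \<le> j \<and> j < n \<and> i - 1 \<in> {..<n} \<and> j \<in> {..<n}}" by force
    then have "h \<in> \<Gamma> {..<n}" using h generated mono_generate unfolding rotation_subgroup_def by blast
    then show ?thesis using \<Gamma>_imp_conn[of h "{..<n}" \<one>] h by simp
  qed
  have "X \<subseteq> residue r n (\<one>, False)"
  proof
    fix c assume c: "c \<in> X"
    obtain h e where c': "c = (h, e)" "h \<in> carrier G" using c by auto
    have "conn r {..<n} (\<one>, False) (h, e)"
    proof (cases e)
      case True
      have "conn r {..<n} (h, False) (r 0 (h, False))" using n by (intro conn_step) simp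
      from conn_trans[OF even[OF c'(2)] this] show ?thesis using True c'(2) by simp
    qed (use even c' in simp)
    then show "c \<in> residue r n (\<one>, False)" unfolding residue_def c' by simp
  qed
  moreover have "residue r n (\<one>, False) \<subseteq> X" by (rule orbit(2)) simp_all
  ultimately have "residue r n (\<one>, False) = X" by blast
  moreover have "chamber_system n (residue r n (\<one>, False)) r" by (rule orbit(1)) simp_all
  ultimately show ?thesis by simp
qed

sublocale X: chamber_system n X r by (rule coset_chamber_system)

lemma face_even: "face (h, False) i = (i, \<Gamma> (cot n i) #> h)"
  unfolding coset_face_def by simp

lemma even_representative:
  assumes c: "c \<in> X"
  obtains h where "h \<in> carrier G" "conn r (cot n i) c (h, False)" "face c i = face (h, False) i"
proof (cases "snd c")
  case False
  then show ?thesis using that[of "fst c"] c by (cases c) auto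
next
  case True
  \<comment> \<open>The letter has to differ from \<open>i\<close> in order to keep the face of rank
    \<open>i\<close>; the choice is the one made in \<open>coset_face\<close>.\<close>
  let ?b = "if i = 0 then 1 else 0 :: nat"
  have b: "?b < n" "?b \<in> cot n i" using n by auto
  obtain h where h: "c = (h, True)" "h \<in> carrier G" using c True by (cases c) auto
  then have rc: "r ?b c = (inv (t ?b) \<otimes> h, False)" by simp
  show ?thesis
  proof
    show "inv (t ?b) \<otimes> h \<in> carrier G" using t_mem[OF b(1)] h by simp
    show "conn r (cot n i) c (inv (t ?b) \<otimes> h, False)" using conn_step[OF b(2), of r c] rc by simp
    show "face c i = face (inv (t ?b) \<otimes> h, False) i" unfolding coset_face_def using rc True by simp
  qed
qed

lemma coset_face_eq:
  assumes c: "c \<in> X" and d: "d \<in> X"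
  shows "face c i = face d j \<longleftrightarrow> i = j \<and> conn r (cot n i) c d"
proof -
  have sub: "cot n i \<subseteq> {..<n}" by auto
  obtain h where h: "h \<in> carrier G" "conn r (cot n i) c (h, False)" "face c i = face (h, False) i"
    using even_representative[OF c] .
  obtain k where k: "k \<in> carrier G" "conn r (cot n j) d (k, False)" "face d j = face (k, False) j"
    using even_representative[OF d] .
  have "face c i = face d j \<longleftrightarrow> i = j \<and> conn r (cot n i) (h, False) (k, False)"
    unfolding h(3) k(3) face_even using conn_even_iff[OF h(1) k(1) sub] by auto
  also have "\<dots> \<longleftrightarrow> i = j \<and> conn r (cot n i) c d"
  proof (cases "i = j")
    case True
    have hc: "conn r (cot n i) (h, False) c" using X.conn_sym[OF h(2) sub c] .
    have kd: "conn r (cot n i) (k, False) d" using X.conn_sym[OF k(2) _ d] True sub by simp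
    have k': "conn r (cot n i) d (k, False)" using k(2) True by simp
    have "conn r (cot n i) (h, False) (k, False) \<longleftrightarrow> conn r (cot n i) c d"
      using conn_trans[OF conn_trans[OF h(2)] kd] conn_trans[OF conn_trans[OF hc] k'] by blast
    then show ?thesis using True by simp
  qed simp
  finally show ?thesis .
qed

lemma coset_faces_eq: "coset_faces n G s = {face c i | c i. c \<in> X \<and> -1 \<le> i \<and> i \<le> int n}"
proof (intro equalityI subsetI)
  fix F assume "F \<in> coset_faces n G s"
  then obtain i h where "F = (i, \<Gamma> (cot n i) #> h)" "-1 \<le> i" "i \<le> int n" "h \<in> carrier G"
    unfolding coset_faces_def RCOSETS_def by auto
  then have "F = face (h, False) i" "(h, False) \<in> X" "-1 \<le> i" "i \<le> int n" using face_even by auto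
  then show "F \<in> {face c i | c i. c \<in> X \<and> -1 \<le> i \<and> i \<le> int n}" by blast
next
  fix F assume "F \<in> {face c i | c i. c \<in> X \<and> -1 \<le> i \<and> i \<le> int n}"
  then obtain c i where c: "F = face c i" "c \<in> X" "-1 \<le> i" "i \<le> int n" by blast
  then obtain h where "h \<in> carrier G" "face c i = face (h, False) i" using even_representative by metis
  then show "F \<in> coset_faces n G s" unfolding c(1) coset_faces_def RCOSETS_def face_even using c by auto
qed

text \<open>Incidence by intersecting cosets and incidence by a common chamber agree: an element in
  both cosets is an even chamber with both faces. Only incidence is treated here; a polytope results
  once the intersection property is added.\<close>

theorem coset_presentation: "incidence_presentation n X r (coset_poset n G s) face"
proof (intro incidence_presentation.intro incidence_presentation_axioms.intro coset_chamber_system)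
  have inc: "(face c i, face d j) \<in> coset_poset n G s \<longleftrightarrow> i \<le> j \<and> snd (face c i) \<inter> snd (face d j) \<noteq> {}"
    if "c \<in> X" "d \<in> X" "-1 \<le> i" "i \<le> int n" "-1 \<le> j" "j \<le> int n" for c d i j
  proof -
    have "face c i \<in> coset_faces n G s" "face d j \<in> coset_faces n G s" unfolding coset_faces_eq using that by blast+
    then show ?thesis unfolding coset_poset_def coset_face_def by auto
  qed
  show "Field (coset_poset n G s) = {face c i |c i. c \<in> X \<and> - 1 \<le> i \<and> i \<le> int n}"
  proof (intro equalityI subsetI)
    fix F assume "F \<in> Field (coset_poset n G s)"
    then show "F \<in> {face c i |c i. c \<in> X \<and> - 1 \<le> i \<and> i \<le> int n}"
      unfolding coset_faces_eq[symmetric] Field_def coset_poset_def by auto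
  next
    fix F assume "F \<in> {face c i |c i. c \<in> X \<and> - 1 \<le> i \<and> i \<le> int n}"
    then obtain c i where c: "c \<in> X" "-1 \<le> i" "i \<le> int n" "F = face c i" by blast
    obtain h where h: "h \<in> carrier G" "face c i = face (h, False) i" using even_representative[OF c(1)] by metis
    have "h \<in> snd (face c i)" unfolding h(2) face_even using rcos_self[OF h(1) \<Gamma>_subgroup] by simp
    then have "(F, F) \<in> coset_poset n G s" using inc[of c c i i] c by auto
    then show "F \<in> Field (coset_poset n G s)" unfolding Field_def by blast
  qed
  fix c d :: "'g \<times> bool" and i j :: int assume cd: "c \<in> X" "d \<in> X" "-1 \<le> i" "i \<le> int n" "-1 \<le> j" "j \<le> int n"
  show "(face c i = face d j) = (i = j \<and> conn r (cot n i) c d)" using coset_face_eq cd by blast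
  show "((face c i, face d j) \<in> coset_poset n G s) = (i \<le> j \<and> (\<exists>z\<in>X. face z i = face c i \<and> face z j = face d j))"
    unfolding inc[OF cd]
  proof (intro conj_cong refl iffI)
    assume "snd (face c i) \<inter> snd (face d j) \<noteq> {}"
    then obtain x where x: "x \<in> snd (face c i)" "x \<in> snd (face d j)" by blast
    have "x \<in> carrier G \<and> face (x, False) i = face c i" if "c \<in> X" "x \<in> snd (face c i)" for c i
    proof -
      obtain h where h: "h \<in> carrier G" "face c i = face (h, False) i" using even_representative[OF \<open>c \<in> X\<close>] by metis
      have "x \<in> \<Gamma> (cot n i) #> h" using that(2) unfolding h(2) face_even by simp
      then have "\<Gamma> (cot n i) #> h = \<Gamma> (cot n i) #> x" "x \<in> carrier G"
        using repr_independence[OF _ h(1) \<Gamma>_subgroup] r_coset_subset_G[OF subgroup.subset[OF \<Gamma>_subgroup] h(1)] by blast+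
      then show ?thesis unfolding h(2) face_even by simp
    qed
    then show "\<exists>z\<in>X. face z i = face c i \<and> face z j = face d j" using x cd by blast
  next
    assume "\<exists>z\<in>X. face z i = face c i \<and> face z j = face d j"
    then obtain z where z: "z \<in> X" "face z i = face c i" "face z j = face d j" by blast
    obtain x where x: "x \<in> carrier G" "face (x, False) i = face c i" "face (x, False) j = face d j"
    proof (cases "snd z")
      case False
      then show ?thesis using that[of "fst z"] z by (cases z) auto
    next
      case True
      \<comment> \<open>This is where the rank has to be at least 3: two proper faces leave a third type free.\<close>
      have "\<exists>b < 3. int b \<noteq> i \<and> int b \<noteq> j"
      proof (rule ccontr)
        assume "\<not> ?thesis"
        then have "\<And>b. b < 3 \<Longrightarrow> int b = i \<or> int b = j" by blast
        from this[of 0] this[of 1] this[of 2] show False by simp linarith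
      qed
      then obtain b where b: "b < n" "int b \<noteq> i" "int b \<noteq> j" using n by (meson less_le_trans)
      have rz: "r b z \<in> X" using X.closed b z by blast
      have "conn r (cot n i) z (r b z)" "conn r (cot n j) z (r b z)" using b by (intro conn_step; simp)+
      then have "face (r b z) i = face c i" "face (r b z) j = face d j"
        using coset_face_eq[OF z(1) rz, of i i] coset_face_eq[OF z(1) rz, of j j] z(2,3) by simp_all
      moreover obtain h where "z = (h, True)" "h \<in> carrier G" using z(1) True by (cases z) auto
      ultimately show ?thesis using that[of "inv (t b) \<otimes> h"] t_mem[OF b(1)] by simp
    qed
    have "x \<in> snd (face (x, False) i)" "x \<in> snd (face (x, False) j)"
      unfolding face_even using rcos_self[OF x(1) \<Gamma>_subgroup] by simp_all
    then show "snd (face c i) \<inter> snd (face d j) \<noteq> {}" unfolding x(2,3) by blast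
  qed
qed

text \<open>Steps multiply on the left, so right multiplications commute with them; together they
  are transitive on the chambers of each parity.\<close>

lemma right_mult_aut:
  assumes k: "k \<in> carrier G"
  shows "chamber_aut n X r (\<lambda>(h, e). (h \<otimes> k, e))"
  unfolding chamber_iso_def
proof (intro conjI allI impI ballI)
  show "bij_betw (\<lambda>(h, e). (h \<otimes> k, e)) X X"
    by (rule bij_betw_byWitness[where f' = "\<lambda>(h, e). (h \<otimes> inv k, e)"]) (use k in \<open>auto simp: m_assoc\<close>)
  fix i c assume i: "i < n" and "c \<in> X"
  then obtain h e where "c = (h, e)" "h \<in> carrier G" by auto
  then show "(case r i c of (h, e) \<Rightarrow> (h \<otimes> k, e)) = r i (case c of (h, e) \<Rightarrow> (h \<otimes> k, e))"
    using t_mem[OF i] k by (cases e) (simp_all add: m_assoc)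
qed

lemma rotary: "rotary_chambers n X r snd"
  unfolding rotary_chambers_def bicoloured_def
proof (intro conjI allI impI ballI)
  fix i c show "snd (r i c) \<longleftrightarrow> \<not> snd c" unfolding coset_step_def by (simp add: case_prod_unfold)
next
  fix c d assume cd: "c \<in> X" "d \<in> X" "snd c = snd d"
  then obtain h h' e where e: "c = (h, e)" "d = (h', e)" "h \<in> carrier G" "h' \<in> carrier G" by (cases c; cases d) auto
  have "h \<otimes> (inv h \<otimes> h') = h'" using e by (simp add: m_assoc[symmetric])
  then show "\<exists>f. chamber_aut n X r f \<and> f c = d"
    using right_mult_aut[of "inv h \<otimes> h'"] e by (intro exI[of _ "\<lambda>(x, e). (x \<otimes> (inv h \<otimes> h'), e)"]) auto
qed

end

section \<open>Projections onto polytopes\<close>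

definition flag_projection :: "('g, 'z) monoid_scheme \<Rightarrow> 'a rel \<Rightarrow> 'a set \<Rightarrow> ('g \<Rightarrow> 'a \<Rightarrow> 'a) \<Rightarrow> 'g \<times> bool \<Rightarrow> 'a set" where
  "flag_projection G s \<Phi> p = (\<lambda>(h, e). p (inv\<^bsub>G\<^esub> h) ` (if e then adj_flag s 0 \<Phi> else \<Phi>))"

text \<open>Used for the two factors of the mix of P and Q, and also for K with two adjacent base
  flags, where the mix of K with its mirror image is projected in two ways onto the same
  polytope.\<close>

locale rotation_projection = rotation_data n G s
  for n and G :: "('g, 'z) monoid_scheme" (structure) and s +
  fixes Q :: "'a rel" and \<Omega> :: "'a set" and p :: "'g \<Rightarrow> 'a \<Rightarrow> 'a" and c :: "'a set \<Rightarrow> bool"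
  assumes polytope: "abstract_polytope n Q"
    and rotary_Q: "rotary_chambers n (flags Q) (adj_flag Q) c" and \<Omega>: "\<Omega> \<in> flags Q"
    and p_hom: "p \<in> hom G (aut_group Q)"
    and p_gen: "1 \<le> i \<Longrightarrow> i < n \<Longrightarrow> p (s i) = standard_rotation Q \<Omega> i"
begin

sublocale Q: polytope_presentation n "flags Q" "adj_flag Q" Q "face_at Q"
  using flags_presentation[OF polytope] .

sublocale p: group_hom G "aut_group Q" p
  using p_hom group group_aut by (simp add: group_hom_def group_hom_axioms_def)

abbreviation \<pi> :: "'g \<times> bool \<Rightarrow> 'a set" where "\<pi> \<equiv> flag_projection G Q \<Omega> p"

lemma n_pos: "0 < n"
  using n by simp

lemma \<Omega>0: "adj_flag Q 0 \<Omega> \<in> flags Q"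
  using Q.closed n_pos \<Omega> by blast

lemma p_mem: "h \<in> carrier G \<Longrightarrow> p h \<in> carrier (aut_group Q)"
  by simp

lemma \<pi>_mem: "x \<in> X \<Longrightarrow> \<pi> x \<in> flags Q"
  unfolding flag_projection_def using aut_flag_mem[OF polytope] p_mem \<Omega> \<Omega>0 by auto

text \<open>Confirms on flags that \<open>t i\<close> acts as
  \<open>\<rho>\<^sub>0\<rho>\<^sub>i\<close>; with it the projection turns steps into
  adjacencies.\<close>

lemma p_t: "i < n \<Longrightarrow> p (t i) ` \<Omega> = adj_flag Q i (adj_flag Q 0 \<Omega>)"
proof (induction i)
  case 0
  then show ?case using aut_one_image[OF polytope \<Omega>] Q.invol \<Omega> by simp
next
  case (Suc i)
  then have i: "i < n" by simp
  have si: "s (Suc i) \<in> carrier G" using s_mem Suc by simp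
  have "tau G s (Suc i) (Suc i) = s (Suc i)" unfolding tau_def using si by simp
  then have "t (Suc i) = t i \<otimes> s (Suc i)" using tau_split[of i "Suc i"] Suc by simp
  then have "p (t (Suc i)) ` \<Omega> = p (t i) ` p (s (Suc i)) ` \<Omega>"
    using aut_mult_image[OF polytope p_mem[OF t_mem[OF i]] p_mem[OF si] \<Omega>] p.hom_mult[OF t_mem[OF i] si] by simp
  also have "p (s (Suc i)) ` \<Omega> = adj_flag Q (Suc i) (adj_flag Q i \<Omega>)"
    using standard_rotation(2)[OF polytope rotary_Q \<Omega>, of "Suc i"] p_gen[of "Suc i"] Suc by simp
  also have "p (t i) ` \<dots> = adj_flag Q (Suc i) (adj_flag Q i (p (t i) ` \<Omega>))"
    using aut_adj_flag[OF polytope p_mem[OF t_mem[OF i]]] Q.closed i Suc.prems \<Omega> by metis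
  also have "\<dots> = adj_flag Q (Suc i) (adj_flag Q 0 \<Omega>)" unfolding Suc.IH[OF i] using Q.invol[OF i \<Omega>0] by simp
  finally show ?case .
qed

lemma \<pi>_step:
  assumes i: "i < n" and x: "x \<in> X"
  shows "\<pi> (r i x) = adj_flag Q i (\<pi> x)"
proof -
  obtain h e where x': "x = (h, e)" "h \<in> carrier G" using x by auto
  note ti = t_mem[OF i]
  have ih: "p (inv h) \<in> carrier (aut_group Q)" using x' by simp
  show ?thesis
  proof (cases e)
    case True
    have "\<pi> (r i x) = p (inv h \<otimes> t i) ` \<Omega>"
      unfolding x'(1) flag_projection_def using True x' ti by (simp add: inv_mult_group)
    also have "\<dots> = p (inv h) ` p (t i) ` \<Omega>"
      using aut_mult_image[OF polytope ih p_mem[OF ti] \<Omega>] p.hom_mult[of "inv h" "t i"] x' ti by simp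
    also have "\<dots> = adj_flag Q i (p (inv h) ` adj_flag Q 0 \<Omega>)"
      unfolding p_t[OF i] using aut_adj_flag[OF polytope ih \<Omega>0 i] by simp
    finally show ?thesis unfolding x'(1) flag_projection_def using True by simp
  next
    case False
    have \<Omega>i: "adj_flag Q i \<Omega> \<in> flags Q" using Q.closed i \<Omega> by blast
    have "p (t i) ` adj_flag Q i \<Omega> = adj_flag Q 0 \<Omega>"
      using aut_adj_flag[OF polytope p_mem[OF ti] \<Omega> i] p_t[OF i] Q.invol[OF i \<Omega>0] by simp
    then have inv: "p (inv (t i)) ` adj_flag Q 0 \<Omega> = adj_flag Q i \<Omega>"
      using aut_inv_image[OF polytope p_mem[OF ti] \<Omega>i] p.hom_inv[OF ti] by simp
    have "\<pi> (r i x) = p (inv h \<otimes> inv (t i)) ` adj_flag Q 0 \<Omega>"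
      unfolding x'(1) flag_projection_def using False x' ti by (simp add: inv_mult_group)
    also have "\<dots> = p (inv h) ` p (inv (t i)) ` adj_flag Q 0 \<Omega>"
      using aut_mult_image[OF polytope ih p_mem[OF inv_closed[OF ti]] \<Omega>0] p.hom_mult[of "inv h" "inv (t i)"] x' ti by simp
    also have "\<dots> = adj_flag Q i (p (inv h) ` \<Omega>)" unfolding inv using aut_adj_flag[OF polytope ih \<Omega> i] by simp
    finally show ?thesis unfolding x'(1) flag_projection_def using False by simp
  qed
qed

lemma \<pi>_fold: "w \<in> lists {..<n} \<Longrightarrow> x \<in> X \<Longrightarrow> \<pi> (fold r w x) = fold (adj_flag Q) w (\<pi> x)"
  using X.map_fold[of \<pi> "adj_flag Q" w x] \<pi>_step by blast

lemma \<pi>_eq: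
  assumes h: "h \<in> carrier G" "h' \<in> carrier G" and eq: "\<pi> (h, e) = \<pi> (h', e)"
  shows "p h = p h'"
proof -
  have "p (inv h) = p (inv h')"
    using aut_unique[OF polytope, of "p (inv h)" "p (inv h')" "if e then adj_flag Q 0 \<Omega> else \<Omega>"] eq h \<Omega> \<Omega>0
    unfolding flag_projection_def by (simp split: if_splits)
  then show ?thesis using h p.hom_inv by (metis inv_inv inv_closed)
qed

lemma \<pi>_colour: "x \<in> X \<Longrightarrow> c (\<pi> x) \<longleftrightarrow> (c \<Omega> \<longleftrightarrow> \<not> snd x)"
proof -
  have "\<pi> (\<one>, False) = \<Omega>" unfolding flag_projection_def using aut_one_image[OF polytope \<Omega>] by simp
  moreover assume x: "x \<in> X"
  have one: "(\<one>, False) \<in> X" by simp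
  have "(c (\<pi> x) \<longleftrightarrow> (c (\<pi> (\<one>, False)) \<longleftrightarrow> \<not> snd x)) \<and> x \<in> X"
    using X.connected[OF one x]
  proof (induction rule: conn_induct)
    case (step y i)
    then have i: "i < n" and y: "y \<in> X" by auto
    have "c (\<pi> (r i y)) \<longleftrightarrow> \<not> c (\<pi> y)"
      using \<pi>_step[OF i y] rotary_Q i \<pi>_mem[OF y] unfolding rotary_chambers_def bicoloured_def by simp
    moreover have "snd (r i y) \<longleftrightarrow> \<not> snd y" unfolding coset_step_def by (simp add: case_prod_unfold)
    ultimately show ?case using step X.closed[OF i y] by blast
  qed simp
  ultimately show "c (\<pi> x) \<longleftrightarrow> (c \<Omega> \<longleftrightarrow> \<not> snd x)" by simp
qed

end

section \<open>Mixes\<close>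

lemma tau_DirProd: "tau (G \<times>\<times> H) (\<lambda>i. (s i, t i)) i j = (tau G s i j, tau H t i j)"
proof -
  have "foldr (\<lambda>k x. (s k, t k) \<otimes>\<^bsub>G \<times>\<times> H\<^esub> x) ks \<one>\<^bsub>G \<times>\<times> H\<^esub> =
    (foldr (\<lambda>k x. s k \<otimes>\<^bsub>G\<^esub> x) ks \<one>\<^bsub>G\<^esub>, foldr (\<lambda>k x. t k \<otimes>\<^bsub>H\<^esub> x) ks \<one>\<^bsub>H\<^esub>)" for ks
    by (induction ks) simp_all
  then show ?thesis unfolding tau_def .
qed

abbreviation mix_group :: "nat \<Rightarrow> 'g rotation_system \<Rightarrow> 'h rotation_system \<Rightarrow> ('g \<times> 'h) monoid" where
  "mix_group n A B \<equiv> subgroup_generated (fst A \<times>\<times> fst B) ((\<lambda>i. (snd A i, snd B i)) ` {1..<n})"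

lemma mix_eq: "mix n A B = coset_poset n (mix_group n A B) (\<lambda>i. (snd A i, snd B i))"
  by (cases A; cases B) simp

lemma mix_group_carrier:
  assumes "group (fst A)" "group (fst B)"
  shows "carrier (mix_group n A B) \<subseteq> carrier (fst A) \<times> carrier (fst B)"
  using group.carrier_subgroup_generated_subset[OF DirProd_group[OF assms]] by auto

lemma mix_rotation_data:
  assumes A: "group (fst A)" "\<And>i. 1 \<le> i \<Longrightarrow> i < n \<Longrightarrow> snd A i \<in> carrier (fst A)"
      "\<And>i j. 1 \<le> i \<Longrightarrow> i < j \<Longrightarrow> j < n \<Longrightarrow>
        tau (fst A) (snd A) i j \<otimes>\<^bsub>fst A\<^esub> tau (fst A) (snd A) i j = \<one>\<^bsub>fst A\<^esub>"
    and B: "group (fst B)" "\<And>i. 1 \<le> i \<Longrightarrow> i < n \<Longrightarrow> snd B i \<in> carrier (fst B)"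
      "\<And>i j. 1 \<le> i \<Longrightarrow> i < j \<Longrightarrow> j < n \<Longrightarrow>
        tau (fst B) (snd B) i j \<otimes>\<^bsub>fst B\<^esub> tau (fst B) (snd B) i j = \<one>\<^bsub>fst B\<^esub>"
    and n: "3 \<le> n"
  shows "rotation_data n (mix_group n A B) (\<lambda>i. (snd A i, snd B i))"
proof -
  interpret D: group "fst A \<times>\<times> fst B" using A(1) B(1) by (rule DirProd_group)
  let ?S = "(\<lambda>i. (snd A i, snd B i)) ` {1..<n}" and ?G = "mix_group n A B"
  have S: "carrier (fst A \<times>\<times> fst B) \<inter> ?S = ?S" using A(2) B(2) by auto
  have mem: "(snd A i, snd B i) \<in> carrier ?G" if "1 \<le> i" "i < n" for i
    unfolding carrier_subgroup_generated S using that by (intro generate.incl) auto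
  then have S': "carrier ?G \<inter> ?S = ?S" by auto
  have "carrier ?G = carrier (subgroup_generated ?G ?S)" by (simp only: D.subgroup_generated2)
  then have "carrier ?G = generate ?G ?S" unfolding carrier_subgroup_generated[of ?G] S' .
  moreover have "tau ?G (\<lambda>i. (snd A i, snd B i)) i j = (tau (fst A) (snd A) i j, tau (fst B) (snd B) i j)" for i j
  proof -
    have "tau ?G (\<lambda>i. (snd A i, snd B i)) i j = tau (fst A \<times>\<times> fst B) (\<lambda>i. (snd A i, snd B i)) i j"
      unfolding tau_def by simp
    then show ?thesis unfolding tau_DirProd .
  qed
  ultimately show ?thesis
    using A(3) B(3) n mem D.group_subgroup_generated by (intro rotation_data.intro) simp_all
qed

lemma mix_fst_hom: "group (fst A) \<Longrightarrow> group (fst B) \<Longrightarrow> fst \<in> hom (mix_group n A B) (fst A)"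
  using mix_group_carrier[of A B n] by (intro homI) auto

lemma mix_snd_hom: "group (fst A) \<Longrightarrow> group (fst B) \<Longrightarrow> snd \<in> hom (mix_group n A B) (fst B)"
  using mix_group_carrier[of A B n] by (intro homI) auto

lemma eval_tau_word: "eval_word G s (tau_word i j) = tau G s i j"
  unfolding eval_word_def tau_word_def tau_def by (simp add: foldr_map comp_def)

lemma rotation_group_relator:
  assumes P: "abstract_polytope n s" "rotary_chambers n (flags s) (adj_flag s) c" "\<Phi> \<in> flags s"
    and ij: "1 \<le> i" "i < j" "j < n"
  shows "tau (rotation_group n s \<Phi>) (standard_rotation s \<Phi>) i j \<otimes>\<^bsub>rotation_group n s \<Phi>\<^esub>
    tau (rotation_group n s \<Phi>) (standard_rotation s \<Phi>) i j = \<one>\<^bsub>rotation_group n s \<Phi>\<^esub>"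
proof -
  interpret flags: polytope_presentation n "flags s" "adj_flag s" s "face_at s"
    using flags_presentation[OF P(1)] .
  interpret G: group "rotation_group n s \<Phi>" by (rule rotation_group[OF P])
  have w: "tau_word i j \<in> words n" using tau_word_words ij by blast
  have "eval_word (rotation_group n s \<Phi>) (standard_rotation s \<Phi>) (tau_word i j @ tau_word i j) =
      eval_word (rotation_group n s \<Phi>) (standard_rotation s \<Phi>) []"
    using eval_rotation_eq[OF P, of "tau_word i j @ tau_word i j" "[]"] w
      flags.word_eq_act[OF word_eq.relator[OF ij] order_refl] P(3) by simp
  then show ?thesis
    using G.eval_word_append[of n "standard_rotation s \<Phi>" "tau_word i j" "tau_word i j"] rotation_mem[OF P] w
    by (simp add: eval_tau_word) (simp add: eval_word_def)
qed

section \<open>Rotary polytopes\<close>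

context chamber_system
begin

lemma bicoloured_fold:
  assumes c: "bicoloured n X r c" and w: "w \<in> lists {..<n}" and x: "x \<in> X"
  shows "c (fold r w x) \<longleftrightarrow> (c x \<longleftrightarrow> even (length w))"
  using w x
proof (induction w arbitrary: x)
  case (Cons i w)
  have "i < n" using Cons.hyps by simp
  then have "c (r i x) \<longleftrightarrow> \<not> c x" using c Cons.prems unfolding bicoloured_def by blast
  then show ?case using Cons closed by auto
qed simp

lemma chamber_aut_fold_fixed:
  assumes f: "chamber_aut n X r f" and w: "w \<in> lists {..<n}" and x: "x \<in> X"
  shows "fold r w (f x) = f x \<longleftrightarrow> fold r w x = x"
proof -
  have "fold r w (f x) = f (fold r w x)"
    using map_fold[of f r w x] chamber_iso_step[OF f] w x by simp
  then show ?thesis using chamber_iso_inj[OF f fold_closed[OF w x] x] by simp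
qed

text \<open>An automorphism carries the one chamber to the other and commutes with words, so
  chambers of one colour have the same stabiliser among words; this is normality of the relation
  subgroup.\<close>

lemma rotary_fixed:
  assumes c: "rotary_chambers n X r c" and w: "w \<in> lists {..<n}"
    and xy: "x \<in> X" "y \<in> X" "c x = c y" and fixed: "fold r w x = x"
  shows "fold r w y = y"
proof -
  obtain f where "chamber_aut n X r f" "f x = y" using c xy unfolding rotary_chambers_def by blast
  then show ?thesis using chamber_aut_fold_fixed[of f w x] w xy fixed by metis
qed

end

lemma reflection_word_even: "even (length (reflection_word u))"
  by (induction u) auto

lemma directly_regular_chambers_rotary:
  assumes "directly_regular_chambers n X r"
  obtains c where "rotary_chambers n X r c"
  using assms unfolding directly_regular_chambers_def rotary_chambers_def by blast

text \<open>In rank 2 there is a single rotation, so words commute and \<open>bar\<close> inverts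
  them. If a word fixes the 0-neighbour, its bar and hence its inverse fix \<open>x\<close>. The
  relation subgroup therefore contains its mirror image, which rules out total chirality.\<close>

lemma (in chamber_system) rank_two_fixed:
  assumes n: "n = 2" and b: "b \<in> words 2" and x: "x \<in> X"
    and fixed: "fold r (reflection_word b) (r 0 x) = r 0 x"
  shows "fold r (reflection_word b) x = x"
proof -
  have r01: "r 0 z \<in> X" "r 1 z \<in> X" "r 0 (r 0 z) = z" "r 1 (r 1 z) = z" if "z \<in> X" for z
    using closed[of 0 z] closed[of 1 z] invol[of 0 z] invol[of 1 z] that n by auto
  define g where "g e z = fold r (if e then [1, 0] else [0, 1 :: nat]) z" for e z
  have gX: "g e z \<in> X" and gg: "g e (g (\<not> e) z) = z" if "z \<in> X" for e z
    using that r01 unfolding g_def by (cases e; simp del: One_nat_def)+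
  have letter: "fold r (reflection_word ((i, e) # u)) z = fold r (reflection_word u) (g e z)"
    if "(i, e) # u \<in> words 2" for i e u z
  proof -
    have "i = 1" using that by simp
    then show ?thesis unfolding g_def by simp
  qed
  have comm: "g e (fold r (reflection_word u) z) = fold r (reflection_word u) (g e z)"
    if "u \<in> words 2" "z \<in> X" for u e z
    using that
  proof (induction u arbitrary: z)
    case (Cons l u)
    obtain i d where l: "l = (i, d)" by (metis prod.exhaust)
    have "g e (g d z) = g d (g e z)" using gg[OF Cons.prems(2), of e] gg[OF Cons.prems(2), of d] by (cases "d = e") auto
    then show ?case using Cons letter[of i d u] l gX by simp
  qed simp
  have bar: "fold r (reflection_word (bar_word u)) (fold r (reflection_word u) z) = z" if "u \<in> words 2" "z \<in> X" for u z
    using that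
  proof (induction u arbitrary: z)
    case (Cons l u)
    obtain i d where l: "l = (i, d)" by (metis prod.exhaust)
    have i: "i = 1" "u \<in> words 2" using Cons.prems l by auto
    have "fold r (reflection_word (bar_word (l # u))) (fold r (reflection_word (l # u)) z) =
        fold r (reflection_word (bar_word u)) (g (\<not> d) (fold r (reflection_word u) (g d z)))"
      using letter[of i d u z] letter[of 1 "\<not> d" "bar_word u"] Cons.prems bar_word_words[OF i(2)] l i
      by simp
    also have "\<dots> = z" unfolding comm[OF i(2) gX[OF Cons.prems(2)]]
      using gg[OF Cons.prems(2), of "\<not> d"] Cons.IH[OF i(2) Cons.prems(2)] by simp
    finally show ?case .
  qed simp
  have bw: "bar_word b \<in> words 2" by (rule bar_word_words[OF b])
  have L: "reflection_word b \<in> lists {..<n}" "reflection_word (bar_word b) \<in> lists {..<n}"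
    using reflection_word_lists b bw n by blast+
  have "fold r (reflection_word (bar_word b)) (r 0 (r 0 x)) = r 0 (fold r (reflection_word b) (r 0 x))"
    using bar_word_act[of 2 b "r 0 x"] b n r01[OF x] by simp
  then have "fold r (reflection_word (bar_word b)) x = x" using fixed r01 x by simp
  then have "fold r (reflection_word (bar_word b)) (fold r (reflection_word b) x) = fold r (reflection_word (bar_word b)) x"
    using bar[OF b x] by simp
  then show ?thesis using fold_inj[OF L(2) fold_closed[OF L(1) x] x] by blast
qed

text \<open>In rank 1 the exchange of 0-adjacent flags is an automorphism. In rank 2 the rotation
  \<open>\<sigma>\<^sub>1\<close> would fix the base flag, although it moves the face of rank 0. The
  bound is used for coset posets and for the half-turn, whose letter \<open>m - 2\<close> must be
  positive.\<close>

lemma totally_chiral_rank: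
  assumes tc: "totally_chiral m K \<Phi>" and \<Phi>: "\<Phi> \<in> flags K"
  shows "3 \<le> m"
proof (rule ccontr)
  assume "\<not> 3 \<le> m"
  have chi: "chiral_polytope m K" using tc unfolding totally_chiral_def by blast
  then have polytope: "abstract_polytope m K" unfolding chiral_polytope_def by blast
  interpret K: polytope_presentation m "flags K" "adj_flag K" K "face_at K" by (rule flags_presentation[OF polytope])
  have cc: "chiral_chambers m (flags K) (adj_flag K)" using chi K.chiral_iff by blast
  then have m: "0 < m" unfolding chiral_chambers_def by blast
  then consider "m = 1" | "m = 2" using \<open>\<not> 3 \<le> m\<close> by linarith
  then show False
  proof cases
    case 1
    have "chamber_aut m (flags K) (adj_flag K) (adj_flag K 0)" unfolding chamber_iso_def
    proof
      show "bij_betw (adj_flag K 0) (flags K) (flags K)"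
        by (rule bij_betw_byWitness[where f' = "adj_flag K 0"]) (use K.invol[OF m] K.closed[OF m] in auto)
    qed (use 1 in simp)
    then show False using cc \<Phi> unfolding chiral_chambers_def by blast
  next
    case 2
    have u: "[(1, False)] \<in> words m" using 2 by simp
    obtain a b where ab: "a \<in> words m" "b \<in> words m" "word_eq m [(1, False)] (a @ b)"
      "fold (adj_flag K) (reflection_word a) \<Phi> = \<Phi>"
      "fold (adj_flag K) (reflection_word b) (adj_flag K 0 \<Phi>) = adj_flag K 0 \<Phi>"
      using totally_chiral_decomposition[OF tc \<Phi> u] .
    have "fold (adj_flag K) (reflection_word b) \<Phi> = \<Phi>" using K.rank_two_fixed[OF 2 _ \<Phi>] ab 2 by simp
    then have "fold (adj_flag K) (reflection_word [(1, False)]) \<Phi> = \<Phi>"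
      using K.word_eq_act[OF ab(3) order_refl u] ab(4) \<Phi> by simp
    then have "adj_flag K 1 (adj_flag K 0 \<Phi>) = \<Phi>" by simp
    then have "face_at K (adj_flag K 0 \<Phi>) 0 = face_at K \<Phi> 0"
      using K.face_step_other[of 1 "adj_flag K 0 \<Phi>" 0] K.closed[OF m \<Phi>] 2 by simp
    then show False using K.face_step[OF m \<Phi>] by simp
  qed
qed

text \<open>Several chambers may share a flag as long as the intersection property is not known, but
  a step still exchanges a single face. Adjacency of flags is thereby available for the coset
  chambers of the mix of K with its mirror image.\<close>

lemma (in incidence_presentation) i_adjacent_step:
  assumes i: "i < n" and x: "x \<in> X" and ne: "face (r i x) (int i) \<noteq> face x (int i)"
  shows "i_adjacent s i (flag_of x) (flag_of (r i x))"
proof -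
  have rx: "r i x \<in> X" using closed i x by blast
  have same: "face (r i x) j = face x j" if "j \<noteq> int i" "-1 \<le> j" "j \<le> int n" for j
    using face_cong[OF x conn_step[of i "{i}" r x], of j] that i by auto
  have diff: "flag_of y - flag_of z = {face y (int i)}"
    if "y \<in> X" "z \<in> X" "\<And>j. j \<noteq> int i \<Longrightarrow> -1 \<le> j \<Longrightarrow> j \<le> int n \<Longrightarrow> face y j = face z j"
      "face y (int i) \<noteq> face z (int i)" for y z
  proof -
    have mem: "face y j \<in> flag_of z \<longleftrightarrow> face y j = face z j" if "-1 \<le> j" "j \<le> int n" for j
      using face_mem_flag_of[OF \<open>z \<in> X\<close> \<open>y \<in> X\<close> that] .
    show ?thesis
    proof (intro equalityI subsetI)
      fix F assume F: "F \<in> flag_of y - flag_of z"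
      then obtain j where j: "-1 \<le> j" "j \<le> int n" "F = face y j" unfolding flag_of_def by auto
      then have "j = int i" using F mem that(3) by blast
      then show "F \<in> {face y (int i)}" using j by simp
    next
      fix F assume "F \<in> {face y (int i)}"
      then show "F \<in> flag_of y - flag_of z" using mem[of "int i"] that(4) i unfolding flag_of_def[of y] by auto
    qed
  qed
  have d: "flag_of x - flag_of (r i x) = {face x (int i)}" "flag_of (r i x) - flag_of x = {face (r i x) (int i)}"
    using diff[OF x rx] diff[OF rx x] same ne by metis+
  have "flag_of x \<in> flags s" "flag_of (r i x) \<in> flags s" using flags_eq x rx by blast+
  then show ?thesis unfolding i_adjacent_def adjacent_def d using face_rank_face[OF x, of "int i"] i by simp
qed

section \<open>The mix of a chiral polytope with its mirror image\<close>

lemma tau_hom: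
  assumes h: "h \<in> hom G H" "h \<one>\<^bsub>G\<^esub> = \<one>\<^bsub>H\<^esub>" and G: "group G"
    and s: "\<And>i. 1 \<le> i \<Longrightarrow> i < n \<Longrightarrow> s i \<in> carrier G" and ij: "1 \<le> i" "j < n"
  shows "tau H (\<lambda>i. h (s i)) i j = h (tau G s i j)" "tau G s i j \<in> carrier G"
proof -
  interpret group G by fact
  have "foldr (\<lambda>k x. s k \<otimes>\<^bsub>G\<^esub> x) ks \<one>\<^bsub>G\<^esub> \<in> carrier G \<and>
      foldr (\<lambda>k x. h (s k) \<otimes>\<^bsub>H\<^esub> x) ks \<one>\<^bsub>H\<^esub> = h (foldr (\<lambda>k x. s k \<otimes>\<^bsub>G\<^esub> x) ks \<one>\<^bsub>G\<^esub>)"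
    if "\<forall>k \<in> set ks. 1 \<le> k \<and> k < n" for ks
    using that by (induction ks) (auto simp: s h hom_mult[OF h(1)])
  then show "tau H (\<lambda>i. h (s i)) i j = h (tau G s i j)" "tau G s i j \<in> carrier G"
    unfolding tau_def using ij by (simp_all del: upt_Suc)
qed

lemma tau_Wplus: "1 \<le> i \<Longrightarrow> j < m \<Longrightarrow> tau (Wplus m) (Wplus_gen m) i j = word_class m (tau_word i j)"
proof -
  have "foldr (\<lambda>k x. Wplus_gen m k \<otimes>\<^bsub>Wplus m\<^esub> x) ks \<one>\<^bsub>Wplus m\<^esub> = word_class m (map (\<lambda>k. (k, False)) ks) \<and>
      map (\<lambda>k. (k, False)) ks \<in> words m" if "\<forall>k \<in> set ks. 1 \<le> k \<and> k < m" for ks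
    using that
  proof (induction ks)
    case (Cons k ks)
    then show ?case using Wplus_mult[of "[(k, False)]" m "map (\<lambda>k. (k, False)) ks"] unfolding Wplus_gen_def by simp
  qed (simp add: Wplus_one)
  then show "1 \<le> i \<Longrightarrow> j < m \<Longrightarrow> tau (Wplus m) (Wplus_gen m) i j = word_class m (tau_word i j)"
    unfolding tau_def tau_word_def by (simp del: upt_Suc)
qed

text \<open>The poset is presented twice: by polytopal chambers \<open>Y\<close>, a facet of Q in
  the application, and by coset chambers, which project onto the flags of \<open>K\<close> from the
  base flag \<open>\<Phi>\<close> and from its 0-adjacent flag. Flags of the poset link the two. The
  two projections of a chamber have opposite colours, so a word fixing both fixes all flags of
  \<open>K\<close>.\<close>

lemma mirror_mix_fixed:
  assumes chi: "chiral_polytope m K" and \<Phi>: "\<Phi> \<in> flags K" and m: "3 \<le> m"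
    and Y: "polytope_presentation m Y q (mix m (rotation_system m K \<Phi>) (mirror_rotation_system m K \<Phi>)) face"
    and w: "w \<in> lists {..<m}" and y: "y \<in> Y" "fold q w y = y" and x: "x \<in> flags K"
  shows "fold (adj_flag K) w x = x"
proof -
  have polytope: "abstract_polytope m K" using chi unfolding chiral_polytope_def by blast
  interpret K: polytope_presentation m "flags K" "adj_flag K" K "face_at K" by (rule flags_presentation[OF polytope])
  obtain c where c: "rotary_chambers m (flags K) (adj_flag K) c"
    using chi K.chiral_iff unfolding chiral_chambers_def by blast
  have m0: "0 < m" using m by simp
  let ?\<Phi>' = "adj_flag K 0 \<Phi>"
  have \<Phi>': "?\<Phi>' \<in> flags K" using K.closed[OF m0 \<Phi>] .
  note R = rotation_group[OF polytope c \<Phi>] and R' = rotation_group[OF polytope c \<Phi>']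
  let ?N = "relation_subgroup m K ?\<Phi>'"
  let ?h = "Wplus_hom (rotation_group m K ?\<Phi>') (standard_rotation K ?\<Phi>')"
  interpret h: group_hom "Wplus m" "rotation_group m K ?\<Phi>'" ?h
    by (rule Wplus_hom_group_hom[OF polytope c \<Phi>'])
  have N: "?N \<lhd> Wplus m" unfolding relation_subgroup_def by (rule h.normal_kernel)
  interpret N: normal ?N "Wplus m" by (rule N)
  \<comment> \<open>The mirror group is the quotient of \<open>Wplus m\<close> by the relations at
    the 0-adjacent flag, so it maps to the rotations with that base flag.\<close>
  obtain g where g: "g \<in> hom (Wplus m Mod ?N) (rotation_group m K ?\<Phi>')"
    "\<And>x. x \<in> carrier (Wplus m) \<Longrightarrow> g (?N #>\<^bsub>Wplus m\<^esub> x) = ?h x"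
    using h.FactGroup_universal_kernel[OF N] unfolding relation_subgroup_def by blast
  let ?A = "rotation_system m K \<Phi>" and ?B = "mirror_rotation_system m K \<Phi>"
  have B: "fst ?B = Wplus m Mod ?N" "snd ?B = (\<lambda>i. ?N #>\<^bsub>Wplus m\<^esub> Wplus_gen m i)"
    unfolding mirror_rotation_system_def Let_def bar_relation_subgroup[OF polytope c \<Phi> m0] by simp_all
  have A: "fst ?A = rotation_group m K \<Phi>" "snd ?A = standard_rotation K \<Phi>"
    unfolding rotation_system_def by simp_all
  have gen: "Wplus_gen m i \<in> carrier (Wplus m)" if "1 \<le> i" "i < m" for i
    unfolding Wplus_gen_def using word_class_carrier that by simp
  have Ngrp: "group (fst ?B)" unfolding B using N.factorgroup_is_group .
  have coset_hom: "(\<lambda>a. ?N #>\<^bsub>Wplus m\<^esub> a) \<in> hom (Wplus m) (Wplus m Mod ?N)" using N.r_coset_hom_Mod .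
  have coset_one: "?N #>\<^bsub>Wplus m\<^esub> \<one>\<^bsub>Wplus m\<^esub> = \<one>\<^bsub>Wplus m Mod ?N\<^esub>"
    using h.G.coset_mult_one[OF N.subset] by simp
  have relB: "tau (fst ?B) (snd ?B) i j \<otimes>\<^bsub>fst ?B\<^esub> tau (fst ?B) (snd ?B) i j = \<one>\<^bsub>fst ?B\<^esub>"
    if ij: "1 \<le> i" "i < j" "j < m" for i j
  proof -
    have t: "tau (fst ?B) (snd ?B) i j = ?N #>\<^bsub>Wplus m\<^esub> word_class m (tau_word i j)"
      unfolding B using tau_hom(1)[OF coset_hom coset_one Wplus_group gen ij(1,3)] tau_Wplus ij by simp
    have "word_class m (tau_word i j) \<in> carrier (Wplus m)" using word_class_carrier tau_word_words ij by simp
    then show ?thesis unfolding t unfolding B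
      using hom_mult[OF coset_hom, of "word_class m (tau_word i j)" "word_class m (tau_word i j)"]
        Wplus_relator[OF ij] coset_one by simp
  qed
  have data: "rotation_data m (mix_group m ?A ?B) (\<lambda>i. (snd ?A i, snd ?B i))"
  proof (rule mix_rotation_data)
    show "snd ?B i \<in> carrier (fst ?B)" if "1 \<le> i" "i < m" for i
      unfolding B using hom_in_carrier[OF coset_hom gen[OF that]] .
  qed (use A R rotation_mem[OF polytope c \<Phi>] rotation_group_relator[OF polytope c \<Phi>] Ngrp relB m in auto)
  interpret D: rotation_data m "mix_group m ?A ?B" "\<lambda>i. (snd ?A i, snd ?B i)" by (rule data)
  have inc: "incidence_presentation m D.X D.r (mix m ?A ?B) D.face" unfolding mix_eq by (rule D.coset_presentation)
  interpret D: incidence_presentation m D.X D.r "mix m ?A ?B" D.face by (rule inc)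
  have grpA: "group (fst ?A)" unfolding A by (rule R)
  have fst_hom: "fst \<in> hom (mix_group m ?A ?B) (aut_group K)"
    using hom_compose[OF mix_fst_hom[OF grpA Ngrp] rotation_inclusion[OF polytope c \<Phi>, folded A(1)]] by (simp add: comp_def)
  have snd_hom: "(\<lambda>x. g (snd x)) \<in> hom (mix_group m ?A ?B) (aut_group K)"
    using hom_compose[OF hom_compose[OF mix_snd_hom[OF grpA Ngrp] g(1)[folded B(1)]] rotation_inclusion[OF polytope c \<Phi>']]
    by (simp add: comp_def)
  interpret P1: rotation_projection m "mix_group m ?A ?B" "\<lambda>i. (snd ?A i, snd ?B i)" K \<Phi> fst c
    using fst_hom A(2) by unfold_locales (simp_all add: polytope c \<Phi>)
  have g_gen: "g (snd ?B i) = standard_rotation K ?\<Phi>' i" if i: "1 \<le> i" "i < m" for i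
  proof -
    interpret R': group "rotation_group m K ?\<Phi>'" by (rule R')
    have "g (snd ?B i) = ?h (Wplus_gen m i)" unfolding B by (rule g(2)[OF gen[OF i]])
    also have "\<dots> = eval_word (rotation_group m K ?\<Phi>') (standard_rotation K ?\<Phi>') [(i, False)]"
      unfolding Wplus_gen_def using Wplus_hom_class[OF polytope c \<Phi>', of "[(i, False)]"] i by simp
    finally show ?thesis using rotation_mem[OF polytope c \<Phi>' i] by (simp add: eval_word_def)
  qed
  interpret P2: rotation_projection m "mix_group m ?A ?B" "\<lambda>i. (snd ?A i, snd ?B i)" K ?\<Phi>' "\<lambda>x. g (snd x)" c
    using snd_hom g_gen by unfold_locales (simp_all add: polytope c \<Phi>')
  interpret Y: polytope_presentation m Y q "mix m ?A ?B" face by (rule Y)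
  have "Y.flag_of y \<in> D.flag_of ` D.X" using Y.flags_eq D.flags_eq y(1) by blast
  then obtain d where d: "d \<in> D.X" "D.flag_of d = Y.flag_of y" by auto
  \<comment> \<open>In \<open>Y\<close> the \<open>i\<close>-adjacent flag is unique, so chambers of
    the two presentations with a common flag run through the same flags along a word.\<close>
  have flag: "D.flag_of (fold D.r u d) = Y.flag_of (fold q u y)" if "u \<in> lists {..<m}" for u
    using that
  proof (induction u rule: rev_induct)
    case Nil
    then show ?case using d by simp
  next
    case (snoc i u)
    then have i: "i < m" and u: "u \<in> lists {..<m}" by auto
    let ?d = "fold D.r u d" and ?y = "fold q u y"
    have dX: "?d \<in> D.X" using D.X.fold_closed[OF u d(1)] .
    have yY: "?y \<in> Y" using Y.fold_closed[OF u y(1)] .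
    \<comment> \<open>That the step changes the face of rank \<open>i\<close> is inherited from
      \<open>K\<close> through the projection.\<close>
    have "\<not> conn D.r (cot m (int i)) ?d (D.r i ?d)"
    proof
      assume "conn D.r (cot m (int i)) ?d (D.r i ?d)"
      then have "conn (adj_flag K) (cot m (int i)) (P1.\<pi> ?d) (P1.\<pi> (D.r i ?d))"
        using D.X.map_conn[of P1.\<pi> "adj_flag K" "cot m (int i)" ?d "D.r i ?d"] P1.\<pi>_step dX by auto
      then show False using K.not_conn_cot[OF i P1.\<pi>_mem[OF dX]] P1.\<pi>_step[OF i dX] by simp
    qed
    then have "D.face (D.r i ?d) (int i) \<noteq> D.face ?d (int i)"
      using D.face_eq[OF dX D.X.closed[OF i dX], of "int i" "int i"] i by auto
    then have "i_adjacent (mix m ?A ?B) i (D.flag_of ?d) (D.flag_of (D.r i ?d))"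
      by (rule D.i_adjacent_step[OF i dX])
    then have "D.flag_of (D.r i ?d) = Y.flag_of (q i ?y)"
      unfolding snoc.IH[OF u] using Y.i_adjacent_iff[OF yY] by blast
    then show ?case by simp
  qed
  let ?e = "fold D.r w d"
  have eX: "?e \<in> D.X" using D.X.fold_closed[OF w d(1)] .
  have "D.flag_of d = D.flag_of ?e" using flag[OF w] y(2) d(2) by simp
  then have "D.face d i = D.face ?e i" if "-1 \<le> i" "i \<le> int m" for i
    using D.flag_of_eq_iff[OF d(1) eX] that by blast
  then have conn: "conn D.r (cot m (int i)) d ?e" if "i < m" for i
    using D.face_eq[OF d(1) eX, of "int i" "int i"] that by auto
  \<comment> \<open>The word is only known to fix the flag of the coset chamber \<open>d\<close>,
    not \<open>d\<close> itself. That suffices: \<open>d\<close> and its image share all faces,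
    sharing passes to the projections, and in \<open>K\<close> a chamber is determined by its
    faces.\<close>
  have fix1: "fold (adj_flag K) w (P1.\<pi> d) = P1.\<pi> d"
  proof (rule K.conn_cot_eq[symmetric])
    show "P1.\<pi> d \<in> flags K" "fold (adj_flag K) w (P1.\<pi> d) \<in> flags K"
      using P1.\<pi>_mem d(1) K.fold_closed[OF w] by auto
    fix i assume "i < m"
    then have "conn (adj_flag K) (cot m (int i)) (P1.\<pi> d) (P1.\<pi> ?e)"
      using D.X.map_conn[of P1.\<pi> "adj_flag K" "cot m (int i)" d ?e] P1.\<pi>_step d(1) conn by auto
    then show "conn (adj_flag K) (cot m (int i)) (P1.\<pi> d) (fold (adj_flag K) w (P1.\<pi> d))"
      using P1.\<pi>_fold[OF w d(1)] by simp
  qed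
  have fix2: "fold (adj_flag K) w (P2.\<pi> d) = P2.\<pi> d"
  proof (rule K.conn_cot_eq[symmetric])
    show "P2.\<pi> d \<in> flags K" "fold (adj_flag K) w (P2.\<pi> d) \<in> flags K"
      using P2.\<pi>_mem d(1) K.fold_closed[OF w] by auto
    fix i assume "i < m"
    then have "conn (adj_flag K) (cot m (int i)) (P2.\<pi> d) (P2.\<pi> ?e)"
      using D.X.map_conn[of P2.\<pi> "adj_flag K" "cot m (int i)" d ?e] P2.\<pi>_step d(1) conn by auto
    then show "conn (adj_flag K) (cot m (int i)) (P2.\<pi> d) (fold (adj_flag K) w (P2.\<pi> d))"
      using P2.\<pi>_fold[OF w d(1)] by simp
  qed
  have "c ?\<Phi>' \<longleftrightarrow> \<not> c \<Phi>" using c m0 \<Phi> unfolding rotary_chambers_def bicoloured_def by blast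
  then have "c (P1.\<pi> d) = c x \<or> c (P2.\<pi> d) = c x" using P1.\<pi>_colour[OF d(1)] P2.\<pi>_colour[OF d(1)] by blast
  then show ?thesis
  proof
    assume "c (P1.\<pi> d) = c x"
    then show ?thesis by (rule K.rotary_fixed[OF c w P1.\<pi>_mem[OF d(1)] x _ fix1])
  next
    assume "c (P2.\<pi> d) = c x"
    then show ?thesis by (rule K.rotary_fixed[OF c w P2.\<pi>_mem[OF d(1)] x _ fix2])
  qed
qed

section \<open>Words separating a flag from its mirror image\<close>

lemma facet_iso_flags:
  assumes P: "abstract_polytope (Suc m) P" and facets: "facets_isomorphic (Suc m) P K" and \<Psi>: "\<Psi> \<in> flags P"
  obtains h where "chamber_iso m (residue (adj_flag P) m \<Psi>) (adj_flag P) (flags K) (adj_flag K) h"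
    "chamber_system m (residue (adj_flag P) m \<Psi>) (adj_flag P)"
proof -
  obtain face where "polytope_presentation m (residue (adj_flag P) m \<Psi>) (adj_flag P) K face"
    using facet_presents[OF flags_presentation[OF P] facets \<Psi>] .
  then interpret F: polytope_presentation m "residue (adj_flag P) m \<Psi>" "adj_flag P" K face .
  obtain h where "chamber_iso m (residue (adj_flag P) m \<Psi>) (adj_flag P) (flags K) (adj_flag K) h"
    by (rule F.iso_flags)
  then show ?thesis using F.chamber_system_axioms by (rule that)
qed

lemma facet_word_fixed:
  assumes P: "abstract_polytope (Suc m) P" and facets: "facets_isomorphic (Suc m) P K" and \<Psi>: "\<Psi> \<in> flags P"
    and h: "chamber_iso m (residue (adj_flag P) m \<Psi>) (adj_flag P) (flags K) (adj_flag K) h"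
    and w: "w \<in> lists {..<m}" and y: "y \<in> residue (adj_flag P) m \<Psi>"
  shows "fold (adj_flag P) w y = y \<longleftrightarrow> fold (adj_flag K) w (h y) = h y"
proof -
  interpret F: chamber_system m "residue (adj_flag P) m \<Psi>" "adj_flag P"
    using facet_iso_flags[OF P facets \<Psi>] by blast
  have "h (fold (adj_flag P) w y) = fold (adj_flag K) w (h y)"
    using F.map_fold[of h "adj_flag K" w y] chamber_iso_step[OF h] w y by blast
  then show ?thesis using chamber_iso_inj[OF h F.fold_closed[OF w y] y] by simp
qed

text \<open>Total chirality of \<open>K\<close> splits \<open>u\<close> into \<open>a\<close>,
  fixing \<open>\<Phi>\<close>, and \<open>b\<close>, fixing its 0-adjacent flag. Transferred to the
  facet of \<open>\<Psi>\<close>, one of them fixes \<open>\<Psi>\<close> and therefore all flags of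
  its colour, so that only the other acts there, and that one fixes the mirror flag. Which is which
  depends on whether the facet isomorphism gives \<open>\<Psi>\<close> the colour of
  \<open>\<Phi>\<close>.\<close>

lemma facet_word_replacement:
  assumes tc: "totally_chiral m K \<Phi>" and \<Phi>: "\<Phi> \<in> flags K"
    and P: "abstract_polytope (Suc m) P" and facets: "facets_isomorphic (Suc m) P K"
    and c: "rotary_chambers (Suc m) (flags P) (adj_flag P) c" and \<Psi>: "\<Psi> \<in> flags P" and u: "u \<in> words m"
  obtains b where "b \<in> lists {..<Suc m}" "fold (adj_flag P) b (adj_flag P 0 \<Psi>) = adj_flag P 0 \<Psi>"
    "\<And>y. y \<in> flags P \<Longrightarrow> c y = c \<Psi> \<Longrightarrow> fold (adj_flag P) (reflection_word u) y = fold (adj_flag P) b y"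
proof -
  interpret P: polytope_presentation "Suc m" "flags P" "adj_flag P" P "face_at P" by (rule flags_presentation[OF P])
  have chi: "chiral_polytope m K" using tc unfolding totally_chiral_def by blast
  then have pK: "abstract_polytope m K" unfolding chiral_polytope_def by blast
  interpret K: polytope_presentation m "flags K" "adj_flag K" K "face_at K" by (rule flags_presentation[OF pK])
  obtain cK where cK: "rotary_chambers m (flags K) (adj_flag K) cK"
    using chi K.chiral_iff unfolding chiral_chambers_def by blast
  have m: "0 < m" using totally_chiral_rank[OF tc \<Phi>] by simp
  have K0: "cK (adj_flag K 0 x) \<longleftrightarrow> \<not> cK x" if "x \<in> flags K" for x
    using cK m that unfolding rotary_chambers_def bicoloured_def by blast
  obtain h where h: "chamber_iso m (residue (adj_flag P) m \<Psi>) (adj_flag P) (flags K) (adj_flag K) h"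
    using facet_iso_flags[OF P facets \<Psi>] by blast
  let ?res = "residue (adj_flag P) m \<Psi>" and ?\<Psi>' = "adj_flag P 0 \<Psi>" and ?\<Phi>' = "adj_flag K 0 \<Phi>"
  have res: "\<Psi> \<in> ?res" "?\<Psi>' \<in> ?res" using m by (auto simp: residue_def intro: conn_step)
  have h0: "h ?\<Psi>' = adj_flag K 0 (h \<Psi>)" using chamber_iso_step[OF h m res(1)] .
  have hK: "h \<Psi> \<in> flags K" "h ?\<Psi>' \<in> flags K" using chamber_iso_mem[OF h] res by blast+
  have \<Phi>': "?\<Phi>' \<in> flags K" using K.closed[OF m \<Phi>] .
  have \<Psi>': "?\<Psi>' \<in> flags P" using P.closed[OF _ \<Psi>] by simp
  obtain a b where ab: "a \<in> words m" "b \<in> words m" "word_eq m u (a @ b)"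
    "fold (adj_flag K) (reflection_word a) \<Phi> = \<Phi>"
    "fold (adj_flag K) (reflection_word b) ?\<Phi>' = ?\<Phi>'"
    using totally_chiral_decomposition[OF tc \<Phi> u] .
  have L: "reflection_word v \<in> lists {..<m}" "reflection_word v \<in> lists {..<Suc m}" if "v \<in> words m" for v
    using that reflection_word_lists[of v m m] reflection_word_lists[of v m "Suc m"] by auto
  have act: "fold (adj_flag P) (reflection_word u) y =
      fold (adj_flag P) (reflection_word b) (fold (adj_flag P) (reflection_word a) y)" if "y \<in> flags P" for y
    using P.word_eq_act[OF ab(3) _ u] that by simp
  note fixed = facet_word_fixed[OF P facets \<Psi> h L(1)]
  have bic: "bicoloured (Suc m) (flags P) (adj_flag P) c" using c unfolding rotary_chambers_def by blast
  show ?thesis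
  proof (cases "cK (h \<Psi>) = cK \<Phi>")
    case True
    have "fold (adj_flag K) (reflection_word a) (h \<Psi>) = h \<Psi>"
      using K.rotary_fixed[OF cK L(1)[OF ab(1)] \<Phi> hK(1)] True ab(4) by simp
    then have a: "fold (adj_flag P) (reflection_word a) \<Psi> = \<Psi>" using fixed[OF ab(1) res(1)] by simp
    have "fold (adj_flag K) (reflection_word b) (h ?\<Psi>') = h ?\<Psi>'"
      using K.rotary_fixed[OF cK L(1)[OF ab(2)] \<Phi>' hK(2)] True ab(5) K0[OF \<Phi>] K0[OF hK(1)] h0 by simp
    then have b: "fold (adj_flag P) (reflection_word b) ?\<Psi>' = ?\<Psi>'" using fixed[OF ab(2) res(2)] by simp
    show ?thesis
    proof (rule that[OF L(2)[OF ab(2)] b])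
      fix y assume y: "y \<in> flags P" "c y = c \<Psi>"
      then have "fold (adj_flag P) (reflection_word a) y = y"
        using P.rotary_fixed[OF c L(2)[OF ab(1)] \<Psi> y(1) _ a] by simp
      then show "fold (adj_flag P) (reflection_word u) y = fold (adj_flag P) (reflection_word b) y" using act[OF y(1)] by simp
    qed
  next
    case False
    have "fold (adj_flag K) (reflection_word a) (h ?\<Psi>') = h ?\<Psi>'"
      using K.rotary_fixed[OF cK L(1)[OF ab(1)] \<Phi> hK(2)] False ab(4) K0[OF hK(1)] h0 by simp
    then have a: "fold (adj_flag P) (reflection_word a) ?\<Psi>' = ?\<Psi>'" using fixed[OF ab(1) res(2)] by simp
    have "fold (adj_flag K) (reflection_word b) (h \<Psi>) = h \<Psi>"
      using K.rotary_fixed[OF cK L(1)[OF ab(2)] \<Phi>' hK(1)] False ab(5) K0[OF \<Phi>] by simp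
    then have b: "fold (adj_flag P) (reflection_word b) \<Psi> = \<Psi>" using fixed[OF ab(2) res(1)] by simp
    show ?thesis
    proof (rule that[OF L(2)[OF ab(1)] a])
      fix y assume y: "y \<in> flags P" "c y = c \<Psi>"
      let ?z = "fold (adj_flag P) (reflection_word a) y"
      have z: "?z \<in> flags P" using P.fold_closed[OF L(2)[OF ab(1)] y(1)] .
      have "c ?z = c \<Psi>" using P.bicoloured_fold[OF bic L(2)[OF ab(1)] y(1)] reflection_word_even y(2) by simp
      then have "fold (adj_flag P) (reflection_word b) ?z = ?z"
        using P.rotary_fixed[OF c L(2)[OF ab(2)] \<Psi> z _ b] by simp
      then show "fold (adj_flag P) (reflection_word u) y = ?z" using act[OF y(1)] by simp
    qed
  qed
qed

text \<open>The orbit of the base flag under the stabiliser of its mirror flag is infinite, because together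
  with its image under the half-turn \<open>r (m - 2)\<close>, \<open>r m\<close> it exhausts the flags of one colour; so by
  the pigeonhole principle two elements of the stabiliser agree on \<open>z\<close> but not on the base flag.\<close>

lemma separating_word:
  assumes tc: "totally_chiral m K \<Phi>" and \<Phi>: "\<Phi> \<in> flags K"
    and P: "abstract_polytope (Suc m) P" and facets: "facets_isomorphic (Suc m) P K"
    and c: "rotary_chambers (Suc m) (flags P) (adj_flag P) c" and \<Psi>: "\<Psi> \<in> flags P"
    and infinite: "infinite (flags P)"
    and Z: "chamber_system (Suc m) Z q" "finite Z" "z \<in> Z"
  obtains v where "v \<in> lists {..<Suc m}" "fold q v z = z"
    "fold (adj_flag P) v (adj_flag P 0 \<Psi>) = adj_flag P 0 \<Psi>" "fold (adj_flag P) v \<Psi> \<noteq> \<Psi>"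
proof -
  interpret P: polytope_presentation "Suc m" "flags P" "adj_flag P" P "face_at P" by (rule flags_presentation[OF P])
  interpret Z: chamber_system "Suc m" Z q by (rule Z(1))
  have m: "3 \<le> m" by (rule totally_chiral_rank[OF tc \<Phi>])
  let ?r = "adj_flag P" and ?\<Psi>' = "adj_flag P 0 \<Psi>"
  let ?L = "lists {..<Suc m}"
  have \<Psi>': "?\<Psi>' \<in> flags P" using P.closed[OF _ \<Psi>] by simp
  have bic: "bicoloured (Suc m) (flags P) ?r c" using c unfolding rotary_chambers_def by blast
  have c0: "c ?\<Psi>' \<longleftrightarrow> \<not> c \<Psi>" using bic \<Psi> unfolding bicoloured_def by simp
  define B where "B = {a \<in> ?L. fold ?r a ?\<Psi>' = ?\<Psi>'}"
  define Orb where "Orb = (\<lambda>a. fold ?r a \<Psi>) ` B"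
  have even: "even (length a)" if "a \<in> B" for a
    using that P.bicoloured_fold[OF bic _ \<Psi>', of a] unfolding B_def by auto
  have Orb: "y \<in> flags P \<and> c y = c \<Psi>" if "y \<in> Orb" for y
  proof -
    obtain a where a: "a \<in> B" "y = fold ?r a \<Psi>" using \<open>y \<in> Orb\<close> unfolding Orb_def by blast
    then have "a \<in> ?L" unfolding B_def by blast
    then show ?thesis using P.fold_closed[OF _ \<Psi>] P.bicoloured_fold[OF bic _ \<Psi>] even a by simp
  qed
  \<comment> \<open>This is the half-turn
    \<open>\<sigma>\<^sub>m\<^sub>-\<^sub>1\<sigma>\<^sub>m\<close>. Its letters commute, so it is
    an involution; together with the facet rotations it generates all rotations.\<close>
  define \<tau> where "\<tau> = [m - 2, m]"
  have \<tau>L: "\<tau> \<in> ?L" using m unfolding \<tau>_def by auto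
  have \<tau>_even: "even (length \<tau>)" unfolding \<tau>_def by simp
  have \<tau>\<tau>: "fold ?r \<tau> (fold ?r \<tau> y) = y" if y: "y \<in> flags P" for y
  proof -
    have 1: "?r (m - 2) (?r m x) = ?r m (?r (m - 2) x)" if "x \<in> flags P" for x
      using P.commute[of "m - 2" m x] that m by simp
    have "fold ?r \<tau> (fold ?r \<tau> y) = ?r m (?r (m - 2) (?r m (?r (m - 2) y)))" unfolding \<tau>_def by simp
    also have "\<dots> = ?r m (?r m (?r (m - 2) (?r (m - 2) y)))" using 1 P.closed y by simp
    also have "\<dots> = y" using P.invol P.closed y by simp
    finally show ?thesis .
  qed
  \<comment> \<open>Two copies of the orbit suffice: \<open>\<tau>\<close> exchanges them, and facet
    words act on each as words of the stabiliser.\<close>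
  define S where "S = Orb \<union> fold ?r \<tau> ` Orb"
  have S_flags: "y \<in> flags P \<and> c y = c \<Psi>" if "y \<in> S" for y
    using that Orb P.fold_closed[OF \<tau>L] P.bicoloured_fold[OF bic \<tau>L] \<tau>_even unfolding S_def by auto
  have S_\<tau>: "fold ?r \<tau> y \<in> S" if "y \<in> S" for y
    using that \<tau>\<tau> Orb unfolding S_def by auto
  have S_facet: "fold ?r (reflection_word u) y \<in> S" if u: "u \<in> words m" and y: "y \<in> S" for u y
  proof -
    obtain b where b: "b \<in> ?L" "fold ?r b ?\<Psi>' = ?\<Psi>'"
      "\<And>y. y \<in> flags P \<Longrightarrow> c y = c \<Psi> \<Longrightarrow> fold ?r (reflection_word u) y = fold ?r b y"
      using facet_word_replacement[OF tc \<Phi> P facets c \<Psi> u] by blast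
    have yb: "fold ?r (reflection_word u) y = fold ?r b y" using b(3) S_flags[OF y] by blast
    from y consider "y \<in> Orb" | x where "x \<in> Orb" "y = fold ?r \<tau> x" unfolding S_def by blast
    then show ?thesis
    proof cases
      case 1
      then obtain a where a: "a \<in> B" "y = fold ?r a \<Psi>" unfolding Orb_def by blast
      then have "a @ b \<in> B" using b unfolding B_def by simp
      then have "fold ?r (a @ b) \<Psi> \<in> Orb" unfolding Orb_def by blast
      then have "fold ?r b y \<in> Orb" unfolding a(2) by simp
      then show ?thesis unfolding yb S_def by blast
    next
      case 2
      then obtain a where a: "a \<in> B" "x = fold ?r a \<Psi>" unfolding Orb_def by blast
      \<comment> \<open>The conjugate of \<open>b\<close> by \<open>\<tau>\<close> again fixes the
        mirror flag: \<open>\<tau>\<close> preserves colours, and \<open>b\<close> fixes every flag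
        of the mirror colour.\<close>
      let ?a = "a @ \<tau> @ b @ \<tau>"
      have aL: "a \<in> ?L" "fold ?r a ?\<Psi>' = ?\<Psi>'" using a(1) unfolding B_def by auto
      let ?x = "fold ?r \<tau> ?\<Psi>'"
      have xf: "?x \<in> flags P" "c ?\<Psi>' = c ?x"
        using P.fold_closed[OF \<tau>L \<Psi>'] P.bicoloured_fold[OF bic \<tau>L \<Psi>'] \<tau>_even by auto
      have "fold ?r b ?x = ?x" using P.rotary_fixed[OF c b(1) \<Psi>' xf b(2)] .
      then have "?a \<in> B" using aL \<tau>L b(1) \<tau>\<tau>[OF \<Psi>'] unfolding B_def by simp
      then have "fold ?r ?a \<Psi> \<in> Orb" unfolding Orb_def by blast
      moreover have "fold ?r \<tau> (fold ?r ?a \<Psi>) = fold ?r b y"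
      proof -
        have "fold ?r b y \<in> flags P" using P.fold_closed[OF b(1)] S_flags[OF y] by blast
        then show ?thesis using \<tau>\<tau> a(2) 2(2) by simp
      qed
      ultimately show ?thesis unfolding yb S_def by (metis UnI2 imageI)
    qed
  qed
  \<comment> \<open>Closure under these two-letter words makes \<open>S\<close> together with its
    0-neighbours closed under every single step.\<close>
  have S_pair: "?r i (?r 0 y) \<in> S \<and> ?r 0 (?r i y) \<in> S" if i: "i < Suc m" and y: "y \<in> S" for i y
  proof -
    have yf: "y \<in> flags P" using S_flags[OF y] by blast
    have facet: "?r j (?r 0 y) \<in> S" if "1 \<le> j" "j < m" for j
      using S_facet[OF tau_word_words y, of 1 j] P.tau_word_act[of 1 j y] that yf by simp
    consider "i = 0" | "i = 1" | "2 \<le> i" "i < m" | "i = m" using i by linarith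
    then show ?thesis
    proof cases
      case 1
      then show ?thesis using P.invol[of 0 y] yf y by simp
    next
      case 2
      have "fold ?r (reflection_word [(1, True)]) y \<in> S" using S_facet[of "[(1, True)]" y] y m by simp
      then show ?thesis using facet[of 1] 2 m by simp
    next
      case 3
      then show ?thesis using facet[of i] P.commute[of 0 i y] yf i by simp
    next
      case 4
      \<comment> \<open>The half-turn applied after the letter \<open>m - 2\<close> cancels it and
        leaves \<open>m\<close>; this is how the letter outside the facet is reached.\<close>
      have "?r (m - 2) (?r 0 y) \<in> S" using facet[of "m - 2"] m by simp
      then have "fold ?r \<tau> (?r (m - 2) (?r 0 y)) \<in> S" by (rule S_\<tau>)
      then have "?r m (?r 0 y) \<in> S"
        using P.invol[of "m - 2" "?r 0 y"] P.closed[of 0 y] yf m unfolding \<tau>_def by simp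
      then show ?thesis using 4 P.commute[of 0 m y] yf m by simp
    qed
  qed
  have "\<Psi> \<in> S"
  proof -
    have "[] \<in> B" unfolding B_def by simp
    then show ?thesis unfolding S_def Orb_def by force
  qed
  have "y \<in> S \<union> ?r 0 ` S" if y: "y \<in> flags P" for y
    using P.connected[OF \<Psi> y]
  proof (induction rule: conn_induct)
    case (step y i)
    then have i: "i < Suc m" by simp
    from step.IH consider "y \<in> S" | x where "x \<in> S" "y = ?r 0 x" by blast
    then show ?case
    proof cases
      case 1
      have "?r 0 (?r i y) \<in> S" using S_pair[OF i 1] by blast
      moreover have "?r 0 (?r 0 (?r i y)) = ?r i y" using P.invol[of 0] P.closed[OF i] S_flags[OF 1] by simp
      ultimately show ?thesis by (metis UnI2 imageI)
    next
      case 2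
      then show ?thesis using S_pair[OF i 2(1)] by blast
    qed
  qed (use \<open>\<Psi> \<in> S\<close> in blast)
  then have "flags P \<subseteq> S \<union> ?r 0 ` S" by blast
  then have inf: "infinite Orb"
    using infinite finite_subset unfolding S_def by (metis finite_Un finite_imageI)
  define word where "word y = (SOME a. a \<in> B \<and> y = fold ?r a \<Psi>)" for y
  have word: "word y \<in> B" "fold ?r (word y) \<Psi> = y" if "y \<in> Orb" for y
  proof -
    have "\<exists>a. a \<in> B \<and> y = fold ?r a \<Psi>" using that unfolding Orb_def by blast
    from someI_ex[OF this] show "word y \<in> B" "fold ?r (word y) \<Psi> = y" unfolding word_def by auto
  qed
  have "(\<lambda>y. fold q (word y) z) ` Orb \<subseteq> Z" using word(1) Z.fold_closed[OF _ Z(3)] unfolding B_def by blast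
  then have "finite ((\<lambda>y. fold q (word y) z) ` Orb)" using Z(2) finite_subset by blast
  then obtain x where "x \<in> Orb" "infinite {y \<in> Orb. fold q (word y) z = fold q (word x) z}"
    using pigeonhole_infinite[OF inf] by blast
  moreover from this(2) obtain y where "y \<in> {y \<in> Orb. fold q (word y) z = fold q (word x) z}" "y \<noteq> x"
    by (metis (no_types, lifting) finite.emptyI finite.insertI finite_subset insertI1 subsetI)
  ultimately have xy: "x \<in> Orb" "y \<in> Orb" "fold q (word y) z = fold q (word x) z" "y \<noteq> x" by auto
  have L: "word x \<in> ?L" "word y \<in> ?L" "fold ?r (word x) ?\<Psi>' = ?\<Psi>'" "fold ?r (word y) ?\<Psi>' = ?\<Psi>'"
    using word(1)[OF xy(1)] word(1)[OF xy(2)] unfolding B_def by auto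
  \<comment> \<open>Both words lead \<open>z\<close> to the same place, so going along one and back
    along the other fixes \<open>z\<close>; on \<open>\<Psi>\<close> the two words differ.\<close>
  let ?v = "word y @ rev (word x)"
  show ?thesis
  proof (rule that)
    show "?v \<in> ?L" using L(1,2) by (auto simp: in_lists_conv_set)
    show "fold q ?v z = z" using xy(3) Z.fold_rev[OF L(1) Z(3)] by simp
    show "fold ?r ?v ?\<Psi>' = ?\<Psi>'" using L(3,4) P.fold_rev[OF L(1) \<Psi>'] by simp
    show "fold ?r ?v \<Psi> \<noteq> \<Psi>"
    proof
      assume "fold ?r ?v \<Psi> = \<Psi>"
      then have "fold ?r (rev (word x)) y = \<Psi>" using word(2)[OF xy(2)] by simp
      then have "y = fold ?r (word x) \<Psi>" using P.fold_rev'[OF L(1), of y] Orb[OF xy(2)] by simp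
      then show False using word(2)[OF xy(1)] xy(4) by simp
    qed
  qed
qed

section \<open>Chirality of the mix and regularity of its facets\<close>

theorem theorem5p5:
  fixes n :: nat and p :: "nat \<Rightarrow> nat"
    and K :: "'a rel" and P :: "'b rel" and Q :: "'c rel"
    and \<Phi> :: "'a set" and \<Psi> :: "'b set" and \<Omega> :: "'c set"
  assumes "\<Phi> \<in> flags K" and "\<Psi> \<in> flags P" and "\<Omega> \<in> flags Q"
    and "finite (Field K)"
    and "totally_chiral (n - 1) K \<Phi>"
    and "has_type (n - 1) K \<Phi> p"
    and "facets_directly_regular (n - 1) K"
    and "universal_chiral n K P"
    and "finite (Field Q)"
    and "directly_regular n Q"
    and "has_type n Q \<Omega> (p(n - 1 := 2))"
    and "facets_isomorphic n Q
           (mix (n - 1) (rotation_system (n - 1) K \<Phi>) (mirror_rotation_system (n - 1) K \<Phi>))"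
  shows "chiral_polytope n (mix n (rotation_system n P \<Psi>) (rotation_system n Q \<Omega>)) \<and>
         facets_directly_regular n (mix n (rotation_system n P \<Psi>) (rotation_system n Q \<Omega>))"
proof -
  note \<Phi> = assms(1) and \<Psi> = assms(2) and \<Omega> = assms(3)
  define m where "m = n - 1"
  have tc: "totally_chiral m K \<Phi>" using assms(5) unfolding m_def .
  have m: "3 \<le> m" by (rule totally_chiral_rank[OF tc \<Phi>])
  then have n: "n = Suc m" "3 \<le> n" "0 < n" "n = Suc (Suc (m - 1))" "Suc (m - 1) = m" unfolding m_def by auto
  have chiK: "chiral_polytope m K" using tc unfolding totally_chiral_def by blast
  have univ: "universal_chiral n K P" by fact
  then have chiP: "chiral_polytope n P" and facetsP: "facets_isomorphic n P K" unfolding universal_chiral_def by auto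
  have pP: "abstract_polytope n P" using chiP unfolding chiral_polytope_def by blast
  have pQ: "abstract_polytope n Q" using assms(10) unfolding directly_regular_def regular_polytope_def by blast
  interpret P: polytope_presentation n "flags P" "adj_flag P" P "face_at P" by (rule flags_presentation[OF pP])
  interpret Q: polytope_presentation n "flags Q" "adj_flag Q" Q "face_at Q" by (rule flags_presentation[OF pQ])
  obtain cP where cP: "rotary_chambers n (flags P) (adj_flag P) cP"
    using chiP P.chiral_iff unfolding chiral_chambers_def by blast
  have dQ: "directly_regular_chambers n (flags Q) (adj_flag Q)" using assms(10) Q.directly_regular_iff n by blast
  then obtain cQ where cQ: "rotary_chambers n (flags Q) (adj_flag Q) cQ" by (rule directly_regular_chambers_rotary)
  have "infinite (Field P)" using universal_chiral_infinite[OF univ n(4)] chiK n(5) by simp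
  \<comment> \<open>Every face lies in a flag and flags are finite, so infinitely many faces require
    infinitely many flags.\<close>
  moreover have "Field P \<subseteq> \<Union> (flags P)"
  proof
    fix F assume "F \<in> Field P"
    then obtain y i where "y \<in> flags P" "-1 \<le> i" "i \<le> int n" "F = face_at P y i" by (rule P.FieldE)
    then have "F \<in> P.flag_of y" "P.flag_of y \<in> flags P" using P.flag_of_mem unfolding P.flag_of_def by auto
    then show "F \<in> \<Union> (flags P)" by blast
  qed
  moreover have "finite y" if y: "y \<in> flags P" for y
  proof -
    from y have "y \<in> P.flag_of ` flags P" using P.flags_eq by simp
    then show ?thesis using P.finite_flag_of by auto
  qed
  ultimately have infP: "infinite (flags P)" using finite_subset finite_Union by metis
  have finQ: "finite (flags Q)" using assms(9) by (rule finite_flags)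
  let ?A = "rotation_system n P \<Psi>" and ?B = "rotation_system n Q \<Omega>"
  have A: "fst ?A = rotation_group n P \<Psi>" "snd ?A = standard_rotation P \<Psi>"
    and B: "fst ?B = rotation_group n Q \<Omega>" "snd ?B = standard_rotation Q \<Omega>"
    unfolding rotation_system_def by simp_all
  have grp: "group (fst ?A)" "group (fst ?B)"
    unfolding A B using rotation_group[OF pP cP \<Psi>] rotation_group[OF pQ cQ \<Omega>] by auto
  interpret D: rotation_data n "mix_group n ?A ?B" "\<lambda>i. (snd ?A i, snd ?B i)"
    using rotation_mem[OF pP cP \<Psi>] rotation_group_relator[OF pP cP \<Psi>]
      rotation_mem[OF pQ cQ \<Omega>] rotation_group_relator[OF pQ cQ \<Omega>] grp n(2)
    by (intro mix_rotation_data) (auto simp: A B)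
  have fst_hom: "fst \<in> hom (mix_group n ?A ?B) (aut_group P)"
    using hom_compose[OF mix_fst_hom[OF grp] rotation_inclusion[OF pP cP \<Psi>, folded A(1)]] by (simp add: comp_def)
  have snd_hom: "snd \<in> hom (mix_group n ?A ?B) (aut_group Q)"
    using hom_compose[OF mix_snd_hom[OF grp] rotation_inclusion[OF pQ cQ \<Omega>, folded B(1)]] by (simp add: comp_def)
  interpret PP: rotation_projection n "mix_group n ?A ?B" "\<lambda>i. (snd ?A i, snd ?B i)" P \<Psi> fst cP
    using fst_hom A(2) by unfold_locales (simp_all add: pP cP \<Psi>)
  interpret QQ: rotation_projection n "mix_group n ?A ?B" "\<lambda>i. (snd ?A i, snd ?B i)" Q \<Omega> snd cQ
    using snd_hom B(2) by unfold_locales (simp_all add: pQ cQ \<Omega>)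
  \<comment> \<open>The mix lies in the direct product, so its elements are known from both
    components; the colour in Q tells the parity.\<close>
  have joint: "x = y" if xy: "x \<in> D.X" "y \<in> D.X" "PP.\<pi> x = PP.\<pi> y" "QQ.\<pi> x = QQ.\<pi> y" for x y
  proof -
    have "snd x = snd y" using QQ.\<pi>_colour[OF xy(1), unfolded xy(4)] QQ.\<pi>_colour[OF xy(2)] by blast
    moreover obtain h e h' e' where e: "x = (h, e)" "y = (h', e')" by (metis prod.exhaust)
    ultimately have e': "e' = e" by simp
    have "fst h = fst h'" "snd h = snd h'"
      using PP.\<pi>_eq[of h h' e] QQ.\<pi>_eq[of h h' e] xy unfolding e e' by auto
    then show ?thesis unfolding e e' by (simp add: prod_eq_iff)
  qed
  have facet_inj: "x = y" if xy: "x \<in> D.X" "y \<in> D.X" "conn D.r {..<m} x y" "QQ.\<pi> x = QQ.\<pi> y" for x y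
  proof -
    obtain w where w: "w \<in> lists {..<m}" "fold D.r w x = y" using xy(3) unfolding conn_def by blast
    have wn: "w \<in> lists {..<n}" using w(1) n(1) by auto
    have fixQ: "fold (adj_flag Q) w (QQ.\<pi> x) = QQ.\<pi> x" using QQ.\<pi>_fold[OF wn xy(1)] w(2) xy(4) by simp
    obtain face where face: "polytope_presentation m (residue (adj_flag Q) m (QQ.\<pi> x)) (adj_flag Q)
        (mix m (rotation_system m K \<Phi>) (mirror_rotation_system m K \<Phi>)) face"
      by (rule facet_presents[OF flags_presentation[OF pQ, unfolded n(1)] assms(12)[folded m_def, unfolded n(1)]
          QQ.\<pi>_mem[OF xy(1)]])
    have fixK: "fold (adj_flag K) w k = k" if "k \<in> flags K" for k
      using mirror_mix_fixed[OF chiK \<Phi> m face w(1) residue_self fixQ that] .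
    obtain h where h: "chamber_iso m (residue (adj_flag P) m (PP.\<pi> x)) (adj_flag P) (flags K) (adj_flag K) h"
      using facet_iso_flags[OF pP[unfolded n(1)] facetsP[unfolded n(1)] PP.\<pi>_mem[OF xy(1)]] by blast
    have "fold (adj_flag P) w (PP.\<pi> x) = PP.\<pi> x"
      using facet_word_fixed[OF pP[unfolded n(1)] facetsP[unfolded n(1)] PP.\<pi>_mem[OF xy(1)] h w(1) residue_self]
        fixK chamber_iso_mem[OF h residue_self] by blast
    then have "PP.\<pi> x = PP.\<pi> y" using PP.\<pi>_fold[OF wn xy(1)] w(2) by simp
    then show ?thesis using joint xy by blast
  qed
  have polytopal: "polytopal_chamber_system n D.X D.r"
    by (rule D.X.quotient_criterion[OF Q.polytopal_chamber_system_axioms n(1), of QQ.\<pi>])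
      (use QQ.\<pi>_mem QQ.\<pi>_step facet_inj in blast)+
  let ?M = "mix n ?A ?B"
  have pres: "polytope_presentation n D.X D.r ?M D.face"
    unfolding mix_eq by (intro polytope_presentation.intro D.coset_presentation polytopal)
  interpret M: polytope_presentation n D.X D.r ?M D.face by (rule pres)
  have "chiral_chambers n D.X D.r" unfolding chiral_chambers_def
  proof (intro conjI ballI allI impI)
    show "0 < n" by (rule n(3))
    show "\<exists>c. rotary_chambers n D.X D.r c" using D.rotary by blast
    fix x f assume x: "x \<in> D.X" and f: "chamber_aut n D.X D.r f"
    show "f x \<noteq> D.r 0 x"
    proof
      assume fx: "f x = D.r 0 x"
      obtain v where v: "v \<in> lists {..<Suc m}" "fold (adj_flag Q) v (QQ.\<pi> x) = QQ.\<pi> x"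
        "fold (adj_flag P) v (adj_flag P 0 (PP.\<pi> x)) = adj_flag P 0 (PP.\<pi> x)"
        "fold (adj_flag P) v (PP.\<pi> x) \<noteq> PP.\<pi> x"
        by (rule separating_word[OF tc \<Phi> pP[unfolded n(1)] facetsP[unfolded n(1)] cP[unfolded n(1)] PP.\<pi>_mem[OF x] infP
              Q.chamber_system_axioms[unfolded n(1)] finQ QQ.\<pi>_mem[OF x]])
      have vn: "v \<in> lists {..<n}" using v(1) n(1) by simp
      have rx: "D.r 0 x \<in> D.X" using D.X.closed[OF n(3) x] .
      \<comment> \<open>As Q is regular, \<open>v\<close> fixes the 0-adjacent flag of Q along with
        the flag itself; in P it fixes the 0-adjacent flag only. So \<open>v\<close> fixes the
        0-neighbour of \<open>x\<close> but not \<open>x\<close>, which is impossible if an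
        automorphism takes one to the other.\<close>
      obtain fQ where fQ: "chamber_aut n (flags Q) (adj_flag Q) fQ" "fQ (QQ.\<pi> x) = adj_flag Q 0 (QQ.\<pi> x)"
        using dQ QQ.\<pi>_mem[OF x] Q.closed[OF n(3) QQ.\<pi>_mem[OF x]] unfolding directly_regular_chambers_def by blast
      have "fold (adj_flag Q) v (adj_flag Q 0 (QQ.\<pi> x)) = adj_flag Q 0 (QQ.\<pi> x)"
        using Q.chamber_aut_fold_fixed[OF fQ(1) vn QQ.\<pi>_mem[OF x]] v(2) fQ(2) by simp
      then have "fold D.r v (D.r 0 x) = D.r 0 x"
        using joint[OF D.X.fold_closed[OF vn rx] rx] PP.\<pi>_fold[OF vn rx] QQ.\<pi>_fold[OF vn rx]
          PP.\<pi>_step[OF n(3) x] QQ.\<pi>_step[OF n(3) x] v(3) by simp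
      then have "fold D.r v x = x" using D.X.chamber_aut_fold_fixed[OF f vn x] fx by simp
      then show False using v(4) PP.\<pi>_fold[OF vn x] by simp
    qed
  qed
  then have "chiral_polytope n ?M" using M.chiral_iff by blast
  moreover have "facets_directly_regular n ?M" unfolding facets_directly_regular_def
  proof (intro ballI impI)
    fix F assume F: "F \<in> Field ?M" "face_rank ?M F = int n - 1"
    then obtain x where x: "x \<in> D.X" "F = D.face x (int n - 1)" using M.face_rank_eqE by blast
    have Fx: "F = D.face x (int m)" using x(2) n(1) by simp
    have mn: "m \<le> n" "0 < m" using n m by auto
    interpret F: polytope_presentation m "residue D.r m x" D.r "facet ?M F" D.face
      unfolding Fx by (rule facet_presentation[of m D.X D.r ?M D.face x, folded n(1), OF pres x(1)])
    have "directly_regular_chambers m (residue (adj_flag Q) m (QQ.\<pi> x)) (adj_flag Q)"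
      by (rule Q.directly_regular_residue[OF mn(1) QQ.\<pi>_mem[OF x(1)] dQ])
    moreover have "chamber_iso m (residue D.r m x) D.r (residue (adj_flag Q) m (QQ.\<pi> x)) (adj_flag Q) QQ.\<pi>"
      by (rule residue_iso[OF D.coset_chamber_system Q.chamber_system_axioms mn(1) x(1)])
        (use QQ.\<pi>_mem QQ.\<pi>_step facet_inj in blast)+
    ultimately have "directly_regular_chambers m (residue D.r m x) D.r"
      using directly_regular_chambers_transfer[OF F.chamber_system_axioms] by blast
    then show "directly_regular (n - 1) (facet ?M F)" using F.directly_regular_iff[OF mn(2)] n(1) by simp
  qed
  ultimately show ?thesis by blast
qed

end
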